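(* Let $(\mathcal A,\nabla,\sigma)$ be a differential structure whose quantum Markov semigroup $(\mathscr P_t)_t$ is ergodic, and suppose that $\mathrm{Ric}(\mathcal A,\nabla,\sigma)\ge\lambda$ for some $\lambda>0$. Then the modified logarithmic Sobolev inequality $\mathrm{MLSI}(\lambda)$ holds: for all $\rho\in\mathfrak P$, $$\mathrm{Ent}_\sigma(\rho)\le\frac1{2\lambda}\,\mathcal I_\sigma(\rho).$$
   Context: Differential structure $(\mathcal A,\nabla,\sigma)$: $\mathcal A$ is a finite-dimensional von Neumann algebra with faithful tracial positive linear functional $\tau$, together with (1) a finite index set $\mathcal J$ and, for each $j\in\mathcal J$, a finite-dimensional von Neumann algebra $\mathcal B_j$ with faithful tracial positive linear functional $\tau_j$; (2) for each $j$, unital $*$-homomorphisms $\ell_j,r_j:\mathcal A\to\mathcal B_j$ with $\tau_j(\ell_j(A))=\tau_j(r_j(A))=\tau(A)$ for all $A\in\mathcal A$, and a non-zero $V_j\in\mathcal B_j$; (3) for each $j$ there is a unique $j^*\in\mathcal J$ with $V_{j^*}=V_j^*$, and $\mathcal B_{j^*}=\mathcal B_j$, $\tau_{j^*}=\tau_j$; moreover $\tau_j[V_j^*\ell_j(A_1)V_jr_j(A_2)]=\tau_j[V_j^*r_{j^*}(A_1)V_j\ell_{j^*}(A_2)]$ for all $A_1,A_2\in\mathcal A$; (4) an invertible density matrix $\sigma\in\mathcal A$ and numbers $\omega_j\in\mathbb R$ with $\ell_j(\sigma)V_jr_j(\sigma)^{-1}=e^{-\omega_j}V_j$. Set $\partial_jA:=V_jr_j(A)-\ell_j(A)V_j\in\mathcal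 B_j$, $\nabla A:=(\partial_jA)_{j\in\mathcal J}$. The associated generator $\mathscr L$ is defined by $\sum_{j}\tau_j[(\partial_jA_1)^*\ell_j(\sigma^{1/2})(\partial_jA_2)r_j(\sigma^{1/2})]=-\tau[A_1^*\sigma^{1/2}(\mathscr LA_2)\sigma^{1/2}]$ for all $A_1,A_2\in\mathcal A$; $\mathscr P_t=e^{t\mathscr L}$; $\dagger$ denotes adjoints with respect to $\tau[A^*B]$ on $\mathcal A$ and $\tau_j[A^*B]$ on $\mathcal B_j$. Ergodic means $\ker\mathscr L=\mathrm{lin}\{\mathbf 1\}$. $\mathfrak P$ (resp. $\mathfrak P_+$): positive semidefinite (resp. positive definite) $\rho\in\mathcal A$ with $\tau[\rho]=1$. $\mathcal A_0:=\{A\in\mathcal A: A=A^*,\ \tau[A]=0\}$. Put $\theta_j(r,s):=\Lambda(e^{\omega_j/2}r,e^{-\omega_j/2}s)$ with $\Lambda(r,s)=\frac{r-s}{\log r-\log s}$, $\Lambda(r,r)=r$, extended continuously to $[0,\infty)^2$. For $\rho=\sum_k\lambda_kE_k$ (spectral decomposition), $\widehat\rho_j:=\sum_{k,m}\theta_j(\lambda_k,\lambda_m)\ell_j(E_k)\otimes r_j(E_m)$, $(A\otimes B)\#C:=ACB$, and $\mathscr K_\rho A:=\sum_j\partial_j^\dagger(\widehat\rho_j\#\partial_jA)$. For $\rho\in\mathfrak P_+$, $\mathscr K_\rho$ is a bijection of $\mathcal A_0$ and defines the Riemannian metric $g_\rho(x,y)=\tau[(\mathscr K_\rho^{-1}x)y]$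 on $\mathfrak P_+$. $\mathcal W$ is its Riemannian distance, $\mathcal W(\rho_0,\rho_1)^2=\inf\int_0^1\tau[A_t\mathscr K_{\rho_t}A_t]\,dt$ over smooth curves $(\rho_t)$ in $\mathfrak P_+$ from $\rho_0$ to $\rho_1$ and $(A_t)$ in $\mathcal A_0$ with $\partial_t\rho_t=\mathscr K_{\rho_t}A_t$; $\mathcal W$ extends continuously to a metric on $\mathfrak P$. $\mathrm{Ent}_\sigma(\rho)=\tau[\rho(\log\rho-\log\sigma)]$; $\mathcal I_\sigma(\rho)=-\tau[(\log\rho-\log\sigma)\mathscr L^\dagger\rho]$ for $\rho\in\mathfrak P_+$, with the convention $\mathcal I_\sigma(\rho)=+\infty$ for $\rho\in\mathfrak P\setminus\mathfrak P_+$. $\mathrm{Ric}(\mathcal A,\nabla,\sigma)\ge\lambda$ means that the following equivalent conditions hold: (i) any two points of $\mathfrak P$ are joined by a constant speed $\mathcal W$-geodesic $(\gamma_t)_{t\in[0,1]}$ with $\mathrm{Ent}_\sigma(\gamma_t)\le(1-t)\mathrm{Ent}_\sigma(\gamma_0)+t\,\mathrm{Ent}_\sigma(\gamma_1)-\frac\lambda2t(1-t)\mathcal W(\gamma_0,\gamma_1)^2$; (ii) the same inequality holds along every constant speed geodesic; (iii) for all $\rho,\nu\in\mathfrak P$ and $t\ge0$, $\frac12\frac{d^+}{dt}\mathcal W^2(\mathscr P_t^\dagger\rho,\nu)+\frac\lambda2\mathcal W^2(\mathscr P_t^\dagger\rho,\nu)\le\mathrm{Ent}_\sigma(\nu)-\mathrm{Ent}_\sigma(\mathscr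 P_t^\dagger\rho)$, where $\frac{d^+}{dt}f(t)=\limsup_{h\downarrow0}\frac{f(t+h)-f(t)}h$; (iv) $\frac{d^2}{ds^2}|_{s=0}\mathrm{Ent}_\sigma(\rho_s)\ge\lambda\,\tau[A\mathscr K_\rho A]$ for all $\rho\in\mathfrak P_+$, $A\in\mathcal A_0$, where $(\rho_s)$ is the Riemannian geodesic with $\rho_0=\rho$, $\dot\rho_0=\mathscr K_\rho A$. *)

theory Defs
  imports "HOL-Analysis.Analysis"
begin

section \<open>Matrices\<close>

type_synonym 'n cmat = "complex^'n^'n"

definition mstar :: "complex^'n^'m \<Rightarrow> complex^'m^'n" where
  "mstar X = (\<chi> i j. cnj (X $ j $ i))"

definition cscale :: "complex \<Rightarrow> complex^'n^'m \<Rightarrow> complex^'n^'m" where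
  "cscale c X = (\<chi> i j. c * X $ i $ j)"

text \<open>On \<open>complex^'n\<close> the library's \<open>\<bullet>\<close> is the real part of the usual Hermitian inner product;
  for self-adjoint \<open>X\<close> the number \<open>\<langle>v, X v\<rangle>\<close> is real, so nothing is lost.\<close>

definition psd :: "'n::finite cmat \<Rightarrow> bool" where
  "psd X \<longleftrightarrow> mstar X = X \<and> (\<forall>v. 0 \<le> v \<bullet> (X *v v))"

definition posdef :: "'n::finite cmat \<Rightarrow> bool" where
  "posdef X \<longleftrightarrow> mstar X = X \<and> (\<forall>v. v \<noteq> 0 \<longrightarrow> 0 < v \<bullet> (X *v v))"

text \<open>Spectral decomposition \<open>X = (\<Sum>l\<in>eigvals X. l *\<^sub>R specproj X l)\<close> of a self-adjoint matrix, and the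
  resulting functional calculus.\<close>

definition eigvals :: "'n::finite cmat \<Rightarrow> real set" where
  "eigvals X = {l. \<exists>v. v \<noteq> 0 \<and> X *v v = l *\<^sub>R v}"

definition specproj :: "'n::finite cmat \<Rightarrow> real \<Rightarrow> 'n cmat" where
  "specproj X l = (THE P. mstar P = P \<and> P ** P = P \<and> range ((*v) P) = {v. X *v v = l *\<^sub>R v})"

definition fcalc :: "(real \<Rightarrow> real) \<Rightarrow> 'n::finite cmat \<Rightarrow> 'n cmat" where
  "fcalc f X = (\<Sum>l\<in>eigvals X. f l *\<^sub>R specproj X l)"

section \<open>Finite-dimensional von Neumann algebras\<close>

text \<open>A \<open>*\<close>-algebra of matrices is automatically finite-dimensional and weakly closed, hence a von
  Neumann algebra as soon as it has a unit. The unit is not required to be \<open>mat 1\<close>: it is a projection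
  \<open>p\<close>, and the algebra acts on the Hilbert space \<open>range p\<close>. In this way algebras acting on Hilbert
  spaces of different dimensions live in a common matrix type.\<close>

definition is_unit_of :: "'n::finite cmat set \<Rightarrow> 'n cmat \<Rightarrow> bool" where
  "is_unit_of S e \<longleftrightarrow> e \<in> S \<and> (\<forall>X\<in>S. e ** X = X \<and> X ** e = X)"

definition vn_unit :: "'n::finite cmat set \<Rightarrow> 'n cmat" where
  "vn_unit S = (THE e. is_unit_of S e)"

definition vn_algebra :: "'n::finite cmat set \<Rightarrow> bool" where
  "vn_algebra S \<longleftrightarrow>
     (\<forall>X\<in>S. \<forall>Y\<in>S. X + Y \<in> S) \<and> (\<forall>c. \<forall>X\<in>S. cscale c X \<in> S) \<and>
     (\<forall>X\<in>S. \<forall>Y\<in>S. X ** Y \<in> S) \<and> (\<forall>X\<in>S. mstar X \<in> S) \<and> (\<exists>e. is_unit_of S e)"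

definition faithful_trace :: "'n::finite cmat set \<Rightarrow> ('n cmat \<Rightarrow> complex) \<Rightarrow> bool" where
  "faithful_trace S t \<longleftrightarrow>
     (\<forall>X\<in>S. \<forall>Y\<in>S. t (X + Y) = t X + t Y) \<and> (\<forall>c. \<forall>X\<in>S. t (cscale c X) = c * t X) \<and>
     (\<forall>X\<in>S. \<forall>Y\<in>S. t (X ** Y) = t (Y ** X)) \<and>
     (\<forall>X\<in>S. t (mstar X ** X) \<in> \<real>\<^sub>\<ge>\<^sub>0) \<and>
     (\<forall>X\<in>S. t (mstar X ** X) = 0 \<longrightarrow> X = 0)"

definition unital_star_hom ::
    "'n::finite cmat set \<Rightarrow> 'm::finite cmat set \<Rightarrow> ('n cmat \<Rightarrow> 'm cmat) \<Rightarrow> bool" where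
  "unital_star_hom S T h \<longleftrightarrow>
     (\<forall>X\<in>S. h X \<in> T) \<and>
     (\<forall>X\<in>S. \<forall>Y\<in>S. h (X + Y) = h X + h Y) \<and> (\<forall>c. \<forall>X\<in>S. h (cscale c X) = cscale c (h X)) \<and>
     (\<forall>X\<in>S. \<forall>Y\<in>S. h (X ** Y) = h X ** h Y) \<and> (\<forall>X\<in>S. h (mstar X) = mstar (h X)) \<and>
     h (vn_unit S) = vn_unit T"

text \<open>Value at \<open>Y\<close> of the adjoint of \<open>F : S \<rightarrow> T\<close> for the inner products \<open>t (mstar X ** Y)\<close> on \<open>S\<close> and
  \<open>u (mstar X ** Y)\<close> on \<open>T\<close>.\<close>

definition trace_adjoint :: "'n::finite cmat set \<Rightarrow> ('n cmat \<Rightarrow> complex) \<Rightarrow> ('m::finite cmat \<Rightarrow> complex)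
    \<Rightarrow> ('n cmat \<Rightarrow> 'm cmat) \<Rightarrow> 'm cmat \<Rightarrow> 'n cmat" where
  "trace_adjoint S t u F Y = (THE X. X \<in> S \<and> (\<forall>Z\<in>S. t (mstar X ** Z) = u (mstar Y ** F Z)))"

section \<open>Differential structures\<close>

record ('n, 'm, 'j) diff_struct =
  Alg :: "'n cmat set"
  Tr :: "'n cmat \<Rightarrow> complex"
  Idx :: "'j set"
  BAlg :: "'j \<Rightarrow> 'm cmat set"
  BTr :: "'j \<Rightarrow> 'm cmat \<Rightarrow> complex"
  lhom :: "'j \<Rightarrow> 'n cmat \<Rightarrow> 'm cmat"
  rhom :: "'j \<Rightarrow> 'n cmat \<Rightarrow> 'm cmat"
  Vel :: "'j \<Rightarrow> 'm cmat"
  sig :: "'n cmat"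
  omg :: "'j \<Rightarrow> real"

definition states :: "('n::finite, 'm::finite, 'j) diff_struct \<Rightarrow> 'n cmat set" where
  "states D = {\<rho> \<in> Alg D. psd \<rho> \<and> Tr D \<rho> = 1}"

definition pos_states :: "('n::finite, 'm::finite, 'j) diff_struct \<Rightarrow> 'n cmat set" where
  "pos_states D = {\<rho> \<in> Alg D. posdef \<rho> \<and> Tr D \<rho> = 1}"

definition Alg0 :: "('n::finite, 'm::finite, 'j) diff_struct \<Rightarrow> 'n cmat set" where
  "Alg0 D = {X \<in> Alg D. mstar X = X \<and> Tr D X = 0}"

definition is_conj_index :: "('n::finite, 'm::finite, 'j) diff_struct \<Rightarrow> 'j \<Rightarrow> 'j \<Rightarrow> bool" where
  "is_conj_index D j k \<longleftrightarrow> k \<in> Idx D \<and> BAlg D k = BAlg D j \<and> Vel D k = mstar (Vel D j)"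

text \<open>In the last condition \<open>r\<^sub>j(\<sigma>)\<close> is inverted in the algebra \<open>B\<^sub>j\<close>, whose unit need not be \<open>mat 1\<close>;
  since \<open>r\<^sub>j\<close> is unital this inverse is \<open>r\<^sub>j(\<sigma>\<^sup>-\<^sup>1)\<close>.\<close>

definition differential_structure :: "('n::finite, 'm::finite, 'j) diff_struct \<Rightarrow> bool" where
  "differential_structure D \<longleftrightarrow>
     vn_algebra (Alg D) \<and> mat 1 \<in> Alg D \<and> faithful_trace (Alg D) (Tr D) \<and>
     finite (Idx D) \<and>
     (\<forall>j\<in>Idx D.
        vn_algebra (BAlg D j) \<and> faithful_trace (BAlg D j) (BTr D j) \<and>
        unital_star_hom (Alg D) (BAlg D j) (lhom D j) \<and>
        unital_star_hom (Alg D) (BAlg D j) (rhom D j) \<and>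
        (\<forall>X\<in>Alg D. BTr D j (lhom D j X) = Tr D X \<and> BTr D j (rhom D j X) = Tr D X) \<and>
        Vel D j \<in> BAlg D j \<and> Vel D j \<noteq> 0) \<and>
     (\<forall>j\<in>Idx D.
        (\<exists>!k. is_conj_index D j k) \<and>
        (\<forall>k. is_conj_index D j k \<longrightarrow>
           (\<forall>Y\<in>BAlg D j. BTr D k Y = BTr D j Y) \<and>
           (\<forall>X1\<in>Alg D. \<forall>X2\<in>Alg D.
              BTr D j (mstar (Vel D j) ** lhom D j X1 ** Vel D j ** rhom D j X2) =
              BTr D j (mstar (Vel D j) ** rhom D k X1 ** Vel D j ** lhom D k X2)))) \<and>
     sig D \<in> states D \<and> invertible (sig D) \<and>
     (\<forall>j\<in>Idx D. lhom D j (sig D) ** Vel D j ** rhom D j (matrix_inv (sig D))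
                 = exp (- omg D j) *\<^sub>R Vel D j)"

definition pd :: "('n::finite, 'm::finite, 'j) diff_struct \<Rightarrow> 'j \<Rightarrow> 'n cmat \<Rightarrow> 'm cmat" where
  "pd D j X = Vel D j ** rhom D j X - lhom D j X ** Vel D j"

definition pd_adj :: "('n::finite, 'm::finite, 'j) diff_struct \<Rightarrow> 'j \<Rightarrow> 'm cmat \<Rightarrow> 'n cmat" where
  "pd_adj D j = trace_adjoint (Alg D) (Tr D) (BTr D j) (pd D j)"

section \<open>The semigroup\<close>

definition gen :: "('n::finite, 'm::finite, 'j) diff_struct \<Rightarrow> 'n cmat \<Rightarrow> 'n cmat" where
  "gen D X2 = (THE Y. Y \<in> Alg D \<and> (\<forall>X1\<in>Alg D.
     (\<Sum>j\<in>Idx D. BTr D j (mstar (pd D j X1) ** lhom D j (fcalc sqrt (sig D)) ** pd D j X2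
                          ** rhom D j (fcalc sqrt (sig D))))
     = - Tr D (mstar X1 ** fcalc sqrt (sig D) ** Y ** fcalc sqrt (sig D))))"

definition gen_adj :: "('n::finite, 'm::finite, 'j) diff_struct \<Rightarrow> 'n cmat \<Rightarrow> 'n cmat" where
  "gen_adj D = trace_adjoint (Alg D) (Tr D) (Tr D) (gen D)"

definition semigrp :: "('n::finite, 'm::finite, 'j) diff_struct \<Rightarrow> real \<Rightarrow> 'n cmat \<Rightarrow> 'n cmat" where
  "semigrp D t X = (\<Sum>n. (t ^ n / fact n) *\<^sub>R (gen D ^^ n) X)"

definition semigrp_adj :: "('n::finite, 'm::finite, 'j) diff_struct \<Rightarrow> real \<Rightarrow> 'n cmat \<Rightarrow> 'n cmat" where
  "semigrp_adj D t = trace_adjoint (Alg D) (Tr D) (Tr D) (semigrp D t)"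

definition ergodic :: "('n::finite, 'm::finite, 'j) diff_struct \<Rightarrow> bool" where
  "ergodic D \<longleftrightarrow> {X \<in> Alg D. gen D X = 0} = range (\<lambda>c. cscale c (mat 1))"

section \<open>The Riemannian metric and the transport distance\<close>

text \<open>The logarithmic mean on \<open>[0,\<infinity>)\<^sup>2\<close>; its continuous extension vanishes on the boundary.\<close>

definition log_mean :: "real \<Rightarrow> real \<Rightarrow> real" where
  "log_mean r s = (if r = 0 \<or> s = 0 then 0 else if r = s then r else (r - s) / (ln r - ln s))"

definition theta :: "('n::finite, 'm::finite, 'j) diff_struct \<Rightarrow> 'j \<Rightarrow> real \<Rightarrow> real \<Rightarrow> real" where
  "theta D j r s = log_mean (exp (omg D j / 2) * r) (exp (- omg D j / 2) * s)"

text \<open>\<open>hat_op D j \<rho> C\<close> is the contraction of \<open>\<rho>\<close>-hat with \<open>C\<close>.\<close>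

definition hat_op ::
    "('n::finite, 'm::finite, 'j) diff_struct \<Rightarrow> 'j \<Rightarrow> 'n cmat \<Rightarrow> 'm cmat \<Rightarrow> 'm cmat" where
  "hat_op D j \<rho> C = (\<Sum>k\<in>eigvals \<rho>. \<Sum>m\<in>eigvals \<rho>.
     theta D j k m *\<^sub>R (lhom D j (specproj \<rho> k) ** C ** rhom D j (specproj \<rho> m)))"

definition Kop :: "('n::finite, 'm::finite, 'j) diff_struct \<Rightarrow> 'n cmat \<Rightarrow> 'n cmat \<Rightarrow> 'n cmat" where
  "Kop D \<rho> X = (\<Sum>j\<in>Idx D. pd_adj D j (hat_op D j \<rho> (pd D j X)))"

definition gmet ::
    "('n::finite, 'm::finite, 'j) diff_struct \<Rightarrow> 'n cmat \<Rightarrow> 'n cmat \<Rightarrow> 'n cmat \<Rightarrow> real" where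
  "gmet D \<rho> X Y = Re (Tr D (inv_into (Alg0 D) (Kop D \<rho>) X ** Y))"

definition smooth_curve :: "(real \<Rightarrow> 'a::real_normed_vector) \<Rightarrow> bool" where
  "smooth_curve c \<longleftrightarrow> (\<exists>d :: nat \<Rightarrow> real \<Rightarrow> 'a. d 0 = c \<and>
     (\<forall>k. \<forall>t\<in>{0..1}. (d k has_vector_derivative d (Suc k) t) (at t within {0..1})))"

definition admissible :: "('n::finite, 'm::finite, 'j) diff_struct \<Rightarrow> 'n cmat \<Rightarrow> 'n cmat
    \<Rightarrow> (real \<Rightarrow> 'n cmat) \<Rightarrow> (real \<Rightarrow> 'n cmat) \<Rightarrow> bool" where
  "admissible D \<rho>0 \<rho>1 \<rho> A \<longleftrightarrow>
     smooth_curve \<rho> \<and> smooth_curve A \<and> \<rho> 0 = \<rho>0 \<and> \<rho> 1 = \<rho>1 \<and>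
     (\<forall>t\<in>{0..1}. \<rho> t \<in> pos_states D \<and> A t \<in> Alg0 D \<and>
        (\<rho> has_vector_derivative Kop D (\<rho> t) (A t)) (at t within {0..1}))"

definition Wpos :: "('n::finite, 'm::finite, 'j) diff_struct \<Rightarrow> 'n cmat \<Rightarrow> 'n cmat \<Rightarrow> real" where
  "Wpos D \<rho>0 \<rho>1 = sqrt (Inf {integral {0..1} (\<lambda>t. Re (Tr D (A t ** Kop D (\<rho> t) (A t)))) |
                              \<rho> A. admissible D \<rho>0 \<rho>1 \<rho> A})"

text \<open>The continuous extension of the distance from positive definite to arbitrary states.\<close>

definition Wdist :: "('n::finite, 'm::finite, 'j) diff_struct \<Rightarrow> 'n cmat \<Rightarrow> 'n cmat \<Rightarrow> real" where
  "Wdist D \<rho> \<nu> =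
     (if \<rho> \<in> pos_states D \<and> \<nu> \<in> pos_states D then Wpos D \<rho> \<nu>
      else Lim (at (\<rho>, \<nu>) within pos_states D \<times> pos_states D) (\<lambda>(x, y). Wpos D x y))"

section \<open>Entropy and Fisher information\<close>

text \<open>As \<open>ln 0 = 0\<close> in HOL, \<open>\<rho> ** fcalc ln \<rho>\<close> follows the convention \<open>0 log 0 = 0\<close> for singular \<open>\<rho>\<close>.
  The traces in question are real.\<close>

definition Ent :: "('n::finite, 'm::finite, 'j) diff_struct \<Rightarrow> 'n cmat \<Rightarrow> real" where
  "Ent D \<rho> = Re (Tr D (\<rho> ** (fcalc ln \<rho> - fcalc ln (sig D))))"

definition Fisher :: "('n::finite, 'm::finite, 'j) diff_struct \<Rightarrow> 'n cmat \<Rightarrow> ereal" where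
  "Fisher D \<rho> =
     (if \<rho> \<in> pos_states D
      then ereal (- Re (Tr D ((fcalc ln \<rho> - fcalc ln (sig D)) ** gen_adj D \<rho>)))
      else \<infinity>)"

section \<open>Ricci curvature bounds\<close>

definition const_speed_geodesic ::
    "('n::finite, 'm::finite, 'j) diff_struct \<Rightarrow> (real \<Rightarrow> 'n cmat) \<Rightarrow> bool" where
  "const_speed_geodesic D \<gamma> \<longleftrightarrow>
     (\<forall>t\<in>{0..1}. \<gamma> t \<in> states D) \<and>
     (\<forall>s\<in>{0..1}. \<forall>t\<in>{0..1}. Wdist D (\<gamma> s) (\<gamma> t) = \<bar>s - t\<bar> * Wdist D (\<gamma> 0) (\<gamma> 1))"

definition Ent_convex_along ::
    "('n::finite, 'm::finite, 'j) diff_struct \<Rightarrow> real \<Rightarrow> (real \<Rightarrow> 'n cmat) \<Rightarrow> bool" where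
  "Ent_convex_along D lam \<gamma> \<longleftrightarrow>
     (\<forall>t\<in>{0..1}. Ent D (\<gamma> t) \<le> (1 - t) * Ent D (\<gamma> 0) + t * Ent D (\<gamma> 1)
                   - lam / 2 * t * (1 - t) * (Wdist D (\<gamma> 0) (\<gamma> 1))\<^sup>2)"

definition upper_right_deriv :: "(real \<Rightarrow> real) \<Rightarrow> real \<Rightarrow> ereal" where
  "upper_right_deriv f t = Limsup (at_right 0) (\<lambda>h. ereal ((f (t + h) - f t) / h))"

text \<open>The metric lives on an open subset of an affine space with direction \<open>Alg0 D\<close>. In this flat chart
  the Christoffel symbols of the Levi-Civita connection are given by
  \<open>g(\<Gamma>(x,x), B) = (D\<^sub>x g)(x, B) - (D\<^sub>B g)(x, x) / 2\<close> for constant vector fields \<open>B\<close>, and the geodesic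
  equation is \<open>\<gamma>'' + \<Gamma>(\<gamma>', \<gamma>') = 0\<close>.\<close>

definition gmet_deriv :: "('n::finite, 'm::finite, 'j) diff_struct \<Rightarrow> 'n cmat \<Rightarrow> 'n cmat
    \<Rightarrow> 'n cmat \<Rightarrow> 'n cmat \<Rightarrow> real" where
  "gmet_deriv D \<rho> Z X Y = deriv (\<lambda>e. gmet D (\<rho> + e *\<^sub>R Z) X Y) 0"

definition riemannian_geodesic ::
    "('n::finite, 'm::finite, 'j) diff_struct \<Rightarrow> real set \<Rightarrow> (real \<Rightarrow> 'n cmat) \<Rightarrow> bool" where
  "riemannian_geodesic D S \<gamma> \<longleftrightarrow> (\<exists>v a. \<forall>s\<in>S.
     \<gamma> s \<in> pos_states D \<and>
     (\<gamma> has_vector_derivative v s) (at s) \<and> (v has_vector_derivative a s) (at s) \<and>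
     (\<forall>B\<in>Alg0 D. gmet D (\<gamma> s) (a s) B + gmet_deriv D (\<gamma> s) (v s) (v s) B
                   - gmet_deriv D (\<gamma> s) B (v s) (v s) / 2 = 0))"

definition Ric_geodesic_convex :: "('n::finite, 'm::finite, 'j) diff_struct \<Rightarrow> real \<Rightarrow> bool" where
  "Ric_geodesic_convex D lam \<longleftrightarrow>
     (\<forall>\<rho>\<in>states D. \<forall>\<nu>\<in>states D. \<exists>\<gamma>. const_speed_geodesic D \<gamma> \<and> \<gamma> 0 = \<rho> \<and> \<gamma> 1 = \<nu> \<and>
        Ent_convex_along D lam \<gamma>)"

definition Ric_all_geodesics_convex :: "('n::finite, 'm::finite, 'j) diff_struct \<Rightarrow> real \<Rightarrow> bool" where
  "Ric_all_geodesics_convex D lam \<longleftrightarrow>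
     (\<forall>\<gamma>. const_speed_geodesic D \<gamma> \<longrightarrow> Ent_convex_along D lam \<gamma>)"

definition Ric_EVI :: "('n::finite, 'm::finite, 'j) diff_struct \<Rightarrow> real \<Rightarrow> bool" where
  "Ric_EVI D lam \<longleftrightarrow>
     (\<forall>\<rho>\<in>states D. \<forall>\<nu>\<in>states D. \<forall>t\<ge>0.
        ereal (1 / 2) * upper_right_deriv (\<lambda>s. (Wdist D (semigrp_adj D s \<rho>) \<nu>)\<^sup>2) t
          + ereal (lam / 2 * (Wdist D (semigrp_adj D t \<rho>) \<nu>)\<^sup>2)
        \<le> ereal (Ent D \<nu> - Ent D (semigrp_adj D t \<rho>)))"

definition Ric_Hessian :: "('n::finite, 'm::finite, 'j) diff_struct \<Rightarrow> real \<Rightarrow> bool" where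
  "Ric_Hessian D lam \<longleftrightarrow>
     (\<forall>\<rho>\<in>pos_states D. \<forall>A\<in>Alg0 D. \<forall>e>0. \<forall>\<gamma>.
        riemannian_geodesic D {-e<..<e} \<gamma> \<and> \<gamma> 0 = \<rho> \<and>
        (\<gamma> has_vector_derivative Kop D \<rho> A) (at 0) \<longrightarrow>
        (deriv ^^ 2) (\<lambda>s. Ent D (\<gamma> s)) 0 \<ge> lam * Re (Tr D (A ** Kop D \<rho> A)))"

text \<open>The four conditions are equivalent for (ergodic) differential structures; the curvature bound
  means that they hold.\<close>

definition Ric_ge :: "('n::finite, 'm::finite, 'j) diff_struct \<Rightarrow> real \<Rightarrow> bool" where
  "Ric_ge D lam \<longleftrightarrow> Ric_geodesic_convex D lam \<and> Ric_all_geodesics_convex D lam \<and>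
     Ric_EVI D lam \<and> Ric_Hessian D lam"

end

theory Submission
  imports Defs
begin

text \<open>Why a positive curvature bound implies the modified logarithmic Sobolev inequality. Let \<open>\<rho>\<close> be positive
  definite, put \<open>X = log \<rho> - log \<sigma>\<close>, let \<open>W\<close> be the distance from \<open>\<rho>\<close> to \<open>\<sigma>\<close>, and let \<open>I\<close> be the Fisher
  information of \<open>\<rho>\<close>. Take a geodesic \<open>\<gamma>\<close> from \<open>\<rho>\<close> to \<open>\<sigma>\<close> along which the entropy is convex. Since the entropy
  of \<open>\<sigma>\<close> is \<open>0\<close>, convexity gives \<open>Ent(\<gamma> t) \<le> (1 - t) Ent(\<rho>) - \<lambda>/2 t (1 - t) W\<^sup>2\<close>. On the other hand the
  entropy lies above its tangent, \<open>Ent(\<gamma> t) \<ge> Ent(\<rho>) + \<tau>[X (\<gamma> t - \<rho>)]\<close> (\<open>Ent_tangent\<close>, from Klein's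
  inequality). The tangent term is estimated along an almost optimal curve from \<open>\<rho>\<close> to \<open>\<gamma> t\<close>: its derivative is
  \<open>\<tau>[X K A]\<close>, and the Cauchy-Schwarz inequality for the form of \<open>K\<close> bounds its modulus by roughly
  \<open>t W sqrt(\<tau>[X K\<^sub>\<rho> X])\<close> (\<open>curve_estimate\<close>). The chain rule for the logarithmic mean identifies
  \<open>\<tau>[X K\<^sub>\<rho> X]\<close> with \<open>I\<close> (\<open>chain_rule\<close>, \<open>Fisher_qform\<close>). Dividing by \<open>t\<close> and letting \<open>t\<close> tend to \<open>0\<close>
  yields \<open>Ent(\<rho>) \<le> W sqrt(I) - \<lambda>/2 W\<^sup>2 \<le> I / (2\<lambda>)\<close>. The Cauchy-Schwarz inequality and the last
  inequality are merged into one arithmetic-geometric mean inequality with weight \<open>t / \<lambda>\<close>.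

  Two local facts about the distance enter. First, curves of small action stay near their starting point
  (\<open>displacement_bounded_by_action\<close>), which keeps both \<open>\<gamma> t\<close> and the almost optimal curves among positive
  definite states near \<open>\<rho>\<close>. Second, \<open>\<tau>[X K\<^sub>\<nu> X]\<close> is continuous in \<open>\<nu>\<close> (\<open>qform_continuous\<close>), because the
  logarithmic mean is a uniform limit of polynomials on compact sets of positive pairs.

  The distance is the square root of an infimum of actions, continued to the boundary by a limit. Where there are no
  curves or no limit, it takes one of finitely many default values. The distance from \<open>\<rho>\<close> to \<open>\<gamma> t\<close> is
  \<open>t W\<close>, so for nonzero \<open>W\<close> it takes each value at most once and is genuine for small \<open>t\<close>. If \<open>W\<close> vanishes, a
  degenerate geodesic forces the entropy of \<open>\<rho>\<close> to be nonpositive (\<open>Ent_nonpos_of_zero_distance\<close>).\<close>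

section \<open>Matrix arithmetic\<close>

lemma mstar_mstar [simp]: "mstar (mstar X) = X"
  by (simp add: mstar_def vec_eq_iff)

lemma mstar_add: "mstar (X + Y) = mstar X + mstar Y"
  by (simp add: mstar_def vec_eq_iff)

lemma mstar_diff: "mstar (X - Y) = mstar X - mstar Y"
  by (simp add: mstar_def vec_eq_iff)

lemma mstar_scaleR: "mstar (c *\<^sub>R X) = c *\<^sub>R mstar X"
  by (simp add: mstar_def vec_eq_iff)

lemma mstar_zero [simp]: "mstar 0 = 0"
  by (simp add: mstar_def vec_eq_iff)

lemma mstar_cscale: "mstar (cscale c X) = cscale (cnj c) (mstar X)"
  by (simp add: mstar_def cscale_def vec_eq_iff)

lemma mstar_mult: "mstar (X ** Y) = mstar Y ** mstar X"
  by (simp add: mstar_def matrix_matrix_mult_def vec_eq_iff mult.commute)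

lemma mstar_one [simp]: "mstar (mat 1) = mat 1"
  by (auto simp: mstar_def mat_def vec_eq_iff)

lemma mstar_sum: "mstar (sum f I) = (\<Sum>i\<in>I. mstar (f i))"
  by (induction I rule: infinite_finite_induct) (auto simp: mstar_add)

lemma bounded_linear_mstar: "bounded_linear (mstar :: complex^'n^'m \<Rightarrow> complex^'m^'n)"
  using linearI[of "mstar :: complex^'n^'m \<Rightarrow> complex^'m^'n"]
  by (simp add: linear_conv_bounded_linear mstar_add mstar_scaleR)

lemma cscale_of_real: "cscale (complex_of_real c) X = c *\<^sub>R X"
  by (simp add: cscale_def vec_eq_iff scaleR_conv_of_real[where 'a = complex])

lemma cscale_cscale: "cscale c (cscale d X) = cscale (c * d) X"
  by (simp add: cscale_def vec_eq_iff mult.assoc)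

lemma cscale_add: "cscale c (X + Y) = cscale c X + cscale c Y"
  by (simp add: cscale_def vec_eq_iff distrib_left)

lemma cscale_diff: "cscale c (X - Y) = cscale c X - cscale c Y"
  by (simp add: cscale_def vec_eq_iff right_diff_distrib)

lemma mult_cscale: "X ** cscale c Y = cscale c (X ** Y)"
  and cscale_mult: "cscale c X ** Y = cscale c (X ** Y)"
  by (simp_all add: cscale_def vec_eq_iff matrix_matrix_mult_def sum_distrib_left mult_ac)

lemma bounded_bilinear_matrix_mult:
  "bounded_bilinear ((**) :: complex^'b^'a \<Rightarrow> complex^'c^'b \<Rightarrow> complex^'c^'a)"
proof -
  have "bilinear ((**) :: complex^'b^'a \<Rightarrow> complex^'c^'b \<Rightarrow> complex^'c^'a)"
    unfolding bilinear_def
    by (auto intro!: linearI simp: matrix_add_ldistrib vec_eq_iff matrix_matrix_mult_def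
          sum.distrib distrib_left distrib_right scaleR_sum_right)
  then show ?thesis by (simp add: bilinear_conv_bounded_bilinear)
qed

interpretation mmult: bounded_bilinear "(**) :: complex^'b^'a \<Rightarrow> complex^'c^'b \<Rightarrow> complex^'c^'a"
  by (rule bounded_bilinear_matrix_mult)

lemma matrix_vector_scaleR: "(c *\<^sub>R X) *v v = c *\<^sub>R (X *v v)" for X :: "complex^'n^'m"
  by (simp add: vec_eq_iff matrix_vector_mult_def scaleR_sum_right)

lemma matrix_vector_scaleR_right: "X *v (c *\<^sub>R v) = c *\<^sub>R (X *v v)" for X :: "complex^'n^'m"
  by (simp add: linear_scale)

lemma matrix_vector_sum: "sum f I *v v = (\<Sum>i\<in>I. f i *v v)" for f :: "'i \<Rightarrow> complex^'n^'m"
  by (induction I rule: infinite_finite_induct) (auto simp: matrix_vector_mult_add_rdistrib)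

text \<open>The identity for the Hermitian form carries over to its real part, so self-adjoint matrices are
  symmetric operators on the underlying real Euclidean space; the spectral theorem below is therefore the
  real one.\<close>

lemma inner_mstar: "v \<bullet> (X *v w) = (mstar X *v v) \<bullet> w" for X :: "complex^'n^'m"
proof -
  have c: "a \<bullet> b = Re (cnj a * b)" for a b :: complex
    by (simp add: inner_complex_def)
  have "v \<bullet> (X *v w) = Re (\<Sum>i\<in>UNIV. \<Sum>j\<in>UNIV. cnj (v $ i) * (X $ i $ j * w $ j))"
    by (simp add: inner_vec_def c matrix_vector_mult_def sum_distrib_left)
  also have "\<dots> = Re (\<Sum>j\<in>UNIV. \<Sum>i\<in>UNIV. cnj (v $ i) * (X $ i $ j * w $ j))"
    by (subst sum.swap) simp
  also have "\<dots> = (mstar X *v v) \<bullet> w"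
    by (simp add: inner_vec_def c matrix_vector_mult_def sum_distrib_left sum_distrib_right mstar_def mult_ac)
  finally show ?thesis .
qed

lemma matrix_eq_on_spanning:
  fixes X Y :: "complex^'n^'m"
  assumes "span S = UNIV" and "\<And>v. v \<in> S \<Longrightarrow> X *v v = Y *v v"
  shows "X = Y"
proof -
  have "X *v v = Y *v v" for v
    by (rule linear_eq_on_span[where B = S]) (use assms in auto)
  then show ?thesis using matrix_eq by blast
qed

section \<open>Linear maps on subspaces\<close>

lemma linear_projection_onto_subspace:
  fixes S :: "'a::euclidean_space set"
  assumes "subspace S"
  obtains P where "linear P" "\<And>x. P x \<in> S" "\<And>x. x \<in> S \<Longrightarrow> P x = x"
proof -
  obtain B where B: "B \<subseteq> S" "pairwise orthogonal B" "\<And>x. x \<in> B \<Longrightarrow> norm x = 1"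
      "independent B" "card B = dim S" "span B = S"
    using orthonormal_basis_subspace[OF assms] by metis
  let ?P = "\<lambda>x. \<Sum>b\<in>B. (x \<bullet> b) *\<^sub>R b"
  show ?thesis
  proof
    show "linear ?P"
      by (auto intro!: linearI simp: inner_add_left scaleR_add_left sum.distrib scaleR_sum_right)
    show "?P x \<in> S" for x
      using B(1) assms by (auto intro!: subspace_sum subspace_scale)
    show "?P x = x" if "x \<in> S" for x
      using B that by (intro orthonormal_basis_expand) (auto intro: independent_imp_finite)
  qed
qed

lemma bounded_linear_extension_from_subspace:
  fixes S :: "'a::euclidean_space set" and f :: "'a \<Rightarrow> 'b::real_normed_vector"
  assumes "subspace S" and "\<And>x y. x \<in> S \<Longrightarrow> y \<in> S \<Longrightarrow> f (x + y) = f x + f y"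
    and "\<And>c x. x \<in> S \<Longrightarrow> f (c *\<^sub>R x) = c *\<^sub>R f x"
  shows "\<exists>g. bounded_linear g \<and> (\<forall>x\<in>S. g x = f x)"
proof -
  obtain P where P: "linear P" "\<And>x. P x \<in> S" "\<And>x. x \<in> S \<Longrightarrow> P x = x"
    using linear_projection_onto_subspace[OF assms(1)] by blast
  have "linear (f \<circ> P)"
    by (rule linearI) (simp_all add: assms P linear_add[OF P(1)] linear_scale[OF P(1)])
  then show ?thesis using P(3) by (intro exI[of _ "f \<circ> P"]) (simp add: linear_conv_bounded_linear)
qed

text \<open>The form \<open>b\<close> becomes positive definite on the whole space after adding the Euclidean form of a
  complement of \<open>S\<close>; there an injective linear map is surjective.\<close>

lemma riesz_on_subspace:
  fixes S :: "'a::euclidean_space set" and b :: "'a \<Rightarrow> 'a \<Rightarrow> real"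
  assumes S: "subspace S"
    and bl: "\<And>x y z. x \<in> S \<Longrightarrow> y \<in> S \<Longrightarrow> z \<in> S \<Longrightarrow> b (x + y) z = b x z + b y z"
      "\<And>c x z. x \<in> S \<Longrightarrow> z \<in> S \<Longrightarrow> b (c *\<^sub>R x) z = c * b x z"
    and br: "\<And>x y z. x \<in> S \<Longrightarrow> y \<in> S \<Longrightarrow> z \<in> S \<Longrightarrow> b z (x + y) = b z x + b z y"
      "\<And>c x z. x \<in> S \<Longrightarrow> z \<in> S \<Longrightarrow> b z (c *\<^sub>R x) = c * b z x"
    and pos: "\<And>x. x \<in> S \<Longrightarrow> x \<noteq> 0 \<Longrightarrow> b x x > 0"
    and f: "\<And>x y. x \<in> S \<Longrightarrow> y \<in> S \<Longrightarrow> f (x + y) = f x + f y"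
      "\<And>c x. x \<in> S \<Longrightarrow> f (c *\<^sub>R x) = c * f x"
  shows "\<exists>x\<in>S. \<forall>z\<in>S. b x z = f z"
proof -
  obtain P where P: "linear P" "\<And>x. P x \<in> S" "\<And>x. x \<in> S \<Longrightarrow> P x = x"
    using linear_projection_onto_subspace[OF S] by blast
  note lP = linear_add[OF P(1)] linear_scale[OF P(1)]
  define B where "B x z = b (P x) (P z) + (x - P x) \<bullet> (z - P z)" for x z
  define G where "G x = (\<Sum>i\<in>Basis. B x i *\<^sub>R i)" for x
  have linB: "linear (B x)" for x
    by (rule linearI) (simp_all add: B_def lP br P inner_diff_right inner_add_right algebra_simps)
  have "B (x + y) z = B x z + B y z" "B (c *\<^sub>R x) z = c * B x z" for c x y z
    by (simp_all add: B_def lP bl P inner_diff_left inner_add_left algebra_simps)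
  then have linG: "linear G"
    by (intro linearI) (simp_all add: G_def scaleR_add_left sum.distrib scaleR_sum_right)
  have G: "G x \<bullet> z = B x z" for x z
  proof -
    have "B x z = B x (\<Sum>i\<in>Basis. (z \<bullet> i) *\<^sub>R i)" by (simp add: euclidean_representation)
    also have "\<dots> = (\<Sum>i\<in>Basis. (z \<bullet> i) * B x i)"
      by (simp add: linear_sum[OF linB] linear_scale[OF linB])
    also have "\<dots> = G x \<bullet> z" by (simp add: G_def inner_sum_left inner_commute[of z] mult.commute)
    finally show ?thesis by simp
  qed
  have b0: "b 0 0 = 0" using bl(2)[of 0 0 0] S by (simp add: subspace_0)
  have "x = 0" if "G x = 0" for x
  proof -
    have "B x x = 0" using G[of x x] that by simp
    moreover have "b (P x) (P x) \<ge> 0" using pos[OF P(2)] b0 by (cases "P x = 0") (auto intro: less_imp_le)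
    ultimately have "b (P x) (P x) = 0" "(x - P x) \<bullet> (x - P x) = 0"
      unfolding B_def by (smt (verit) inner_ge_zero)+
    then have "P x = 0" "x = P x" using pos[OF P(2)[of x]] by fastforce+
    then show ?thesis by simp
  qed
  then have "inj G" using linG linear_injective_0 by blast
  then have "surj G" using linG linear_injective_imp_surjective by blast
  define h where "h z = f (P z)" for z
  have linh: "linear h" by (rule linearI) (simp_all add: h_def lP f P)
  obtain x where x: "G x = (\<Sum>i\<in>Basis. h i *\<^sub>R i)" using \<open>surj G\<close> by (metis surjD)
  have "B x z = h z" for z
  proof -
    have "h z = h (\<Sum>i\<in>Basis. (z \<bullet> i) *\<^sub>R i)" by (simp add: euclidean_representation)
    also have "\<dots> = (\<Sum>i\<in>Basis. (z \<bullet> i) * h i)"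
      by (simp add: linear_sum[OF linh] linear_scale[OF linh])
    also have "\<dots> = G x \<bullet> z" by (simp add: x inner_sum_left inner_commute[of z] mult.commute)
    finally show ?thesis by (simp add: G)
  qed
  then have "b (P x) z = f z" if "z \<in> S" for z
    using that P(3)[OF that] by (metis B_def h_def add.right_neutral diff_self inner_zero_right)
  with P(2) show ?thesis by blast
qed

section \<open>Spectral theory of self-adjoint matrices\<close>

text \<open>On an invariant subspace a maximiser \<open>u\<close> of the Rayleigh quotient over the unit sphere is an
  eigenvector: the form \<open>x \<mapsto> m * (x \<bullet> x) - x \<bullet> T x\<close> is nonnegative and vanishes at \<open>u\<close>, so its
  derivative \<open>m u - T u\<close> vanishes as well.\<close>

lemma symmetric_eigenvector_in_invariant_subspace:
  fixes T :: "'a::euclidean_space \<Rightarrow> 'a"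
  assumes lin: "linear T" and sym: "\<And>x y. x \<bullet> T y = T x \<bullet> y"
    and S: "subspace S" "\<And>x. x \<in> S \<Longrightarrow> T x \<in> S" and x0: "x0 \<in> S" "x0 \<noteq> 0"
  obtains u m where "u \<in> S" "u \<noteq> 0" "T u = m *\<^sub>R u"
proof -
  note lT = linear_add[OF lin] linear_scale[OF lin] linear_diff[OF lin]
  let ?K = "S \<inter> sphere 0 1"
  have "compact ?K" using S(1) by (simp add: closed_subspace closed_Int_compact)
  moreover have "(1 / norm x0) *\<^sub>R x0 \<in> ?K" using x0 S(1) by (simp add: subspace_scale)
  then have "?K \<noteq> {}" by blast
  moreover have "continuous_on ?K (\<lambda>x. x \<bullet> T x)"
    using lin by (intro continuous_intros linear_continuous_on) (simp add: linear_conv_bounded_linear)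
  ultimately obtain u where u: "u \<in> ?K" and max: "\<And>x. x \<in> ?K \<Longrightarrow> x \<bullet> T x \<le> u \<bullet> T u"
    using continuous_attains_sup by (metis (no_types, lifting))
  define m where "m = u \<bullet> T u"
  have uu: "u \<bullet> u = 1" using u by (simp add: norm_eq_1)
  have q: "x \<bullet> T x \<le> m * (x \<bullet> x)" if "x \<in> S" for x
  proof (cases "x = 0")
    case False
    let ?y = "(1 / norm x) *\<^sub>R x"
    have "?y \<in> ?K" using False that S(1) by (simp add: subspace_scale)
    from max[OF this] have "(x \<bullet> T x) / (norm x)\<^sup>2 \<le> m"
      by (simp add: m_def lT power2_eq_square)
    then show ?thesis using False by (simp add: field_simps power2_norm_eq_inner)
  qed (simp add: lT linear_0[OF lin])
  \<comment> \<open>Moving from \<open>u\<close> in the direction \<open>- w\<close> changes the nonnegative form at first order by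
    \<open>- 2 * s * (w \<bullet> w)\<close>, which is impossible for small \<open>s > 0\<close> unless \<open>w = 0\<close>.\<close>
  define w where "w = m *\<^sub>R u - T u"
  have w: "w \<in> S" using u S by (auto simp: w_def intro!: subspace_diff subspace_scale)
  define Q where "Q = m * (w \<bullet> w) - w \<bullet> T w"
  have "0 \<le> - 2 * s * (w \<bullet> w) + s\<^sup>2 * Q" for s
  proof -
    have "u - s *\<^sub>R w \<in> S" using u w S by (auto intro!: subspace_diff subspace_scale)
    from q[OF this] have "0 \<le> m * ((u - s *\<^sub>R w) \<bullet> (u - s *\<^sub>R w)) - (u - s *\<^sub>R w) \<bullet> T (u - s *\<^sub>R w)" by simp
    also have "\<dots> = (m * (u \<bullet> u) - u \<bullet> T u) - 2 * s * (m * (w \<bullet> u) - w \<bullet> T u) + s\<^sup>2 * Q"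
      using sym[of u w] by (simp add: Q_def lT inner_diff inner_commute power2_eq_square algebra_simps)
    also have "\<dots> = - 2 * s * (w \<bullet> w) + s\<^sup>2 * Q"
    proof -
      have "m * (u \<bullet> u) - u \<bullet> T u = 0" using uu m_def by simp
      moreover have "m * (w \<bullet> u) - w \<bullet> T u = w \<bullet> w"
      proof -
        have "w \<bullet> w = w \<bullet> (m *\<^sub>R u - T u)" by (subst (2) w_def) simp
        then show ?thesis by (simp add: inner_diff_right)
      qed
      ultimately show ?thesis by simp
    qed
    finally show ?thesis .
  qed
  note quad = this
  have "w \<bullet> w = 0"
  proof (rule ccontr)
    assume "w \<bullet> w \<noteq> 0"
    then have ww: "w \<bullet> w > 0" by (simp add: less_le)
    \<comment> \<open>The denominator \<open>\<bar>Q\<bar> + 1\<close> makes the second order term smaller than the first order one.\<close>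
    let ?s = "(w \<bullet> w) / (\<bar>Q\<bar> + 1)"
    have s: "?s > 0" using ww by (intro divide_pos_pos) auto
    have "2 * (w \<bullet> w) \<le> s * Q" if "s > 0" for s
      using quad[of s] that mult_le_cancel_left_pos[OF that, of "2 * (w \<bullet> w)" "s * Q"]
      by (simp add: power2_eq_square mult_ac)
    from this[OF s] have "2 * (w \<bullet> w) \<le> ?s * Q" .
    also have "?s * Q \<le> ?s * (\<bar>Q\<bar> + 1)" using s by (intro mult_left_mono) auto
    also have "\<dots> = w \<bullet> w" by simp
    finally show False using ww by simp
  qed
  then have "T u = m *\<^sub>R u" by (simp add: w_def)
  with u uu that show ?thesis by force
qed

lemma symmetric_eigenvectors_span:
  fixes T :: "'a::euclidean_space \<Rightarrow> 'a"
  assumes lin: "linear T" and sym: "\<And>x y. x \<bullet> T y = T x \<bullet> y"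
  shows "span {v. \<exists>m. T v = m *\<^sub>R v} = UNIV"
proof (rule ccontr)
  let ?E = "{v. \<exists>m. T v = m *\<^sub>R v}"
  assume "span ?E \<noteq> UNIV"
  then have *: "span ?E \<subset> span UNIV" by auto
  obtain x0 where x0: "x0 \<noteq> 0" "\<And>y. y \<in> span ?E \<Longrightarrow> orthogonal x0 y"
    by (rule orthogonal_to_subspace_exists_gen[OF *]) metis
  let ?S = "{x. \<forall>y\<in>?E. y \<bullet> x = 0}"
  have S: "subspace ?S"
    by (auto simp: subspace_def inner_add_right)
  have inv: "T x \<in> ?S" if "x \<in> ?S" for x
    using that by (auto simp: sym)
  have "y \<bullet> x0 = 0" if "y \<in> ?E" for y
    using x0(2)[OF span_base[OF that]] by (simp add: orthogonal_def inner_commute)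
  then have "x0 \<in> ?S" by blast
  then obtain u m where "u \<in> ?S" "u \<noteq> 0" "T u = m *\<^sub>R u"
    using symmetric_eigenvector_in_invariant_subspace[OF lin sym S inv] x0(1) by blast
  then show False by auto
qed

text \<open>Eigenvectors for distinct eigenvalues are orthogonal, hence independent.\<close>

lemma finite_eigvals: assumes "mstar X = X" shows "finite (eigvals X)"
proof -
  define g where "g l = (SOME v. v \<noteq> 0 \<and> X *v v = l *\<^sub>R v)" for l :: real
  have g: "g l \<noteq> 0 \<and> X *v g l = l *\<^sub>R g l" if "l \<in> eigvals X" for l
    unfolding g_def by (rule someI_ex) (use that in \<open>auto simp: eigvals_def\<close>)
  have orth: "g l \<bullet> g k = 0" if "l \<in> eigvals X" "k \<in> eigvals X" "l \<noteq> k" for l k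
  proof -
    have "g l \<bullet> (X *v g k) = (X *v g l) \<bullet> g k" using inner_mstar[of "g l" X "g k"] assms by simp
    then show ?thesis using g that by simp
  qed
  have "independent (g ` eigvals X)"
    by (rule pairwise_orthogonal_independent)
      (use orth g in \<open>auto simp: pairwise_def orthogonal_def\<close>)
  then have "finite (g ` eigvals X)" by (rule independent_imp_finite)
  moreover have "inj_on g (eigvals X)"
    using orth g by (intro inj_onI) (metis inner_eq_zero_iff)
  ultimately show ?thesis by (rule finite_imageD)
qed

lemma eigenvectors_span:
  fixes X :: "'n::finite cmat"
  assumes "mstar X = X"
  shows "span {v. \<exists>l\<in>eigvals X. X *v v = l *\<^sub>R v} = UNIV"
proof -
  let ?E = "{v. \<exists>m::real. X *v v = m *\<^sub>R v}"
  have "span ?E = UNIV"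
    by (rule symmetric_eigenvectors_span) (use assms inner_mstar[of _ X] in auto)
  moreover have "?E \<subseteq> span {v. \<exists>l\<in>eigvals X. X *v v = l *\<^sub>R v}"
  proof
    fix v assume "v \<in> ?E"
    then obtain m :: real where m: "X *v v = m *\<^sub>R v" by blast
    show "v \<in> span {v. \<exists>l\<in>eigvals X. X *v v = l *\<^sub>R v}"
    proof (cases "v = 0")
      case False
      then have "m \<in> eigvals X" using m by (auto simp: eigvals_def)
      then show ?thesis using m by (intro span_base) auto
    qed (simp add: span_0)
  qed
  ultimately show ?thesis using span_minimal[OF _ subspace_span] by blast
qed

text \<open>Lagrange interpolation writes a spectral projection as a polynomial in the matrix. This shows
  both that the projection exists and that it lies in every algebra containing the matrix.\<close>

primrec lagrange :: "'n::finite cmat \<Rightarrow> real \<Rightarrow> real list \<Rightarrow> 'n cmat" where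
  "lagrange X l [] = mat 1"
| "lagrange X l (m # ms) = (1 / (l - m)) *\<^sub>R (X - m *\<^sub>R mat 1) ** lagrange X l ms"

lemma lagrange_eigenvector:
  assumes "X *v v = k *\<^sub>R v"
  shows "lagrange X l ms *v v = (\<Prod>m\<leftarrow>ms. (k - m) / (l - m)) *\<^sub>R v"
proof (induction ms)
  case (Cons m ms)
  have "lagrange X l (m # ms) *v v = ((1 / (l - m)) *\<^sub>R (X - m *\<^sub>R mat 1)) *v (lagrange X l ms *v v)"
    by (simp only: lagrange.simps matrix_vector_mul_assoc)
  also have "\<dots> = (\<Prod>m\<leftarrow>ms. (k - m) / (l - m)) *\<^sub>R (1 / (l - m)) *\<^sub>R (k *\<^sub>R v - m *\<^sub>R v)"
    by (simp only: Cons.IH matrix_vector_scaleR matrix_vector_mult_diff_rdistrib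
        matrix_vector_scaleR_right assms matrix_vector_mul_lid)
  also have "\<dots> = (\<Prod>m\<leftarrow>m # ms. (k - m) / (l - m)) *\<^sub>R v"
    by (simp add: scaleR_diff_left[symmetric])
  finally show ?case .
qed simp

lemma spectral_projection_exists:
  assumes sa: "mstar X = X" and "l \<in> eigvals X"
  obtains ms where "\<And>v. X *v v = l *\<^sub>R v \<Longrightarrow> lagrange X l ms *v v = v"
    "\<And>v k. k \<in> eigvals X \<Longrightarrow> k \<noteq> l \<Longrightarrow> X *v v = k *\<^sub>R v \<Longrightarrow> lagrange X l ms *v v = 0"
proof -
  obtain ms where ms: "set ms = eigvals X - {l}"
    using finite_eigvals[OF sa] finite_list by (metis finite_Diff)
  show ?thesis
  proof
    show "lagrange X l ms *v v = v" if "X *v v = l *\<^sub>R v" for v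
    proof -
      have "map (\<lambda>m. (l - m) / (l - m)) ms = map (\<lambda>_. 1) ms" using ms by auto
      then have "(\<Prod>m\<leftarrow>ms. (l - m) / (l - m)) = (\<Prod>m\<leftarrow>ms. 1)" by (rule arg_cong)
      also have "\<dots> = 1" by (induction ms) auto
      finally show ?thesis using lagrange_eigenvector[OF that, of l ms] by simp
    qed
    show "lagrange X l ms *v v = 0" if "k \<in> eigvals X" "k \<noteq> l" "X *v v = k *\<^sub>R v" for v k
    proof -
      have "0 \<in> set (map (\<lambda>m. (k - m) / (l - m)) ms)" using that ms by force
      then have "(\<Prod>m\<leftarrow>ms. (k - m) / (l - m)) = 0" using prod_list_zero_iff by blast
      then show ?thesis using lagrange_eigenvector[OF that(3), of l ms] by simp
    qed
  qed
qed

lemma self_adjoint_projection_unique: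
  fixes P Q :: "'n::finite cmat"
  assumes "mstar P = P" "P ** P = P" "mstar Q = Q" "Q ** Q = Q" "range ((*v) P) = range ((*v) Q)"
  shows "P = Q"
proof -
  have "A ** B = B" if AA: "A ** A = A" and AB: "range ((*v) A) = range ((*v) B)" for A B :: "'n cmat"
  proof -
    have "(A ** B) *v v = B *v v" for v
    proof -
      obtain w where "B *v v = A *v w" using AB by (metis rangeE rangeI)
      then show ?thesis using AA by (metis matrix_vector_mul_assoc)
    qed
    then show ?thesis using matrix_eq by blast
  qed
  then have "P ** Q = Q" "Q ** P = P" using assms by metis+
  then show ?thesis using mstar_mult[of P Q] assms by simp
qed

lemma specproj_properties:
  fixes X :: "'n::finite cmat"
  assumes sa: "mstar X = X" and l: "l \<in> eigvals X"
  shows specproj_lagrange: "\<exists>ms. specproj X l = lagrange X l ms"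
    and specproj_self_adjoint: "mstar (specproj X l) = specproj X l"
    and specproj_eigenvector: "X *v v = k *\<^sub>R v \<Longrightarrow> k \<in> eigvals X \<Longrightarrow>
      specproj X l *v v = (if k = l then v else 0)"
proof -
  obtain ms where ms: "\<And>v. X *v v = l *\<^sub>R v \<Longrightarrow> lagrange X l ms *v v = v"
    "\<And>v k. k \<in> eigvals X \<Longrightarrow> k \<noteq> l \<Longrightarrow> X *v v = k *\<^sub>R v \<Longrightarrow> lagrange X l ms *v v = 0"
    using spectral_projection_exists[OF sa l] by metis
  define P where "P = lagrange X l ms"
  have comm: "lagrange X l ns ** X = X ** lagrange X l ns" for ns
    by (induction ns) (simp_all add: mmult.diff_left mmult.diff_right mmult.scaleR_left mmult.scaleR_right
        matrix_mul_assoc[symmetric])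
  have star: "mstar (lagrange X l ns) = lagrange X l ns" for ns
    by (induction ns) (simp_all add: mstar_mult mstar_scaleR mstar_diff sa mmult.diff_left mmult.diff_right
        mmult.scaleR_left mmult.scaleR_right comm)
  note spn = matrix_eq_on_spanning[OF eigenvectors_span[OF sa]]
  have PP: "P ** P = P"
    by (rule spn) (use ms in \<open>force simp: P_def matrix_vector_mul_assoc[symmetric]\<close>)
  have XP: "X ** P = l *\<^sub>R P"
  proof (rule spn)
    fix v assume "v \<in> {v. \<exists>l\<in>eigvals X. X *v v = l *\<^sub>R v}"
    then obtain k where "k \<in> eigvals X" "X *v v = k *\<^sub>R v" by blast
    then show "(X ** P) *v v = (l *\<^sub>R P) *v v"
      using ms by (cases "k = l") (auto simp: P_def matrix_vector_mul_assoc[symmetric] matrix_vector_scaleR)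
  qed
  have range: "range ((*v) P) = {v. X *v v = l *\<^sub>R v}"
  proof safe
    fix v show "X *v (P *v v) = l *\<^sub>R (P *v v)"
      by (simp add: XP matrix_vector_mul_assoc matrix_vector_scaleR)
  next
    fix v assume "X *v v = l *\<^sub>R v"
    then show "v \<in> range ((*v) P)" using ms(1)[of v] unfolding P_def by (metis rangeI)
  qed
  have "specproj X l = P" unfolding specproj_def
  proof (rule the_equality)
    show "mstar P = P \<and> P ** P = P \<and> range ((*v) P) = {v. X *v v = l *\<^sub>R v}"
      using star PP range by (simp add: P_def)
    then show "Q = P" if "mstar Q = Q \<and> Q ** Q = Q \<and> range ((*v) Q) = {v. X *v v = l *\<^sub>R v}" for Q
      using that self_adjoint_projection_unique[of Q P] by simp
  qed
  then show "\<exists>ms. specproj X l = lagrange X l ms" "mstar (specproj X l) = specproj X l"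
    "X *v v = k *\<^sub>R v \<Longrightarrow> k \<in> eigvals X \<Longrightarrow> specproj X l *v v = (if k = l then v else 0)"
    using ms star by (auto simp: P_def)
qed

lemma matrix_eq_on_eigenvectors:
  fixes X :: "'n::finite cmat"
  assumes "mstar X = X" and "\<And>v k. k \<in> eigvals X \<Longrightarrow> X *v v = k *\<^sub>R v \<Longrightarrow> A *v v = B *v v"
  shows "A = B"
  by (rule matrix_eq_on_spanning[OF eigenvectors_span[OF assms(1)]]) (use assms(2) in blast)

lemma specproj_mult:
  assumes sa: "mstar X = X" and kl: "k \<in> eigvals X" "l \<in> eigvals X"
  shows "specproj X k ** specproj X l = (if k = l then specproj X k else 0)"
proof (rule matrix_eq_on_eigenvectors[OF sa])
  fix v m assume m: "m \<in> eigvals X" "X *v v = m *\<^sub>R v"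
  note e = specproj_eigenvector[OF sa _ m(2,1)]
  show "(specproj X k ** specproj X l) *v v = (if k = l then specproj X k else 0) *v v"
    unfolding matrix_vector_mul_assoc[symmetric] using e kl by simp
qed

lemma specproj_sum:
  assumes sa: "mstar X = X" shows "(\<Sum>l\<in>eigvals X. specproj X l) = mat 1"
proof (rule matrix_eq_on_eigenvectors[OF sa])
  fix v m assume m: "m \<in> eigvals X" "X *v v = m *\<^sub>R v"
  note e = specproj_eigenvector[OF sa _ m(2,1)]
  have "(\<Sum>l\<in>eigvals X. specproj X l) *v v = (\<Sum>l\<in>eigvals X. if m = l then v else 0)"
    unfolding matrix_vector_sum by (rule sum.cong) (simp_all add: e)
  then show "(\<Sum>l\<in>eigvals X. specproj X l) *v v = mat 1 *v v"
    using m(1) finite_eigvals[OF sa] by simp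
qed

lemma spectral_decomposition:
  assumes sa: "mstar X = X" shows "fcalc (\<lambda>x. x) X = X"
proof (rule matrix_eq_on_spanning[OF eigenvectors_span[OF sa]])
  fix v assume "v \<in> {v. \<exists>l\<in>eigvals X. X *v v = l *\<^sub>R v}"
  then obtain k where k: "k \<in> eigvals X" "X *v v = k *\<^sub>R v" by blast
  have "fcalc (\<lambda>x. x) X *v v = (\<Sum>l\<in>eigvals X. if k = l then l *\<^sub>R v else 0)"
    unfolding fcalc_def matrix_vector_sum
    by (rule sum.cong) (auto simp: matrix_vector_scaleR specproj_eigenvector[OF sa _ k(2,1)])
  then show "fcalc (\<lambda>x. x) X *v v = X *v v" using k finite_eigvals[OF sa] by simp
qed

lemma fcalc_mult:
  assumes sa: "mstar X = X" shows "fcalc f X ** fcalc g X = fcalc (\<lambda>x. f x * g x) X"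
proof -
  have "fcalc f X ** fcalc g X
      = (\<Sum>k\<in>eigvals X. \<Sum>l\<in>eigvals X. if k = l then (f k * g k) *\<^sub>R specproj X k else 0)"
    unfolding fcalc_def mmult.sum_left mmult.sum_right
    by (intro sum.cong refl) (simp add: mmult.scaleR_left mmult.scaleR_right specproj_mult[OF sa] mult.commute)
  then show ?thesis using finite_eigvals[OF sa] by (simp add: fcalc_def)
qed

lemma fcalc_self_adjoint: assumes "mstar X = X" shows "mstar (fcalc f X) = fcalc f X"
  by (simp add: fcalc_def mstar_sum mstar_scaleR specproj_self_adjoint[OF assms])

lemma fcalc_one: assumes "mstar X = X" "\<And>l. l \<in> eigvals X \<Longrightarrow> f l = 1" shows "fcalc f X = mat 1"
  using specproj_sum[OF assms(1)] assms(2) by (simp add: fcalc_def)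

lemma specproj_nonzero: assumes "mstar X = X" "l \<in> eigvals X" shows "specproj X l \<noteq> 0"
proof
  assume "specproj X l = 0"
  moreover obtain v where "v \<noteq> 0" "X *v v = l *\<^sub>R v" using assms(2) by (auto simp: eigvals_def)
  ultimately show False using specproj_eigenvector[OF assms, of v l] assms(2) by simp
qed

lemma psd_eigvals_nonneg: assumes "psd X" "l \<in> eigvals X" shows "l \<ge> 0"
proof -
  obtain v where v: "v \<noteq> 0" "X *v v = l *\<^sub>R v" using assms(2) by (auto simp: eigvals_def)
  then have "0 \<le> l * (v \<bullet> v)" using assms(1) unfolding psd_def by (metis inner_scaleR_right)
  moreover have "v \<bullet> v > 0" using v(1) by simp
  ultimately show ?thesis by (simp add: zero_le_mult_iff not_le[symmetric] del: not_le)
qed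

lemma posdef_eigvals_pos: assumes "posdef X" "l \<in> eigvals X" shows "l > 0"
proof -
  obtain v where v: "v \<noteq> 0" "X *v v = l *\<^sub>R v" using assms(2) by (auto simp: eigvals_def)
  then have "0 < l * (v \<bullet> v)" using assms(1) unfolding posdef_def by (metis inner_scaleR_right)
  moreover have "v \<bullet> v > 0" using v(1) by simp
  ultimately show ?thesis using zero_less_mult_iff[of l "v \<bullet> v"] by linarith
qed

lemma posdef_imp_psd: "posdef X \<Longrightarrow> psd X"
  unfolding posdef_def psd_def by (metis inner_zero_left le_less)

text \<open>Invertibility excludes the eigenvalue \<open>0\<close>, so the square root is invertible too and
  \<open>v \<bullet> X v\<close> is the squared norm of its value at \<open>v\<close>.\<close>

lemma psd_invertible_imp_posdef:
  assumes "psd X" "invertible X" shows "posdef X"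
proof -
  have sa: "mstar X = X" using assms(1) by (simp add: psd_def)
  have pos: "l > 0" if l: "l \<in> eigvals X" for l
  proof -
    have "l \<noteq> 0"
    proof
      assume "l = 0"
      then obtain v where "v \<noteq> 0" "X *v v = 0" using l by (auto simp: eigvals_def)
      then show False using assms(2) unfolding invertible_def
        by (metis matrix_vector_mul_assoc matrix_vector_mul_lid matrix_vector_mult_0_right)
    qed
    then show ?thesis using psd_eigvals_nonneg[OF assms(1) l] by simp
  qed
  have "0 < v \<bullet> (X *v v)" if v: "v \<noteq> 0" for v
  proof -
    let ?S = "fcalc sqrt X" and ?T = "fcalc (\<lambda>x. 1 / sqrt x) X"
    have "?S ** ?S = fcalc (\<lambda>x. x) X"
      unfolding fcalc_mult[OF sa] unfolding fcalc_def
      by (intro sum.cong refl) (use pos in \<open>auto simp: less_imp_le\<close>)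
    then have S: "?S ** ?S = X" by (simp add: spectral_decomposition[OF sa])
    have "?T ** ?S = mat 1"
      unfolding fcalc_mult[OF sa] by (rule fcalc_one[OF sa]) (use pos in force)
    then have "?S *v v \<noteq> 0" using v
      by (metis matrix_vector_mul_assoc matrix_vector_mul_lid matrix_vector_mult_0_right)
    moreover have "v \<bullet> (X *v v) = (?S *v v) \<bullet> (?S *v v)"
      using inner_mstar[of v ?S "?S *v v"] by (simp add: matrix_vector_mul_assoc S fcalc_self_adjoint[OF sa])
    ultimately show ?thesis by simp
  qed
  then show ?thesis using sa by (simp add: posdef_def)
qed

text \<open>By compactness of the unit sphere the quadratic form of a positive definite matrix is bounded below
  by a multiple of the square norm, so nearby self-adjoint matrices share half of that bound.\<close>

lemma posdef_neighbourhood: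
  assumes "posdef X"
  obtains d r where "d > 0" "r > 0"
    "\<And>Y l. mstar Y = Y \<Longrightarrow> norm (Y - X) < r \<Longrightarrow> posdef Y \<and> (l \<in> eigvals Y \<longrightarrow> d \<le> l)"
proof -
  let ?K = "sphere (0::complex^'a) 1"
  have "axis undefined 1 \<in> ?K" by simp
  then have ne: "?K \<noteq> {}" by blast
  have cont: "continuous_on ?K (\<lambda>v. v \<bullet> (X *v v))"
    by (intro continuous_intros linear_continuous_on) simp
  obtain u where u: "u \<in> ?K" and min: "\<And>v. v \<in> ?K \<Longrightarrow> u \<bullet> (X *v u) \<le> v \<bullet> (X *v v)"
    using continuous_attains_inf[OF compact_sphere ne cont] by blast
  define m where "m = u \<bullet> (X *v u)"
  have "u \<noteq> 0" using u by auto
  then have m: "m > 0" using assms by (simp add: m_def posdef_def)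
  have lower: "m * (v \<bullet> v) \<le> v \<bullet> (X *v v)" for v
  proof (cases "v = 0")
    case False
    then have "(1 / norm v) *\<^sub>R v \<in> ?K" by simp
    from min[OF this] have "m \<le> (v \<bullet> (X *v v)) / (norm v)\<^sup>2"
      by (simp add: m_def matrix_vector_scaleR_right power2_eq_square)
    then show ?thesis using False by (simp add: field_simps power2_norm_eq_inner)
  qed simp
  obtain C where C: "C > 0" "\<And>Y :: 'a cmat. \<And>v. norm (Y *v v) \<le> norm Y * norm v * C"
  proof -
    have "bilinear ((*v) :: 'a cmat \<Rightarrow> _)"
      unfolding bilinear_def
      by (auto intro!: linearI simp: matrix_vector_mult_add_rdistrib matrix_vector_scaleR
          matrix_vector_right_distrib matrix_vector_scaleR_right)
    then interpret bounded_bilinear "(*v) :: 'a cmat \<Rightarrow> _"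
      by (simp add: bilinear_conv_bounded_bilinear)
    show ?thesis using pos_bounded that by blast
  qed
  have Y: "m / 2 * (v \<bullet> v) \<le> v \<bullet> (Y *v v)" if "norm (Y - X) < m / (2 * C)" for Y v
  proof -
    have "\<bar>v \<bullet> ((Y - X) *v v)\<bar> \<le> norm v * (norm (Y - X) * norm v * C)"
      by (rule order_trans[OF Cauchy_Schwarz_ineq2]) (intro mult_left_mono C, simp)
    also have "\<dots> \<le> norm v * (m / (2 * C) * norm v * C)"
      using that C(1) by (intro mult_left_mono mult_right_mono) auto
    also have "\<dots> = m / 2 * (v \<bullet> v)" using C(1) by (simp add: power2_norm_eq_inner[symmetric] power2_eq_square)
    finally have "\<bar>v \<bullet> (Y *v v) - v \<bullet> (X *v v)\<bar> \<le> m / 2 * (v \<bullet> v)"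
      by (simp only: matrix_vector_mult_diff_rdistrib inner_diff_right)
    then show ?thesis using lower[of v] by argo
  qed
  show ?thesis
  proof
    show "m / 2 > 0" "m / (2 * C) > 0" using m C by auto
    fix Y :: "'a cmat" and l assume sa: "mstar Y = Y" and near: "norm (Y - X) < m / (2 * C)"
    have "0 < v \<bullet> (Y *v v)" if "v \<noteq> 0" for v
      using Y[OF near, of v] that m by (smt (verit) inner_gt_zero_iff mult_pos_pos half_gt_zero)
    moreover have "m / 2 \<le> l" if l: "l \<in> eigvals Y"
    proof -
      obtain v where v: "v \<noteq> 0" "Y *v v = l *\<^sub>R v" using l by (auto simp: eigvals_def)
      then have "m / 2 * (v \<bullet> v) \<le> l * (v \<bullet> v)" using Y[OF near, of v] by simp
      then show ?thesis using v(1) by (simp add: mult_le_cancel_right)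
    qed
    ultimately show "posdef Y \<and> (l \<in> eigvals Y \<longrightarrow> m / 2 \<le> l)" using sa by (simp add: posdef_def)
  qed
qed

section \<open>Algebras with a faithful trace\<close>

locale trace_algebra =
  fixes S :: "'n::finite cmat set" and t :: "'n cmat \<Rightarrow> complex"
  assumes algebra: "vn_algebra S" and trace: "faithful_trace S t"
begin

lemma add_closed: "X \<in> S \<Longrightarrow> Y \<in> S \<Longrightarrow> X + Y \<in> S"
  and cscale_closed: "X \<in> S \<Longrightarrow> cscale c X \<in> S"
  and mult_closed: "X \<in> S \<Longrightarrow> Y \<in> S \<Longrightarrow> X ** Y \<in> S"
  and star_closed: "X \<in> S \<Longrightarrow> mstar X \<in> S"
  using algebra by (auto simp: vn_algebra_def)

lemma scaleR_closed: "X \<in> S \<Longrightarrow> c *\<^sub>R X \<in> S"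
  using cscale_closed[of X "of_real c"] by (simp add: cscale_of_real)

lemma zero_closed: "0 \<in> S"
  using algebra scaleR_closed[of _ 0] by (auto simp: vn_algebra_def is_unit_of_def)

lemma subspace_algebra: "subspace S"
  by (simp add: subspace_def add_closed scaleR_closed zero_closed)

lemma diff_closed: "X \<in> S \<Longrightarrow> Y \<in> S \<Longrightarrow> X - Y \<in> S"
  by (simp add: subspace_algebra subspace_diff)

lemma sum_closed: "(\<And>i. i \<in> I \<Longrightarrow> f i \<in> S) \<Longrightarrow> sum f I \<in> S"
  by (simp add: subspace_algebra subspace_sum)

lemmas closed = add_closed cscale_closed mult_closed star_closed scaleR_closed zero_closed
  diff_closed sum_closed

lemma trace_add: "X \<in> S \<Longrightarrow> Y \<in> S \<Longrightarrow> t (X + Y) = t X + t Y"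
  and trace_cscale: "X \<in> S \<Longrightarrow> t (cscale c X) = c * t X"
  and trace_cyclic: "X \<in> S \<Longrightarrow> Y \<in> S \<Longrightarrow> t (X ** Y) = t (Y ** X)"
  using trace by (auto simp: faithful_trace_def)

lemma trace_scaleR: "X \<in> S \<Longrightarrow> t (c *\<^sub>R X) = c *\<^sub>R t X"
  using trace_cscale[of X "of_real c"] by (simp add: cscale_of_real scaleR_conv_of_real)

lemma trace_zero: "t 0 = 0"
  using trace_scaleR[of 0 0] zero_closed by simp

lemma trace_diff: "X \<in> S \<Longrightarrow> Y \<in> S \<Longrightarrow> t (X - Y) = t X - t Y"
  using trace_add[of X "(- 1) *\<^sub>R Y"] trace_scaleR[of Y "- 1"] scaleR_closed[of Y "- 1"] by simp

lemma trace_sum: "(\<And>i. i \<in> I \<Longrightarrow> f i \<in> S) \<Longrightarrow> t (sum f I) = (\<Sum>i\<in>I. t (f i))"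
  by (induction I rule: infinite_finite_induct) (auto simp: trace_zero trace_add closed)

lemma trace_square:
  assumes "X \<in> S"
  shows "t (mstar X ** X) = of_real (Re (t (mstar X ** X)))" "Re (t (mstar X ** X)) \<ge> 0"
    "X \<noteq> 0 \<Longrightarrow> Re (t (mstar X ** X)) > 0"
proof -
  have *: "t (mstar X ** X) \<in> \<real>\<^sub>\<ge>\<^sub>0" "t (mstar X ** X) = 0 \<Longrightarrow> X = 0"
    using trace assms by (auto simp: faithful_trace_def)
  then show 1: "t (mstar X ** X) = of_real (Re (t (mstar X ** X)))" and 2: "Re (t (mstar X ** X)) \<ge> 0"
    by (auto simp: complex_nonneg_Reals_iff complex_eq_iff)
  show "Re (t (mstar X ** X)) > 0" if "X \<noteq> 0"
    using 1 2 *(2) that by (metis of_real_0 order_le_less)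
qed

lemma vn_unit: "vn_unit S \<in> S" "X \<in> S \<Longrightarrow> vn_unit S ** X = X" "X \<in> S \<Longrightarrow> X ** vn_unit S = X"
proof -
  obtain e where e: "is_unit_of S e" using algebra by (auto simp: vn_algebra_def)
  have "vn_unit S = e" unfolding vn_unit_def
    by (rule the_equality[where P = "is_unit_of S", OF e]) (use e in \<open>metis is_unit_of_def\<close>)
  then show "vn_unit S \<in> S" "X \<in> S \<Longrightarrow> vn_unit S ** X = X" "X \<in> S \<Longrightarrow> X ** vn_unit S = X"
    using e by (auto simp: is_unit_of_def)
qed

text \<open>Polarisation: \<open>c t(X\<^sup>*) + cnj c t(X)\<close> is real for \<open>c = 1\<close> and for \<open>c = \<i>\<close>, because it is a
  combination of traces of squares.\<close>

lemma trace_star: assumes X: "X \<in> S" shows "t (mstar X) = cnj (t X)"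
proof -
  let ?e = "vn_unit S"
  have eX: "mstar ?e ** X = X"
    using vn_unit(3)[OF star_closed[OF X]] mstar_mult[of "mstar X" ?e] by simp
  have "Im (c * t (mstar X) + cnj c * t X) = 0" for c
  proof -
    let ?Y = "X + cscale c ?e"
    have "mstar ?Y ** ?Y = mstar X ** X + cscale c (mstar X) + cscale (cnj c) X
        + cscale (cnj c * c) (mstar ?e ** ?e)"
      using vn_unit(3)[OF star_closed[OF X]] eX
      by (simp add: mstar_add mstar_cscale mmult.add_left mmult.add_right mult_cscale cscale_mult cscale_cscale
          cscale_add mult.commute)
    then have "t (mstar ?Y ** ?Y) = t (mstar X ** X) + c * t (mstar X) + cnj c * t X
        + cnj c * c * t (mstar ?e ** ?e)"
      using X vn_unit(1) by (simp add: trace_add trace_cscale closed)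
    then have "c * t (mstar X) + cnj c * t X
        = t (mstar ?Y ** ?Y) - t (mstar X ** X) - cnj c * c * t (mstar ?e ** ?e)" by simp
    moreover have real: "Im (t (mstar Z ** Z)) = 0" if "Z \<in> S" for Z
      using trace_square(1)[OF that] by (metis Im_complex_of_real)
    moreover have "Im (cnj c * c * t (mstar ?e ** ?e)) = 0" using real[OF vn_unit(1)] by simp
    moreover have "?Y \<in> S" using X vn_unit(1) by (intro closed)
    ultimately show ?thesis using X by (simp only: minus_complex.simps real)
  qed
  from this[of 1] this[of \<i>] show ?thesis by (simp add: complex_eq_iff)
qed

definition ip :: "'n cmat \<Rightarrow> 'n cmat \<Rightarrow> real" where
  "ip X Y = Re (t (mstar X ** Y))"

lemma ip_add_left: "X \<in> S \<Longrightarrow> Y \<in> S \<Longrightarrow> Z \<in> S \<Longrightarrow> ip (X + Y) Z = ip X Z + ip Y Z"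
  and ip_add_right: "X \<in> S \<Longrightarrow> Y \<in> S \<Longrightarrow> Z \<in> S \<Longrightarrow> ip Z (X + Y) = ip Z X + ip Z Y"
  and ip_diff_left: "X \<in> S \<Longrightarrow> Y \<in> S \<Longrightarrow> Z \<in> S \<Longrightarrow> ip (X - Y) Z = ip X Z - ip Y Z"
  and ip_diff_right: "X \<in> S \<Longrightarrow> Y \<in> S \<Longrightarrow> Z \<in> S \<Longrightarrow> ip Z (X - Y) = ip Z X - ip Z Y"
  and ip_scaleR_left: "X \<in> S \<Longrightarrow> Z \<in> S \<Longrightarrow> ip (c *\<^sub>R X) Z = c * ip X Z"
  and ip_scaleR_right: "X \<in> S \<Longrightarrow> Z \<in> S \<Longrightarrow> ip Z (c *\<^sub>R X) = c * ip Z X"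
  by (simp_all add: ip_def mstar_add mstar_diff mstar_scaleR mmult.add_left mmult.add_right mmult.diff_left
      mmult.diff_right mmult.scaleR_left mmult.scaleR_right trace_add trace_diff trace_scaleR closed)

lemma ip_sum_right: "Z \<in> S \<Longrightarrow> (\<And>i. i \<in> I \<Longrightarrow> f i \<in> S) \<Longrightarrow> ip Z (sum f I) = (\<Sum>i\<in>I. ip Z (f i))"
  by (simp add: ip_def mmult.sum_right trace_sum closed)

lemma ip_nonneg: "X \<in> S \<Longrightarrow> ip X X \<ge> 0"
  and ip_pos: "X \<in> S \<Longrightarrow> X \<noteq> 0 \<Longrightarrow> ip X X > 0"
  by (simp_all add: ip_def trace_square(2,3))

lemma ip_commute: "X \<in> S \<Longrightarrow> Y \<in> S \<Longrightarrow> ip X Y = ip Y X"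
  using trace_star[of "mstar X ** Y"] by (simp add: ip_def mstar_mult closed)

lemma ip_am_gm:
  assumes "X \<in> S" "Y \<in> S" "c > 0" shows "2 * \<bar>ip X Y\<bar> \<le> c * ip X X + ip Y Y / c"
proof -
  \<comment> \<open>The inequality says that \<open>a X + b Y\<close> and \<open>a X - b Y\<close> have nonnegative square norm.\<close>
  define a b where "a = sqrt c" and "b = 1 / sqrt c"
  have ab: "a * (a * z) = c * z" "a * (b * z) = z" "b * (a * z) = z" "b * (b * z) = z / c" for z
    using assms(3) by (simp_all add: a_def b_def mult.assoc[symmetric])
  have XY: "a *\<^sub>R X \<in> S" "b *\<^sub>R Y \<in> S" using assms by (auto intro!: closed)
  have "ip (a *\<^sub>R X) (a *\<^sub>R X) = c * ip X X" "ip (b *\<^sub>R Y) (b *\<^sub>R Y) = ip Y Y / c"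
    "ip (a *\<^sub>R X) (b *\<^sub>R Y) = ip X Y" "ip (b *\<^sub>R Y) (a *\<^sub>R X) = ip X Y"
    using assms XY by (simp_all only: ip_scaleR_left ip_scaleR_right ip_commute[of Y X] ab)
  then have "ip (a *\<^sub>R X + b *\<^sub>R Y) (a *\<^sub>R X + b *\<^sub>R Y) = c * ip X X + 2 * ip X Y + ip Y Y / c"
    "ip (a *\<^sub>R X - b *\<^sub>R Y) (a *\<^sub>R X - b *\<^sub>R Y) = c * ip X X - 2 * ip X Y + ip Y Y / c"
    using XY by (simp_all add: ip_add_left ip_add_right ip_diff_left ip_diff_right closed)
  then show ?thesis using ip_nonneg[OF add_closed[OF XY]] ip_nonneg[OF diff_closed[OF XY]] by linarith
qed

text \<open>The real representation theorem gives equality of real parts; replacing \<open>Z\<close> by \<open>\<i> Z\<close> gives the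
  imaginary parts.\<close>

lemma riesz:
  assumes add: "\<And>X Y. X \<in> S \<Longrightarrow> Y \<in> S \<Longrightarrow> f (X + Y) = f X + f Y"
    and cscale: "\<And>c X. X \<in> S \<Longrightarrow> f (cscale c X) = c * f X"
  shows "\<exists>!X. X \<in> S \<and> (\<forall>Z\<in>S. t (mstar X ** Z) = f Z)"
proof (rule ex_ex1I)
  have scaleR: "f (c *\<^sub>R X) = of_real c * f X" if "X \<in> S" for c X
    using cscale[OF that, of "of_real c"] by (simp add: cscale_of_real)
  have Re_add: "Re (f (X + Y)) = Re (f X) + Re (f Y)" if "X \<in> S" "Y \<in> S" for X Y
    using add[OF that] by simp
  have Re_scaleR: "Re (f (c *\<^sub>R X)) = c * Re (f X)" if "X \<in> S" for c X
    using scaleR[OF that] by simp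
  have "\<exists>X\<in>S. \<forall>Z\<in>S. ip X Z = Re (f Z)"
    by (rule riesz_on_subspace[OF subspace_algebra ip_add_left ip_scaleR_left ip_add_right
        ip_scaleR_right ip_pos Re_add Re_scaleR])
  then obtain X where X: "X \<in> S" "\<And>Z. Z \<in> S \<Longrightarrow> ip X Z = Re (f Z)" by blast
  have "t (mstar X ** Z) = f Z" if Z: "Z \<in> S" for Z
  proof -
    have "Re (t (mstar X ** Z)) = Re (f Z)" using X(2)[OF Z] by (simp only: ip_def)
    moreover have "Re (\<i> * t (mstar X ** Z)) = Re (\<i> * f Z)"
      using X(2)[OF cscale_closed[OF Z, of \<i>]] X(1) Z
      by (simp only: ip_def mult_cscale trace_cscale cscale closed)
    ultimately show ?thesis by (simp add: complex_eq_iff)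
  qed
  then show "\<exists>X. X \<in> S \<and> (\<forall>Z\<in>S. t (mstar X ** Z) = f Z)" using X(1) by blast
next
  fix X Y assume X: "X \<in> S \<and> (\<forall>Z\<in>S. t (mstar X ** Z) = f Z)" and Y: "Y \<in> S \<and> (\<forall>Z\<in>S. t (mstar Y ** Z) = f Z)"
  then have "ip (X - Y) (X - Y) = 0"
    by (simp add: ip_def mstar_diff mmult.diff_left trace_diff closed)
  moreover have "X - Y \<in> S" using X Y by (intro closed) auto
  ultimately have "X - Y = 0" using ip_pos[of "X - Y"] by (metis less_irrefl)
  then show "X = Y" by simp
qed

lemma trace_bounded_linear: "\<exists>g. bounded_linear g \<and> (\<forall>X\<in>S. g X = t X)"
  by (rule bounded_linear_extension_from_subspace[OF subspace_algebra trace_add trace_scaleR])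

text \<open>All norms on the finite-dimensional space \<open>S\<close> are equivalent; the trace norm is definite because the
  trace is faithful.\<close>

lemma ip_coercive: "\<exists>c>0. \<forall>X\<in>S. c * (norm X)\<^sup>2 \<le> ip X X"
proof (cases "S = {0}")
  case True
  then show ?thesis by (intro exI[of _ 1]) (auto simp: ip_nonneg zero_closed)
next
  case False
  let ?K = "S \<inter> sphere 0 1"
  obtain g where g: "bounded_linear g" "\<And>X. X \<in> S \<Longrightarrow> g X = t X" using trace_bounded_linear by blast
  have K: "compact ?K" using subspace_algebra by (simp add: closed_subspace closed_Int_compact)
  obtain X0 where "X0 \<in> S" "X0 \<noteq> 0" using False zero_closed by blast
  then have "(1 / norm X0) *\<^sub>R X0 \<in> ?K" by (simp add: closed)
  then have ne: "?K \<noteq> {}" by blast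
  have "continuous_on UNIV (mstar :: 'n cmat \<Rightarrow> 'n cmat)"
    by (rule linear_continuous_on[OF bounded_linear_mstar])
  then have "continuous_on UNIV (\<lambda>X :: 'n cmat. mstar X ** X)"
    by (rule mmult.continuous_on) (rule continuous_on_id)
  then have "continuous_on UNIV (\<lambda>X :: 'n cmat. Re (g (mstar X ** X)))"
    by (intro continuous_on_Re bounded_linear.continuous_on[OF g(1)])
  then have cont: "continuous_on ?K (\<lambda>X. Re (g (mstar X ** X)))" by (rule continuous_on_subset) simp
  obtain U where U: "U \<in> ?K" and min: "\<And>X. X \<in> ?K \<Longrightarrow> Re (g (mstar U ** U)) \<le> Re (g (mstar X ** X))"
    using continuous_attains_inf[OF K ne cont] by blast
  have gip: "Re (g (mstar X ** X)) = ip X X" if "X \<in> S" for X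
    using that by (simp add: g(2) ip_def closed)
  show ?thesis
  proof (intro exI conjI ballI)
    show "ip U U > 0" using U by (intro ip_pos) auto
    show "ip U U * (norm X)\<^sup>2 \<le> ip X X" if X: "X \<in> S" for X
    proof (cases "X = 0")
      case False
      then have *: "(1 / norm X) *\<^sub>R X \<in> ?K" using X by (simp add: closed)
      have "ip U U \<le> ip ((1 / norm X) *\<^sub>R X) ((1 / norm X) *\<^sub>R X)"
        using min[OF *] gip U X by (simp add: closed)
      also have "\<dots> = ip X X / (norm X)\<^sup>2"
        using X by (simp add: ip_scaleR_left ip_scaleR_right closed power2_eq_square)
      finally show ?thesis using False by (simp add: field_simps)
    qed (use ip_nonneg[OF zero_closed] in simp)
  qed
qed

text \<open>The defining descriptions of the trace adjoints denote, since the functional on the right is linear.\<close>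

lemma trace_adjoint_properties:
  assumes "\<And>X Y. X \<in> S \<Longrightarrow> Y \<in> S \<Longrightarrow> u (mstar C ** F (X + Y)) = u (mstar C ** F X) + u (mstar C ** F Y)"
    and "\<And>z X. X \<in> S \<Longrightarrow> u (mstar C ** F (cscale z X)) = z * u (mstar C ** F X)"
  shows "trace_adjoint S t u F C \<in> S"
    and "Z \<in> S \<Longrightarrow> t (mstar (trace_adjoint S t u F C) ** Z) = u (mstar C ** F Z)"
proof -
  have "\<exists>!X. X \<in> S \<and> (\<forall>Z\<in>S. t (mstar X ** Z) = u (mstar C ** F Z))"
    by (rule riesz) (use assms in auto)
  from theI'[OF this] show "trace_adjoint S t u F C \<in> S"
    "Z \<in> S \<Longrightarrow> t (mstar (trace_adjoint S t u F C) ** Z) = u (mstar C ** F Z)"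
    unfolding trace_adjoint_def by auto
qed

lemma ip_bounded: "\<exists>K>0. \<forall>X\<in>S. ip X X \<le> K * (norm X)\<^sup>2"
proof -
  obtain g where g: "bounded_linear g" "\<And>X. X \<in> S \<Longrightarrow> g X = t X"
    using trace_bounded_linear by blast
  obtain K1 where K1: "K1 > 0" "\<And>X. norm (g X) \<le> norm X * K1"
    using bounded_linear.pos_bounded[OF g(1)] by blast
  obtain K2 where K2: "K2 > 0" "\<And>X :: 'n cmat. norm (mstar X :: 'n cmat) \<le> norm X * K2"
    using bounded_linear.pos_bounded[OF bounded_linear_mstar] by blast
  obtain K3 where K3: "K3 > 0" "\<And>(X :: 'n cmat) (Y :: 'n cmat). norm (X ** Y) \<le> norm X * norm Y * K3"
    using mmult.pos_bounded by blast
  have "ip X X \<le> (K2 * K3 * K1) * (norm X)\<^sup>2" if "X \<in> S" for X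
  proof -
    have "ip X X = Re (g (mstar X ** X))" using that by (simp add: ip_def g(2) closed)
    also have "\<dots> \<le> norm (g (mstar X ** X))" by (rule complex_Re_le_cmod)
    also have "\<dots> \<le> norm (mstar X ** X) * K1" by (rule K1(2))
    also have "\<dots> \<le> (norm (mstar X) * norm X * K3) * K1"
      by (rule mult_right_mono[OF K3(2)]) (use K1(1) in simp)
    also have "\<dots> \<le> ((norm X * K2) * norm X * K3) * K1"
      by (intro mult_right_mono K2(2)) (use K1(1) K3(1) in simp_all)
    finally show ?thesis by (simp add: power2_eq_square mult_ac)
  qed
  moreover have "K2 * K3 * K1 > 0" using K1(1) K2(1) K3(1) by simp
  ultimately show ?thesis by blast
qed

end

locale unital_trace_algebra = trace_algebra S t for S :: "'n::finite cmat set" and t +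
  assumes one_closed: "mat 1 \<in> S"
begin

lemma lagrange_closed: "X \<in> S \<Longrightarrow> lagrange X l ms \<in> S"
  by (induction ms) (auto intro!: closed one_closed)

lemma specproj_closed: "X \<in> S \<Longrightarrow> mstar X = X \<Longrightarrow> l \<in> eigvals X \<Longrightarrow> specproj X l \<in> S"
  using specproj_lagrange lagrange_closed by metis

lemma fcalc_closed: "X \<in> S \<Longrightarrow> mstar X = X \<Longrightarrow> fcalc f X \<in> S"
  unfolding fcalc_def by (intro closed specproj_closed)

lemma vn_unit_one: "vn_unit S = mat 1"
  using vn_unit(2)[OF one_closed] by simp

text \<open>By cyclicity and idempotence \<open>t(E F) = t(F E E F)\<close>; in particular such traces are nonnegative.\<close>

lemma trace_specproj_mult:
  assumes "X \<in> S" "mstar X = X" "k \<in> eigvals X" "Y \<in> S" "mstar Y = Y" "m \<in> eigvals Y"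
  shows "t (specproj X k ** specproj Y m) = of_real (ip (specproj X k ** specproj Y m) (specproj X k ** specproj Y m))"
proof -
  let ?E = "specproj X k" and ?F = "specproj Y m"
  have EF: "?E \<in> S" "?F \<in> S" using assms by (auto intro: specproj_closed)
  have "mstar (?E ** ?F) ** (?E ** ?F) = ?F ** (?E ** ?F)"
    using assms specproj_mult[of X k k] by (simp add: mstar_mult specproj_self_adjoint matrix_mul_assoc)
      (metis matrix_mul_assoc)
  moreover have "t (?F ** (?E ** ?F)) = t ((?E ** ?F) ** ?F)" using EF by (intro trace_cyclic closed)
  moreover have "(?E ** ?F) ** ?F = ?E ** ?F"
    using assms specproj_mult[of Y m m] by (simp add: matrix_mul_assoc[symmetric])
  ultimately show ?thesis using trace_square(1)[of "?E ** ?F"] EF by (simp add: ip_def closed)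
qed

text \<open>A state satisfies \<open>l t(E) \<le> 1\<close> for each eigenprojection \<open>E\<close>, and \<open>t(E)\<close>, the square of
  the trace norm of \<open>E\<close>, stays away from \<open>0\<close>: nonzero idempotents are bounded below in norm, because \<open>E = E E\<close>
  makes the norm at most a multiple of its square.\<close>

lemma state_eigvals_bounded:
  obtains R where "R > 0" "\<And>X l. X \<in> S \<Longrightarrow> psd X \<Longrightarrow> t X = 1 \<Longrightarrow> l \<in> eigvals X \<Longrightarrow> l \<le> R"
proof -
  obtain c where c: "c > 0" "\<And>X. X \<in> S \<Longrightarrow> c * (norm X)\<^sup>2 \<le> ip X X" using ip_coercive by blast
  obtain C where C: "C > 0" "\<And>(A :: 'n cmat) (B :: 'n cmat). norm (A ** B) \<le> norm A * norm B * C"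
    using mmult.pos_bounded by blast
  show ?thesis
  proof
    show "C\<^sup>2 / c > 0" using c C by simp
    fix X l assume X: "X \<in> S" "psd X" "t X = 1" and l: "l \<in> eigvals X"
    have sa: "mstar X = X" using X by (simp add: psd_def)
    have E: "specproj X k \<in> S" "t (specproj X k) = of_real (ip (specproj X k) (specproj X k))"
      if "k \<in> eigvals X" for k
      using that X sa trace_specproj_mult[of X k X k] by (auto simp: specproj_mult specproj_closed)
    have "1 = Re (t (fcalc (\<lambda>x. x) X))" using X by (simp add: spectral_decomposition[OF sa])
    also have "\<dots> = (\<Sum>k\<in>eigvals X. k * ip (specproj X k) (specproj X k))"
      unfolding fcalc_def using E by (simp add: trace_sum trace_scaleR closed)
    also have "\<dots> \<ge> l * ip (specproj X l) (specproj X l)"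
      using psd_eigvals_nonneg[OF X(2)] E ip_nonneg
      by (intro member_le_sum l finite_eigvals[OF sa]) auto
    finally have 1: "l * ip (specproj X l) (specproj X l) \<le> 1" .
    let ?E = "specproj X l"
    have "norm ?E = norm (?E ** ?E)" using specproj_mult[OF sa l l] by simp
    also have "\<dots> \<le> norm ?E * norm ?E * C" by (rule C(2))
    finally have "norm ?E * 1 \<le> norm ?E * (norm ?E * C)" by (simp only: mult.assoc mult_1_right)
    moreover have "0 < norm ?E" using specproj_nonzero[OF sa l] by simp
    ultimately have "1 \<le> norm ?E * C" by (simp only: mult_le_cancel_left_pos)
    then have "1 \<le> (norm ?E * C)\<^sup>2" by (rule one_le_power)
    then have "c * 1 \<le> c * (norm ?E * C)\<^sup>2" using c(1) by (intro mult_left_mono) auto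
    also have "\<dots> = (c * (norm ?E)\<^sup>2) * C\<^sup>2" by (simp only: power_mult_distrib mult.assoc)
    also have "\<dots> \<le> ip ?E ?E * C\<^sup>2" using c(2)[OF E(1)[OF l]] by (rule mult_right_mono) simp
    finally have "c \<le> ip ?E ?E * C\<^sup>2" by simp
    then have "l * c \<le> l * (ip ?E ?E * C\<^sup>2)" using psd_eigvals_nonneg[OF X(2) l] by (rule mult_left_mono)
    also have "\<dots> = (l * ip ?E ?E) * C\<^sup>2" by simp
    also have "\<dots> \<le> 1 * C\<^sup>2" by (rule mult_right_mono[OF 1]) simp
    finally show "l \<le> C\<^sup>2 / c" using c(1) by (simp add: field_simps)
  qed
qed

text \<open>Klein's inequality: expanding in the eigenprojections of both matrices reduces it to the scalar
  inequality \<open>k - m \<le> k (ln k - ln m)\<close>, weighted with the nonnegative traces of the products of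
  projections.\<close>

lemma klein_inequality:
  assumes X: "X \<in> S" "psd X" and Y: "Y \<in> S" "posdef Y"
  shows "Re (t X) - Re (t Y) \<le> Re (t (X ** (fcalc ln X - fcalc ln Y)))"
proof -
  have sa: "mstar X = X" "mstar Y = Y" using X Y by (simp_all add: psd_def posdef_def)
  let ?E = "specproj X" and ?F = "specproj Y"
  have EF: "\<And>k. k \<in> eigvals X \<Longrightarrow> ?E k \<in> S" "\<And>m. m \<in> eigvals Y \<Longrightarrow> ?F m \<in> S"
    using X Y sa by (auto intro: specproj_closed)
  have exp: "Re (t (fcalc f X ** fcalc g Y)) = (\<Sum>k\<in>eigvals X. \<Sum>m\<in>eigvals Y. f k * g m * Re (t (?E k ** ?F m)))" for f g
  proof -
    have "fcalc f X ** fcalc g Y = (\<Sum>k\<in>eigvals X. \<Sum>m\<in>eigvals Y. (f k * g m) *\<^sub>R (?E k ** ?F m))"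
      unfolding fcalc_def
      by (simp add: mmult.sum_left mmult.scaleR_left) (simp add: mmult.sum_right mmult.scaleR_right scaleR_sum_right)
    then show ?thesis using EF by (simp add: trace_sum trace_scaleR closed)
  qed
  have one: "fcalc (\<lambda>_. 1) X = mat 1" "fcalc (\<lambda>_. 1) Y = mat 1" using sa by (auto intro: fcalc_one)
  have "X ** (fcalc ln X - fcalc ln Y)
      = fcalc (\<lambda>x. x) X ** fcalc ln X ** mat 1 - fcalc (\<lambda>x. x) X ** fcalc ln Y"
    by (simp add: spectral_decomposition[OF sa(1)] mmult.diff_right)
  also have "\<dots> = fcalc (\<lambda>x. x * ln x) X ** fcalc (\<lambda>_. 1) Y - fcalc (\<lambda>x. x) X ** fcalc ln Y"
    by (simp add: fcalc_mult[OF sa(1)] one)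
  finally have 1: "Re (t (X ** (fcalc ln X - fcalc ln Y)))
      = Re (t (fcalc (\<lambda>x. x * ln x) X ** fcalc (\<lambda>_. 1) Y)) - Re (t (fcalc (\<lambda>x. x) X ** fcalc ln Y))"
    using X Y sa by (simp add: trace_diff closed fcalc_closed)
  have "X = fcalc (\<lambda>x. x) X ** fcalc (\<lambda>_. 1) Y" "Y = fcalc (\<lambda>_. 1) X ** fcalc (\<lambda>x. x) Y"
    using sa by (simp_all add: one spectral_decomposition)
  then have 2: "Re (t X) - Re (t Y) = Re (t (fcalc (\<lambda>x. x) X ** fcalc (\<lambda>_. 1) Y)) - Re (t (fcalc (\<lambda>_. 1) X ** fcalc (\<lambda>x. x) Y))"
    by metis
  have scalar: "k - m \<le> k * ln k - k * ln m" if "k \<ge> 0" "m > 0" for k m :: real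
  proof (cases "k = 0")
    case False
    with that have "k > 0" by simp
    then have "ln (m / k) \<le> m / k - 1" using that by (intro ln_le_minus_one) simp
    then have "k * (ln m - ln k) \<le> k * (m / k - 1)"
      using \<open>k > 0\<close> that by (intro mult_left_mono) (auto simp: ln_div)
    then show ?thesis using \<open>k > 0\<close> by (simp add: algebra_simps)
  qed (use that in simp)
  have "(k - m) * Re (t (?E k ** ?F m)) \<le> (k * ln k - k * ln m) * Re (t (?E k ** ?F m))"
    if "k \<in> eigvals X" "m \<in> eigvals Y" for k m
  proof (rule mult_right_mono)
    show "k - m \<le> k * ln k - k * ln m"
      by (rule scalar[OF psd_eigvals_nonneg[OF X(2) that(1)] posdef_eigvals_pos[OF Y(2) that(2)]])
    have "0 \<le> ip (?E k ** ?F m) (?E k ** ?F m)" using that by (intro ip_nonneg closed EF)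
    then show "0 \<le> Re (t (?E k ** ?F m))"
      by (simp add: trace_specproj_mult[OF X(1) sa(1) that(1) Y(1) sa(2) that(2)])
  qed
  then show ?thesis unfolding 1 2 exp
    by (simp add: sum_subtractf[symmetric] left_diff_distrib[symmetric] sum_mono)
qed

end

section \<open>Double operators on a bimodule\<close>

lemma unital_star_hom_simps:
  assumes "unital_star_hom S T h"
  shows "X \<in> S \<Longrightarrow> h X \<in> T"
    and "X \<in> S \<Longrightarrow> Y \<in> S \<Longrightarrow> h (X + Y) = h X + h Y"
    and "X \<in> S \<Longrightarrow> h (cscale z X) = cscale z (h X)"
    and "X \<in> S \<Longrightarrow> h (c *\<^sub>R X) = c *\<^sub>R h X"
    and "X \<in> S \<Longrightarrow> Y \<in> S \<Longrightarrow> h (X ** Y) = h X ** h Y"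
    and "X \<in> S \<Longrightarrow> h (mstar X) = mstar (h X)"
    and "h (vn_unit S) = vn_unit T"
  using assms by (auto simp: unital_star_hom_def cscale_of_real[symmetric])

locale trace_bimodule = A: unital_trace_algebra S t + B: trace_algebra T u
  for S :: "'n::finite cmat set" and t and T :: "'m::finite cmat set" and u +
  fixes l r :: "'n cmat \<Rightarrow> 'm cmat"
  assumes l_hom: "unital_star_hom S T l" and r_hom: "unital_star_hom S T r"
begin

lemmas l_simps = unital_star_hom_simps[OF l_hom]
lemmas r_simps = unital_star_hom_simps[OF r_hom]

lemma hom_diff:
  assumes "unital_star_hom S T h" "X \<in> S" "Y \<in> S" shows "h (X - Y) = h X - h Y"
  using unital_star_hom_simps(2)[OF assms(1), of "X - Y" Y] assms by (simp add: A.closed)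

lemma hom_sum:
  assumes h: "unital_star_hom S T h" and f: "\<And>i. i \<in> I \<Longrightarrow> f i \<in> S"
  shows "h (sum f I) = (\<Sum>i\<in>I. h (f i))"
  using f
proof (induction I rule: infinite_finite_induct)
  case empty
  then show ?case using unital_star_hom_simps(4)[OF h A.zero_closed, of 0] by simp
next
  case (infinite I)
  then show ?case using unital_star_hom_simps(4)[OF h A.zero_closed, of 0] by simp
qed (simp add: unital_star_hom_simps(2)[OF h] A.closed)

lemma hom_one_mult: "C \<in> T \<Longrightarrow> l (mat 1) ** C = C" "C \<in> T \<Longrightarrow> C ** r (mat 1) = C"
  using l_simps(7) r_simps(7) B.vn_unit by (simp_all add: A.vn_unit_one)

lemma hom_bounded_linear:
  assumes "unital_star_hom S T h"
  shows "\<exists>g. bounded_linear g \<and> (\<forall>X\<in>S. g X = h X)"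
  by (rule bounded_linear_extension_from_subspace[OF A.subspace_algebra
        unital_star_hom_simps(2)[OF assms] unital_star_hom_simps(4)[OF assms]])

text \<open>Corner of \<open>C\<close> between two spectral subspaces; these corners diagonalise every double operator with
  the same matrix \<open>X\<close>.\<close>

definition proj2 :: "'n cmat \<Rightarrow> real \<Rightarrow> real \<Rightarrow> 'm cmat \<Rightarrow> 'm cmat" where
  "proj2 X k m C = l (specproj X k) ** C ** r (specproj X m)"

text \<open>Double operator (Schur multiplier) with symbol \<open>f\<close>: the contraction of the double functional calculus
  \<open>f(X \<otimes> X)\<close> with \<open>C\<close>. For the weighted logarithmic mean it is the operator in the transport metric.\<close>

definition dop :: "(real \<Rightarrow> real \<Rightarrow> real) \<Rightarrow> 'n cmat \<Rightarrow> 'm cmat \<Rightarrow> 'm cmat" where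
  "dop f X C = (\<Sum>k\<in>eigvals X. \<Sum>m\<in>eigvals X. f k m *\<^sub>R proj2 X k m C)"

lemma proj2_scaleR: "proj2 X k m (c *\<^sub>R C) = c *\<^sub>R proj2 X k m C"
  and proj2_sum: "proj2 X k m (sum g I) = (\<Sum>i\<in>I. proj2 X k m (g i))"
  by (simp_all add: proj2_def mmult.add_left mmult.add_right mmult.scaleR_left mmult.scaleR_right
      mmult.sum_left mmult.sum_right)

context
  fixes X assumes X: "X \<in> S" and sa: "mstar X = X"
begin

lemma specproj_in: "k \<in> eigvals X \<Longrightarrow> specproj X k \<in> S"
  using X sa by (rule A.specproj_closed)

lemma hom_specproj_mult:
  assumes "k \<in> eigvals X" "m \<in> eigvals X" and h: "unital_star_hom S T h"
  shows "h (specproj X k) ** h (specproj X m) = (if k = m then h (specproj X k) else 0)"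
  using unital_star_hom_simps(5)[OF h specproj_in specproj_in, OF assms(1,2)]
    unital_star_hom_simps(4)[OF h A.zero_closed, of 0] specproj_mult[OF sa assms(1,2)]
  by (auto split: if_splits)

lemma hom_specproj_star:
  assumes "k \<in> eigvals X" and h: "unital_star_hom S T h"
  shows "mstar (h (specproj X k)) = h (specproj X k)"
  using unital_star_hom_simps(6)[OF h specproj_in[OF assms(1)]] specproj_self_adjoint[OF sa assms(1)]
  by simp

lemma hom_specproj_sum:
  assumes h: "unital_star_hom S T h"
  shows "(\<Sum>k\<in>eigvals X. h (specproj X k)) = h (mat 1)"
  using hom_sum[OF h, of "eigvals X" "specproj X"] specproj_in specproj_sum[OF sa] by simp

lemma proj2_closed: "C \<in> T \<Longrightarrow> k \<in> eigvals X \<Longrightarrow> m \<in> eigvals X \<Longrightarrow> proj2 X k m C \<in> T"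
  by (simp add: proj2_def B.closed l_simps r_simps specproj_in)

lemma dop_closed: "C \<in> T \<Longrightarrow> dop f X C \<in> T"
  unfolding dop_def by (intro B.closed proj2_closed)

lemma proj2_proj2:
  assumes "k \<in> eigvals X" "m \<in> eigvals X" "k' \<in> eigvals X" "m' \<in> eigvals X"
  shows "proj2 X k m (proj2 X k' m' C) = (if k = k' \<and> m = m' then proj2 X k m C else 0)"
proof -
  have "proj2 X k m (proj2 X k' m' C)
      = (l (specproj X k) ** l (specproj X k')) ** C ** (r (specproj X m') ** r (specproj X m))"
    by (simp add: proj2_def matrix_mul_assoc)
  then show ?thesis
    using assms by (auto simp: proj2_def hom_specproj_mult[OF _ _ l_hom] hom_specproj_mult[OF _ _ r_hom])
qed

lemma proj2_dop:
  assumes "k \<in> eigvals X" "m \<in> eigvals X"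
  shows "proj2 X k m (dop f X C) = f k m *\<^sub>R proj2 X k m C"
proof -
  have "proj2 X k m (dop f X C) = (\<Sum>k'\<in>eigvals X. \<Sum>m'\<in>eigvals X. f k' m' *\<^sub>R proj2 X k m (proj2 X k' m' C))"
    by (simp add: dop_def proj2_sum proj2_scaleR)
  also have "\<dots> = (\<Sum>k'\<in>eigvals X. if k = k' then (\<Sum>m'\<in>eigvals X. if m = m' then f k' m' *\<^sub>R proj2 X k m C else 0) else 0)"
    using assms by (intro sum.cong refl) (auto simp: proj2_proj2 intro!: sum.cong sum.neutral)
  also have "\<dots> = f k m *\<^sub>R proj2 X k m C"
    using assms finite_eigvals[OF sa] by simp
  finally show ?thesis .
qed

text \<open>The corners are eigenvectors, so composition multiplies the symbols.\<close>

lemma dop_dop: "dop f X (dop g X C) = dop (\<lambda>k m. f k m * g k m) X C"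
  unfolding dop_def[of f] dop_def[of "\<lambda>k m. f k m * g k m"]
  by (intro sum.cong refl) (simp add: proj2_dop)

lemma dop_diff: "dop f X C - dop g X C = dop (\<lambda>k m. f k m - g k m) X C"
  by (simp add: dop_def scaleR_diff_left sum_subtractf)

lemma dop_left: assumes C: "C \<in> T" shows "l (fcalc f X) ** C = dop (\<lambda>k m. f k) X C"
proof -
  have "l (fcalc f X) ** C = (\<Sum>k\<in>eigvals X. f k *\<^sub>R (l (specproj X k) ** C ** r (mat 1)))"
    unfolding fcalc_def
    using C specproj_in by (simp add: hom_sum[OF l_hom] l_simps A.closed mmult.sum_left mmult.scaleR_left
        hom_one_mult B.closed)
  then show ?thesis
    by (simp add: hom_specproj_sum[OF r_hom, symmetric] dop_def proj2_def mmult.sum_right scaleR_sum_right)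
qed

lemma dop_right: assumes C: "C \<in> T" shows "C ** r (fcalc f X) = dop (\<lambda>k m. f m) X C"
proof -
  have "C ** r (fcalc f X) = (\<Sum>m\<in>eigvals X. f m *\<^sub>R (l (mat 1) ** C ** r (specproj X m)))"
    unfolding fcalc_def
    using C specproj_in by (simp add: hom_sum[OF r_hom] r_simps A.closed mmult.sum_right mmult.scaleR_right
        hom_one_mult B.closed)
  also have "\<dots> = (\<Sum>m\<in>eigvals X. \<Sum>k\<in>eigvals X. f m *\<^sub>R proj2 X k m C)"
    by (simp add: hom_specproj_sum[OF l_hom, symmetric] proj2_def mmult.sum_left scaleR_sum_right)
  also have "\<dots> = dop (\<lambda>k m. f m) X C" unfolding dop_def by (rule sum.swap)
  finally show ?thesis .
qed

lemma dop_one: assumes C: "C \<in> T" shows "dop (\<lambda>k m. 1) X C = C"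
  using dop_left[OF C, of "\<lambda>_. 1"] fcalc_one[OF sa, of "\<lambda>_. 1"] hom_one_mult(1)[OF C] by simp

lemma dop_const: assumes C: "C \<in> T" shows "dop (\<lambda>k m. c) X C = c *\<^sub>R C"
  using dop_one[OF C] by (simp add: dop_def scaleR_sum_right[symmetric])

text \<open>Multiplication by projections from both sides is self-adjoint for the trace inner product, because
  the trace is cyclic.\<close>

lemma ip_proj2:
  assumes C: "C \<in> T" "D \<in> T" and km: "k \<in> eigvals X" "m \<in> eigvals X"
  shows "B.ip C (proj2 X k m D) = B.ip (proj2 X k m C) (proj2 X k m D)"
proof -
  let ?p = "proj2 X k m D" and ?E = "l (specproj X k)" and ?F = "r (specproj X m)"
  have cl: "?p \<in> T" "?E \<in> T" "?F \<in> T" "mstar C \<in> T"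
    using C km by (auto simp: proj2_closed l_simps r_simps specproj_in B.closed)
  have "?E ** ?p ** ?F = ?p" using proj2_proj2[OF km km, of D] by (simp add: proj2_def)
  then have "u (mstar C ** ?p) = u ((mstar C ** ?E ** ?p) ** ?F)"
    by (metis matrix_mul_assoc)
  also have "\<dots> = u (?F ** (mstar C ** ?E ** ?p))" by (intro B.trace_cyclic B.mult_closed cl)
  also have "?F ** (mstar C ** ?E ** ?p) = mstar (proj2 X k m C) ** ?p"
    by (simp only: proj2_def[of X k m C] mstar_mult hom_specproj_star[OF km(1) l_hom]
        hom_specproj_star[OF km(2) r_hom] matrix_mul_assoc)
  finally show ?thesis by (simp add: B.ip_def)
qed

lemma ip_dop:
  assumes C: "C \<in> T" "D \<in> T"
  shows "B.ip C (dop f X D) = (\<Sum>k\<in>eigvals X. \<Sum>m\<in>eigvals X. f k m * B.ip (proj2 X k m C) (proj2 X k m D))"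
proof -
  have "B.ip C (dop f X D) = (\<Sum>k\<in>eigvals X. \<Sum>m\<in>eigvals X. f k m * B.ip C (proj2 X k m D))"
    unfolding dop_def using C proj2_closed by (simp add: B.ip_sum_right B.ip_scaleR_right B.closed)
  then show ?thesis using C by (simp add: ip_proj2)
qed

lemma ip_dop_mono:
  assumes C: "C \<in> T" and fg: "\<And>k m. k \<in> eigvals X \<Longrightarrow> m \<in> eigvals X \<Longrightarrow> f k m \<le> g k m"
  shows "B.ip C (dop f X C) \<le> B.ip C (dop g X C)"
  unfolding ip_dop[OF C C] using fg C
  by (intro sum_mono mult_right_mono B.ip_nonneg proj2_closed)

lemma ip_dop_const: "C \<in> T \<Longrightarrow> B.ip C (dop (\<lambda>_ _. c) X C) = c * B.ip C C"
  by (simp add: dop_const B.ip_scaleR_right)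

text \<open>In the corners the form is a sum of weighted inner products with nonnegative weights.\<close>

lemma ip_dop_am_gm:
  assumes C: "C \<in> T" "D \<in> T" and c: "c > 0"
    and f: "\<And>k m. k \<in> eigvals X \<Longrightarrow> m \<in> eigvals X \<Longrightarrow> 0 \<le> f k m"
  shows "2 * \<bar>B.ip C (dop f X D)\<bar> \<le> c * B.ip C (dop f X C) + B.ip D (dop f X D) / c"
proof -
  let ?p = "proj2 X"
  have "2 * \<bar>B.ip C (dop f X D)\<bar>
      \<le> 2 * (\<Sum>k\<in>eigvals X. \<Sum>m\<in>eigvals X. \<bar>f k m * B.ip (?p k m C) (?p k m D)\<bar>)"
    unfolding ip_dop[OF C] by (intro mult_left_mono order_trans[OF sum_abs] sum_mono sum_abs) simp
  also have "\<dots> = (\<Sum>k\<in>eigvals X. \<Sum>m\<in>eigvals X. f k m * (2 * \<bar>B.ip (?p k m C) (?p k m D)\<bar>))"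
    using f by (simp add: sum_distrib_left abs_mult mult_ac)
  also have "\<dots> \<le> (\<Sum>k\<in>eigvals X. \<Sum>m\<in>eigvals X.
      f k m * (c * B.ip (?p k m C) (?p k m C) + B.ip (?p k m D) (?p k m D) / c))"
    using C f c by (intro sum_mono mult_left_mono B.ip_am_gm proj2_closed)
  also have "\<dots> = c * B.ip C (dop f X C) + B.ip D (dop f X D) / c"
    using C by (simp add: ip_dop sum_distrib_left sum_divide_distrib sum.distrib distrib_left mult_ac)
  finally show ?thesis .
qed

end

text \<open>A double operator with a polynomial symbol is built from left and right multiplications, so it depends
  continuously on the matrix; general symbols are handled by uniform approximation.\<close>

lemma dop_polynomial_continuous:
  fixes F :: "'a filter"
  assumes p: "real_polynomial_function p"
    and X: "X \<in> S" "mstar X = X" and g: "(g \<longlongrightarrow> X) F" "\<forall>\<^sub>F i in F. g i \<in> S \<and> mstar (g i) = g i"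
    and "C \<in> T" "(c \<longlongrightarrow> C) F" "\<forall>\<^sub>F i in F. c i \<in> T"
  shows "((\<lambda>i. dop (\<lambda>k m. p (k, m)) (g i) (c i)) \<longlongrightarrow> dop (\<lambda>k m. p (k, m)) X C) F"
  using p assms(6-)
proof (induction arbitrary: C c rule: real_polynomial_function.induct)
  case (linear p)
  obtain l' r' where lr: "bounded_linear l'" "\<And>Y. Y \<in> S \<Longrightarrow> l' Y = l Y"
    "bounded_linear r'" "\<And>Y. Y \<in> S \<Longrightarrow> r' Y = r Y"
    using hom_bounded_linear[OF l_hom] hom_bounded_linear[OF r_hom] by blast
  have lin: "linear p" using linear(1) by (simp add: linear_conv_bounded_linear)
  define \<alpha> \<beta> where ab: "\<alpha> = p (1, 0)" "\<beta> = p (0, 1)"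
  have p: "p (k, m) = k * \<alpha> + m * \<beta>" for k m
    unfolding ab using linear_add[OF lin, of "(k, 0)" "(0, m)"] linear_scale[OF lin, of k "(1, 0)"]
      linear_scale[OF lin, of m "(0, 1)"] by simp
  have eq: "dop (\<lambda>k m. p (k, m)) Y D = \<alpha> *\<^sub>R (l' Y ** D) + \<beta> *\<^sub>R (D ** r' Y)"
    if "Y \<in> S" "mstar Y = Y" "D \<in> T" for Y D
  proof -
    have 1: "l' Y ** D = dop (\<lambda>k m. k) Y D" "D ** r' Y = dop (\<lambda>k m. m) Y D"
      using dop_left[OF that, of "\<lambda>x. x"] dop_right[OF that, of "\<lambda>x. x"] lr that
      by (simp_all add: spectral_decomposition)
    show ?thesis unfolding 1
      by (simp add: dop_def p scaleR_sum_right scaleR_add_left sum.distrib mult.commute)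
  qed
  have "((\<lambda>i. \<alpha> *\<^sub>R (l' (g i) ** c i) + \<beta> *\<^sub>R (c i ** r' (g i)))
      \<longlongrightarrow> \<alpha> *\<^sub>R (l' X ** C) + \<beta> *\<^sub>R (C ** r' X)) F"
    by (intro tendsto_add tendsto_scaleR tendsto_const mmult.tendsto bounded_linear.tendsto[OF lr(1)]
        bounded_linear.tendsto[OF lr(3)] g linear(3))
  then show ?case unfolding eq[OF X linear(2)]
    by (rule Lim_transform_eventually) (use g(2) linear(4) in eventually_elim, simp add: eq)
next
  case (const a)
  have "((\<lambda>i. a *\<^sub>R c i) \<longlongrightarrow> a *\<^sub>R C) F"
    by (intro tendsto_scaleR tendsto_const const(2))
  then show ?case unfolding dop_const[OF X const(1)]
    by (rule Lim_transform_eventually) (use g(2) const(3) in eventually_elim, simp add: dop_const)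
next
  case (add p q)
  have "((\<lambda>i. dop (\<lambda>k m. p (k, m)) (g i) (c i) + dop (\<lambda>k m. q (k, m)) (g i) (c i))
     \<longlongrightarrow> dop (\<lambda>k m. p (k, m)) X C + dop (\<lambda>k m. q (k, m)) X C) F"
    by (intro tendsto_add add)
  then show ?case unfolding dop_def by (simp add: scaleR_add_left sum.distrib)
next
  case (mult p q)
  have cl: "\<forall>\<^sub>F i in F. dop (\<lambda>k m. q (k, m)) (g i) (c i) \<in> T"
    using g(2) mult(7) by eventually_elim (simp add: dop_closed)
  have "((\<lambda>i. dop (\<lambda>k m. p (k, m)) (g i) (dop (\<lambda>k m. q (k, m)) (g i) (c i)))
     \<longlongrightarrow> dop (\<lambda>k m. p (k, m)) X (dop (\<lambda>k m. q (k, m)) X C)) F"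
    by (rule mult(3)[OF dop_closed[OF X mult(5)] mult(4)[OF mult(5-7)] cl])
  then show ?case unfolding dop_dop[OF X]
    by (rule Lim_transform_eventually) (use g(2) in eventually_elim, simp add: dop_dop)
qed

text \<open>The form \<open>C \<mapsto> ip C (dop f Y C)\<close> is monotone in the symbol, so a uniform polynomial approximation
  of the symbol approximates the form uniformly in \<open>Y\<close>.\<close>

lemma ip_dop_continuous:
  fixes f :: "real \<Rightarrow> real \<Rightarrow> real"
  assumes f: "continuous_on ({a..b} \<times> {a..b}) (\<lambda>(k, m). f k m)"
    and X: "X \<in> S" "mstar X = X" "eigvals X \<subseteq> {a..b}" and C: "C \<in> T"
    and g: "(g \<longlongrightarrow> X) F" "\<forall>\<^sub>F i in F. g i \<in> S \<and> mstar (g i) = g i \<and> eigvals (g i) \<subseteq> {a..b}"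
  shows "((\<lambda>i. B.ip C (dop f (g i) C)) \<longlongrightarrow> B.ip C (dop f X C)) F"
proof (rule tendstoI)
  fix e :: real assume "e > 0"
  have "\<exists>d>0. 2 * (d * I) < e" if "I \<ge> 0" for I :: real
    using that \<open>e > 0\<close> by (intro exI[of _ "e / (2 * I + 1)"]) (auto simp: divide_simps)
  from this[OF B.ip_nonneg[OF C]] obtain d where d: "d > 0" "2 * (d * B.ip C C) < e" by blast
  obtain p where p: "real_polynomial_function p"
    "\<And>x. x \<in> {a..b} \<times> {a..b} \<Longrightarrow> \<bar>(\<lambda>(k, m). f k m) x - p x\<bar> < d"
    using Stone_Weierstrass_real_polynomial_function[OF _ f d(1)] compact_Times by blast
  have approx: "\<bar>B.ip C (dop f Y C) - B.ip C (dop (\<lambda>k m. p (k, m)) Y C)\<bar> \<le> d * B.ip C C"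
    if Y: "Y \<in> S" "mstar Y = Y" "eigvals Y \<subseteq> {a..b}" for Y
  proof -
    have *: "- d \<le> f k m - p (k, m)" "f k m - p (k, m) \<le> d" if "k \<in> eigvals Y" "m \<in> eigvals Y" for k m
      using p(2)[of "(k, m)"] that Y(3) by force+
    have "- d * B.ip C C \<le> B.ip C (dop (\<lambda>k m. f k m - p (k, m)) Y C)"
      using ip_dop_mono[OF Y(1,2) C, of "\<lambda>_ _. - d" "\<lambda>k m. f k m - p (k, m)"] *(1)
      by (simp add: ip_dop_const[OF Y(1,2) C])
    moreover have "B.ip C (dop (\<lambda>k m. f k m - p (k, m)) Y C) \<le> d * B.ip C C"
      using ip_dop_mono[OF Y(1,2) C, of "\<lambda>k m. f k m - p (k, m)" "\<lambda>_ _. d"] *(2)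
      by (simp add: ip_dop_const[OF Y(1,2) C])
    moreover have "B.ip C (dop (\<lambda>k m. f k m - p (k, m)) Y C)
        = B.ip C (dop f Y C) - B.ip C (dop (\<lambda>k m. p (k, m)) Y C)"
      using dop_closed[OF Y(1,2) C] C by (simp add: dop_diff[symmetric] Y B.ip_diff_right)
    ultimately show ?thesis by simp
  qed
  obtain u' where u': "bounded_linear u'" "\<And>Y. Y \<in> T \<Longrightarrow> u' Y = u Y"
    using B.trace_bounded_linear by blast
  have g': "\<forall>\<^sub>F i in F. g i \<in> S \<and> mstar (g i) = g i" using g(2) by eventually_elim simp
  have "((\<lambda>i. dop (\<lambda>k m. p (k, m)) (g i) C) \<longlongrightarrow> dop (\<lambda>k m. p (k, m)) X C) F"
    by (rule dop_polynomial_continuous[OF p(1) X(1,2) g(1) g' C]) (use C in auto)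
  then have "((\<lambda>i. Re (u' (mstar C ** dop (\<lambda>k m. p (k, m)) (g i) C)))
      \<longlongrightarrow> Re (u' (mstar C ** dop (\<lambda>k m. p (k, m)) X C))) F"
    by (intro tendsto_Re bounded_linear.tendsto[OF u'(1)] mmult.tendsto tendsto_const)
  moreover have "0 < e - 2 * (d * B.ip C C)" using d(2) by simp
  ultimately have "\<forall>\<^sub>F i in F. \<bar>Re (u' (mstar C ** dop (\<lambda>k m. p (k, m)) (g i) C))
      - Re (u' (mstar C ** dop (\<lambda>k m. p (k, m)) X C))\<bar> < e - 2 * (d * B.ip C C)"
    unfolding dist_real_def[symmetric] by (rule tendstoD)
  then show "\<forall>\<^sub>F i in F. dist (B.ip C (dop f (g i) C)) (B.ip C (dop f X C)) < e"
    using g(2)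
  proof eventually_elim
    case (elim i)
    have ip: "Re (u' (mstar C ** dop q Y C)) = B.ip C (dop q Y C)" if "Y \<in> S" "mstar Y = Y" for q Y
      using dop_closed[OF that C] C by (simp add: u'(2) B.ip_def B.closed)
    from elim have i: "g i \<in> S" "mstar (g i) = g i" "eigvals (g i) \<subseteq> {a..b}" by auto
    show ?case
      using elim(1) approx[OF i] approx[OF X] unfolding ip[OF i(1,2)] ip[OF X(1,2)] dist_real_def
      by argo
  qed
qed

end

section \<open>The logarithmic mean\<close>

lemma log_mean_commute: "log_mean r s = log_mean s r"
proof -
  have "(r - s) / (ln r - ln s) = (s - r) / (ln s - ln r)"
    by (metis minus_diff_eq minus_divide_divide)
  then show ?thesis by (auto simp: log_mean_def)
qed

lemma log_mean_between:
  assumes "0 < r" "0 < s" shows "min r s \<le> log_mean r s" "log_mean r s \<le> max r s"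
proof -
  have *: "r \<le> log_mean r s \<and> log_mean r s \<le> s" if "0 < r" "r < s" for r s
  proof -
    have "ln (s / r) \<le> s / r - 1" "ln (r / s) \<le> r / s - 1"
      using that by (intro ln_le_minus_one; simp)+
    then have "r * (ln s - ln r) \<le> s - r" "s - r \<le> s * (ln s - ln r)"
      using that by (simp_all add: ln_div field_simps)
    moreover have "ln s - ln r > 0" using that by simp
    moreover have "log_mean r s = (s - r) / (ln s - ln r)"
      using that by (subst log_mean_commute) (simp add: log_mean_def)
    ultimately show ?thesis by (simp add: pos_le_divide_eq pos_divide_le_eq)
  qed
  consider "r < s" | "s < r" | "r = s" by linarith
  then have "min r s \<le> log_mean r s \<and> log_mean r s \<le> max r s"
  proof cases
    case 2
    then show ?thesis using *[OF assms(2) 2] log_mean_commute[of r s] by simp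
  qed (use * assms in \<open>auto simp: log_mean_def\<close>)
  then show "min r s \<le> log_mean r s" "log_mean r s \<le> max r s" by auto
qed

lemma log_mean_nonneg: "0 \<le> r \<Longrightarrow> 0 \<le> s \<Longrightarrow> 0 \<le> log_mean r s"
  using log_mean_between(1)[of r s] by (cases "r = 0 \<or> s = 0") (auto simp: log_mean_def)

lemma log_mean_le_max: "0 \<le> r \<Longrightarrow> 0 \<le> s \<Longrightarrow> log_mean r s \<le> max r s"
  using log_mean_between(2)[of r s] by (cases "r = 0 \<or> s = 0") (auto simp: log_mean_def)

text \<open>Off the diagonal the quotient is continuous; on the diagonal the mean is squeezed between minimum
  and maximum.\<close>

lemma tendsto_log_mean:
  assumes f: "(f \<longlongrightarrow> r) F" and g: "(g \<longlongrightarrow> s) F" and rs: "0 < r" "0 < s"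
  shows "((\<lambda>x. log_mean (f x) (g x)) \<longlongrightarrow> log_mean r s) F"
proof -
  have pos: "\<forall>\<^sub>F x in F. 0 < f x" "\<forall>\<^sub>F x in F. 0 < g x"
    using f g rs order_tendstoD(1) by blast+
  show ?thesis
  proof (cases "r = s")
    case False
    have "((\<lambda>x. f x - g x) \<longlongrightarrow> r - s) F" by (intro tendsto_diff f g)
    then have "\<forall>\<^sub>F x in F. f x - g x \<noteq> 0" using False by (intro tendsto_imp_eventually_ne) auto
    then have eq: "\<forall>\<^sub>F x in F. (f x - g x) / (ln (f x) - ln (g x)) = log_mean (f x) (g x)"
      using pos by eventually_elim (auto simp: log_mean_def)
    have "((\<lambda>x. (f x - g x) / (ln (f x) - ln (g x))) \<longlongrightarrow> (r - s) / (ln r - ln s)) F"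
      using rs False by (intro tendsto_intros f g) auto
    then have "((\<lambda>x. log_mean (f x) (g x)) \<longlongrightarrow> (r - s) / (ln r - ln s)) F"
      by (rule Lim_transform_eventually[OF _ eq])
    then show ?thesis using rs False by (simp add: log_mean_def)
  next
    case True
    have lm: "log_mean r s = r" using rs True by (simp add: log_mean_def)
    have lim: "((\<lambda>x. min (f x) (g x)) \<longlongrightarrow> min r s) F" "((\<lambda>x. max (f x) (g x)) \<longlongrightarrow> max r s) F"
      by (intro tendsto_min tendsto_max f g)+
    have mid: "min r s = r" "max r s = r" using True by simp_all
    have lo: "\<forall>\<^sub>F x in F. min (f x) (g x) \<le> log_mean (f x) (g x)"
      and hi: "\<forall>\<^sub>F x in F. log_mean (f x) (g x) \<le> max (f x) (g x)"
      using pos by (eventually_elim, simp add: log_mean_between)+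
    show ?thesis unfolding lm by (rule tendsto_sandwich[OF lo hi lim[unfolded mid]])
  qed
qed

lemma theta_nonneg: "0 \<le> k \<Longrightarrow> 0 \<le> m \<Longrightarrow> 0 \<le> theta D j k m"
  by (simp add: theta_def log_mean_nonneg)

lemma theta_le:
  assumes "0 \<le> k" "0 \<le> m" "k \<le> R" "m \<le> R" shows "theta D j k m \<le> exp (\<bar>omg D j\<bar> / 2) * R"
proof -
  have "theta D j k m \<le> max (exp (omg D j / 2) * k) (exp (- omg D j / 2) * m)"
    unfolding theta_def using assms by (intro log_mean_le_max) auto
  also have "\<dots> \<le> exp (\<bar>omg D j\<bar> / 2) * R"
    using assms by (intro max.boundedI mult_mono) auto
  finally show ?thesis .
qed

lemma theta_continuous:
  assumes "0 < a" shows "continuous_on ({a..b} \<times> {a..b}) (\<lambda>(k, m). theta D j k m)"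
  unfolding continuous_on_def theta_def case_prod_beta
proof
  fix x assume "x \<in> {a..b} \<times> {a..b}"
  then show "((\<lambda>x. log_mean (exp (omg D j / 2) * fst x) (exp (- omg D j / 2) * snd x)) \<longlongrightarrow>
       log_mean (exp (omg D j / 2) * fst x) (exp (- omg D j / 2) * snd x)) (at x within {a..b} \<times> {a..b})"
    using assms by (intro tendsto_log_mean tendsto_intros) auto
qed

text \<open>The identity behind the chain rule: a logarithmic mean times the difference of the logarithms is the
  difference of its arguments.\<close>

lemma theta_log_difference:
  assumes "0 < k" "0 < m"
  shows "theta D j k m * (ln m - ln k - omg D j) = exp (- omg D j / 2) * m - exp (omg D j / 2) * k"
proof -
  let ?r = "exp (omg D j / 2) * k" and ?s = "exp (- omg D j / 2) * m"
  have "ln ?s = - omg D j / 2 + ln m" "ln ?r = omg D j / 2 + ln k" using assms by (simp_all add: ln_mult)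
  then have l: "ln ?s - ln ?r = ln m - ln k - omg D j" by linarith
  have pos: "?r > 0" "?s > 0" using assms by auto
  have "log_mean r s * (ln s - ln r) = s - r" if "r > 0" "s > 0" for r s
  proof (cases "r = s")
    case False
    then have "ln r - ln s \<noteq> 0" using that by simp
    moreover have "log_mean r s = (r - s) / (ln r - ln s)" using that False by (simp add: log_mean_def)
    ultimately have "log_mean r s * (ln r - ln s) = r - s" by simp
    then show ?thesis by (simp add: right_diff_distrib)
  qed simp
  from this[OF pos] show ?thesis unfolding theta_def l .
qed

section \<open>Differential structures\<close>

locale differential = fixes D :: "('n::finite, 'm::finite, 'j) diff_struct"
  assumes diff_str: "differential_structure D"
begin

sublocale A: unital_trace_algebra "Alg D" "Tr D"
  using diff_str by unfold_locales (auto simp: differential_structure_def)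

lemma bimodule: "j \<in> Idx D \<Longrightarrow> trace_bimodule (Alg D) (Tr D) (BAlg D j) (BTr D j) (lhom D j) (rhom D j)"
  using diff_str by unfold_locales (auto simp: differential_structure_def)

lemma velocity_closed: "j \<in> Idx D \<Longrightarrow> Vel D j \<in> BAlg D j"
  and sigma_state: "sig D \<in> states D"
  and sigma_invertible: "invertible (sig D)"
  and sigma_velocity: "j \<in> Idx D \<Longrightarrow>
    lhom D j (sig D) ** Vel D j ** rhom D j (matrix_inv (sig D)) = exp (- omg D j) *\<^sub>R Vel D j"
  using diff_str by (auto simp: differential_structure_def)

abbreviation ipB :: "'j \<Rightarrow> 'm cmat \<Rightarrow> 'm cmat \<Rightarrow> real" where
  "ipB j \<equiv> trace_algebra.ip (BTr D j)"

lemma sigma: "sig D \<in> Alg D" "mstar (sig D) = sig D" "posdef (sig D)" "Tr D (sig D) = 1"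
  "sig D \<in> pos_states D"
  using sigma_state psd_invertible_imp_posdef[OF _ sigma_invertible]
  by (auto simp: states_def pos_states_def psd_def)

lemma states_simps:
  assumes "\<rho> \<in> states D"
  shows "\<rho> \<in> Alg D" "mstar \<rho> = \<rho>" "psd \<rho>" "Tr D \<rho> = 1" "k \<in> eigvals \<rho> \<Longrightarrow> 0 \<le> k"
  using assms psd_eigvals_nonneg by (auto simp: states_def psd_def)

lemma pos_states_simps:
  assumes "\<rho> \<in> pos_states D"
  shows "\<rho> \<in> states D" "\<rho> \<in> Alg D" "mstar \<rho> = \<rho>" "posdef \<rho>" "Tr D \<rho> = 1" "k \<in> eigvals \<rho> \<Longrightarrow> 0 < k"
  using assms posdef_eigvals_pos posdef_imp_psd by (auto simp: states_def pos_states_def posdef_def)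

lemma pd_properties:
  assumes j: "j \<in> Idx D"
  shows pd_closed: "X \<in> Alg D \<Longrightarrow> pd D j X \<in> BAlg D j"
    and pd_add: "X \<in> Alg D \<Longrightarrow> Y \<in> Alg D \<Longrightarrow> pd D j (X + Y) = pd D j X + pd D j Y"
    and pd_cscale: "X \<in> Alg D \<Longrightarrow> pd D j (cscale z X) = cscale z (pd D j X)"
    and pd_scaleR: "X \<in> Alg D \<Longrightarrow> pd D j (c *\<^sub>R X) = c *\<^sub>R pd D j X"
proof -
  interpret M: trace_bimodule "Alg D" "Tr D" "BAlg D j" "BTr D j" "lhom D j" "rhom D j"
    by (rule bimodule[OF j])
  show "X \<in> Alg D \<Longrightarrow> pd D j X \<in> BAlg D j"
    using velocity_closed[OF j] by (simp add: pd_def M.B.closed M.l_simps M.r_simps)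
  show "X \<in> Alg D \<Longrightarrow> Y \<in> Alg D \<Longrightarrow> pd D j (X + Y) = pd D j X + pd D j Y"
    by (simp add: pd_def M.l_simps M.r_simps mmult.add_left mmult.add_right)
  show "X \<in> Alg D \<Longrightarrow> pd D j (cscale z X) = cscale z (pd D j X)"
    by (simp add: pd_def M.l_simps M.r_simps mult_cscale cscale_mult cscale_diff)
  show "X \<in> Alg D \<Longrightarrow> pd D j (c *\<^sub>R X) = c *\<^sub>R pd D j X"
    by (simp add: pd_def M.l_simps M.r_simps mmult.scaleR_left mmult.scaleR_right scaleR_diff_right)
qed

lemma pd_adj_properties:
  assumes j: "j \<in> Idx D" and C: "C \<in> BAlg D j"
  shows pd_adj_closed: "pd_adj D j C \<in> Alg D"
    and pd_adj: "Z \<in> Alg D \<Longrightarrow> Tr D (mstar (pd_adj D j C) ** Z) = BTr D j (mstar C ** pd D j Z)"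
proof -
  interpret M: trace_bimodule "Alg D" "Tr D" "BAlg D j" "BTr D j" "lhom D j" "rhom D j"
    by (rule bimodule[OF j])
  have 1: "BTr D j (mstar C ** pd D j (X + Y)) = BTr D j (mstar C ** pd D j X) + BTr D j (mstar C ** pd D j Y)"
    if "X \<in> Alg D" "Y \<in> Alg D" for X Y
    using that C pd_closed[OF j] by (simp add: pd_add[OF j] mmult.add_right M.B.trace_add M.B.closed)
  have 2: "BTr D j (mstar C ** pd D j (cscale z X)) = z * BTr D j (mstar C ** pd D j X)"
    if "X \<in> Alg D" for z X
    using that C pd_closed[OF j] by (simp add: pd_cscale[OF j] mult_cscale M.B.trace_cscale M.B.closed)
  show "pd_adj D j C \<in> Alg D"
    "Z \<in> Alg D \<Longrightarrow> Tr D (mstar (pd_adj D j C) ** Z) = BTr D j (mstar C ** pd D j Z)"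
    unfolding pd_adj_def using A.trace_adjoint_properties[of "BTr D j" C "pd D j", OF 1 2] by blast+
qed

lemma hat_op_dop: "hat_op D j = trace_bimodule.dop (lhom D j) (rhom D j) (theta D j)"
  if "j \<in> Idx D"
proof -
  interpret M: trace_bimodule "Alg D" "Tr D" "BAlg D j" "BTr D j" "lhom D j" "rhom D j"
    by (rule bimodule[OF that])
  show ?thesis by (intro ext) (simp add: hat_op_def M.dop_def M.proj2_def)
qed

lemma hat_op_closed:
  assumes j: "j \<in> Idx D" and "\<rho> \<in> Alg D" "mstar \<rho> = \<rho>" "C \<in> BAlg D j" shows "hat_op D j \<rho> C \<in> BAlg D j"
proof -
  interpret M: trace_bimodule "Alg D" "Tr D" "BAlg D j" "BTr D j" "lhom D j" "rhom D j"
    by (rule bimodule[OF j])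
  show ?thesis unfolding hat_op_dop[OF j] by (rule M.dop_closed[OF assms(2-)])
qed

section \<open>The Dirichlet form of the transport metric\<close>

text \<open>The Dirichlet form of the metric operator: the inner product of \<open>X\<close> with \<open>Kop D \<rho> Y\<close>.\<close>

definition qform :: "'n cmat \<Rightarrow> 'n cmat \<Rightarrow> 'n cmat \<Rightarrow> real" where
  "qform \<rho> X Y = (\<Sum>j\<in>Idx D. ipB j (pd D j X) (hat_op D j \<rho> (pd D j Y)))"

lemma Kop_closed: "\<rho> \<in> Alg D \<Longrightarrow> mstar \<rho> = \<rho> \<Longrightarrow> Y \<in> Alg D \<Longrightarrow> Kop D \<rho> Y \<in> Alg D"
  unfolding Kop_def by (intro A.sum_closed pd_adj_closed hat_op_closed pd_closed)

lemma trace_Kop: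
  assumes \<rho>: "\<rho> \<in> Alg D" "mstar \<rho> = \<rho>" and X: "X \<in> Alg D" "mstar X = X" and Y: "Y \<in> Alg D"
  shows "Re (Tr D (X ** Kop D \<rho> Y)) = qform \<rho> X Y"
proof -
  have "Re (Tr D (X ** Kop D \<rho> Y)) = A.ip X (Kop D \<rho> Y)" using X by (simp add: A.ip_def)
  also have "\<dots> = (\<Sum>j\<in>Idx D. A.ip X (pd_adj D j (hat_op D j \<rho> (pd D j Y))))"
    unfolding Kop_def by (intro A.ip_sum_right X pd_adj_closed hat_op_closed pd_closed \<rho> Y)
  also have "\<dots> = qform \<rho> X Y"
    unfolding qform_def
  proof (intro sum.cong refl)
    fix j assume j: "j \<in> Idx D"
    interpret M: trace_bimodule "Alg D" "Tr D" "BAlg D j" "BTr D j" "lhom D j" "rhom D j"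
      by (rule bimodule[OF j])
    let ?C = "hat_op D j \<rho> (pd D j Y)"
    have C: "?C \<in> BAlg D j" by (intro hat_op_closed j \<rho> pd_closed Y)
    have "A.ip X (pd_adj D j ?C) = A.ip (pd_adj D j ?C) X"
      by (intro A.ip_commute X pd_adj_closed j C)
    also have "\<dots> = ipB j ?C (pd D j X)" unfolding A.ip_def M.B.ip_def by (simp add: pd_adj j C X)
    also have "\<dots> = ipB j (pd D j X) ?C" by (intro M.B.ip_commute C pd_closed j X)
    finally show "A.ip X (pd_adj D j ?C) = ipB j (pd D j X) ?C" .
  qed
  finally show ?thesis .
qed

lemma qform_am_gm:
  assumes \<rho>: "\<rho> \<in> states D" and XY: "X \<in> Alg D" "Y \<in> Alg D" and c: "c > 0"
  shows "2 * \<bar>qform \<rho> X Y\<bar> \<le> c * qform \<rho> X X + qform \<rho> Y Y / c"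
proof -
  have "2 * \<bar>qform \<rho> X Y\<bar> \<le> (\<Sum>j\<in>Idx D. 2 * \<bar>ipB j (pd D j X) (hat_op D j \<rho> (pd D j Y))\<bar>)"
    unfolding qform_def sum_distrib_left[symmetric] by (intro mult_left_mono sum_abs) simp
  also have "\<dots> \<le> (\<Sum>j\<in>Idx D. c * ipB j (pd D j X) (hat_op D j \<rho> (pd D j X))
      + ipB j (pd D j Y) (hat_op D j \<rho> (pd D j Y)) / c)"
  proof (rule sum_mono)
    fix j assume j: "j \<in> Idx D"
    interpret M: trace_bimodule "Alg D" "Tr D" "BAlg D j" "BTr D j" "lhom D j" "rhom D j"
      by (rule bimodule[OF j])
    show "2 * \<bar>ipB j (pd D j X) (hat_op D j \<rho> (pd D j Y))\<bar> \<le> c * ipB j (pd D j X) (hat_op D j \<rho> (pd D j X))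
      + ipB j (pd D j Y) (hat_op D j \<rho> (pd D j Y)) / c"
      unfolding hat_op_dop[OF j]
      using states_simps[OF \<rho>] c
      by (intro M.ip_dop_am_gm pd_closed j XY theta_nonneg) auto
  qed
  also have "\<dots> = c * qform \<rho> X X + qform \<rho> Y Y / c"
    by (simp add: qform_def sum.distrib sum_distrib_left sum_divide_distrib)
  finally show ?thesis .
qed

lemma qform_nonneg:
  assumes "\<rho> \<in> states D" "X \<in> Alg D" shows "0 \<le> qform \<rho> X X"
  using qform_am_gm[OF assms(1,2,2), of 1] by simp

text \<open>Eigenvalues of states are uniformly bounded, hence so is the symbol \<open>theta\<close> on their spectra.\<close>

lemma qform_bounded: "\<exists>M>0. \<forall>\<rho>\<in>states D. \<forall>X\<in>Alg D. qform \<rho> X X \<le> M * (norm X)\<^sup>2"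
proof -
  obtain R where R: "R > 0" "\<And>\<rho> k. \<rho> \<in> states D \<Longrightarrow> k \<in> eigvals \<rho> \<Longrightarrow> k \<le> R"
    using A.state_eigvals_bounded states_simps(1,3,4) by metis
  have "\<exists>M\<ge>0. \<forall>\<rho>\<in>states D. \<forall>X\<in>Alg D. ipB j (pd D j X) (hat_op D j \<rho> (pd D j X)) \<le> M * (norm X)\<^sup>2"
    if j: "j \<in> Idx D" for j
  proof -
    interpret M: trace_bimodule "Alg D" "Tr D" "BAlg D j" "BTr D j" "lhom D j" "rhom D j"
      by (rule bimodule[OF j])
    obtain g where g: "bounded_linear g" "\<And>X. X \<in> Alg D \<Longrightarrow> g X = pd D j X"
      using bounded_linear_extension_from_subspace[OF A.subspace_algebra pd_add[OF j] pd_scaleR[OF j]]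
      by blast
    obtain K where K: "K > 0" "\<And>X. norm (g X) \<le> norm X * K"
      using bounded_linear.pos_bounded[OF g(1)] by blast
    obtain L where L: "L > 0" "\<And>C. C \<in> BAlg D j \<Longrightarrow> ipB j C C \<le> L * (norm C)\<^sup>2"
      using M.B.ip_bounded by blast
    define N where "N = exp (\<bar>omg D j\<bar> / 2) * R"
    have N: "N \<ge> 0" using R(1) by (simp add: N_def)
    have "ipB j (pd D j X) (hat_op D j \<rho> (pd D j X)) \<le> (N * (L * K\<^sup>2)) * (norm X)\<^sup>2"
      if \<rho>: "\<rho> \<in> states D" and X: "X \<in> Alg D" for \<rho> X
    proof -
      have P: "pd D j X \<in> BAlg D j" by (rule pd_closed[OF j X])
      have "ipB j (pd D j X) (hat_op D j \<rho> (pd D j X)) \<le> ipB j (pd D j X) (M.dop (\<lambda>_ _. N) \<rho> (pd D j X))"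
        unfolding hat_op_dop[OF j] N_def using states_simps[OF \<rho>] R(2)[OF \<rho>]
        by (intro M.ip_dop_mono P theta_le) auto
      also have "\<dots> = N * ipB j (pd D j X) (pd D j X)"
        by (rule M.ip_dop_const[OF states_simps(1,2)[OF \<rho>] P])
      also have "\<dots> \<le> N * (L * (norm X * K)\<^sup>2)"
        using L(2)[OF P] K(2)[of X] g(2)[OF X] N L(1) K(1)
        by (intro mult_left_mono order_trans[OF L(2)[OF P]] power_mono) auto
      finally show ?thesis by (simp add: power_mult_distrib mult_ac)
    qed
    moreover have "N * (L * K\<^sup>2) \<ge> 0" using N L(1) by simp
    ultimately show ?thesis by blast
  qed
  then obtain M where M: "\<And>j. j \<in> Idx D \<Longrightarrow> M j \<ge> 0"
    "\<And>j \<rho> X. j \<in> Idx D \<Longrightarrow> \<rho> \<in> states D \<Longrightarrow> X \<in> Alg D \<Longrightarrow>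
      ipB j (pd D j X) (hat_op D j \<rho> (pd D j X)) \<le> M j * (norm X)\<^sup>2"
    by metis
  have "qform \<rho> X X \<le> (1 + sum M (Idx D)) * (norm X)\<^sup>2" if "\<rho> \<in> states D" "X \<in> Alg D" for \<rho> X
  proof -
    have "qform \<rho> X X \<le> (\<Sum>j\<in>Idx D. M j * (norm X)\<^sup>2)"
      unfolding qform_def by (intro sum_mono M that)
    also have "\<dots> \<le> (1 + sum M (Idx D)) * (norm X)\<^sup>2" by (simp add: sum_distrib_right distrib_right)
    finally show ?thesis .
  qed
  moreover have "1 + sum M (Idx D) > 0" using M(1) by (simp add: sum_nonneg add_pos_nonneg)
  ultimately show ?thesis by blast
qed

text \<open>Near a positive definite \<open>\<rho>\<close> all spectra lie in one compact interval of positive numbers, on which the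
  symbol \<open>theta\<close> is continuous.\<close>

lemma qform_continuous:
  assumes \<rho>: "\<rho> \<in> pos_states D" and X: "X \<in> Alg D" and e: "e > 0"
  shows "\<exists>d>0. \<forall>\<nu>\<in>pos_states D. norm (\<nu> - \<rho>) < d \<longrightarrow> qform \<nu> X X \<le> qform \<rho> X X + e"
proof -
  obtain R where R: "R > 0" "\<And>\<rho> k. \<rho> \<in> states D \<Longrightarrow> k \<in> eigvals \<rho> \<Longrightarrow> k \<le> R"
    using A.state_eigvals_bounded states_simps(1,3,4) by metis
  obtain a d where a: "a > 0" "d > 0"
    "\<And>Y l. mstar Y = Y \<Longrightarrow> norm (Y - \<rho>) < d \<Longrightarrow> posdef Y \<and> (l \<in> eigvals Y \<longrightarrow> a \<le> l)"
    using posdef_neighbourhood[OF pos_states_simps(4)[OF \<rho>]] by metis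
  let ?F = "at \<rho> within pos_states D"
  have spec: "eigvals \<nu> \<subseteq> {a..R}" if "\<nu> \<in> pos_states D" "norm (\<nu> - \<rho>) < d" for \<nu>
    using a(3)[of \<nu>] R(2) pos_states_simps(1,3)[OF that(1)] that(2) by auto
  have near: "\<forall>\<^sub>F \<nu> in ?F. \<nu> \<in> Alg D \<and> mstar \<nu> = \<nu> \<and> eigvals \<nu> \<subseteq> {a..R}"
    unfolding eventually_at
    by (rule exI[of _ d]) (use a(2) spec pos_states_simps(2,3) in \<open>auto simp: dist_norm\<close>)
  have "((\<lambda>\<nu>. qform \<nu> X X) \<longlongrightarrow> qform \<rho> X X) ?F"
    unfolding qform_def
  proof (rule tendsto_sum)
    fix j assume j: "j \<in> Idx D"
    interpret M: trace_bimodule "Alg D" "Tr D" "BAlg D j" "BTr D j" "lhom D j" "rhom D j"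
      by (rule bimodule[OF j])
    show "((\<lambda>\<nu>. ipB j (pd D j X) (hat_op D j \<nu> (pd D j X))) \<longlongrightarrow>
        ipB j (pd D j X) (hat_op D j \<rho> (pd D j X))) ?F"
      unfolding hat_op_dop[OF j]
      by (rule M.ip_dop_continuous[OF theta_continuous[OF a(1)] pos_states_simps(2,3)[OF \<rho>]
            spec[OF \<rho>] pd_closed[OF j X] tendsto_ident_at near]) (use a(2) in simp)
  qed
  then have "\<forall>\<^sub>F \<nu> in ?F. qform \<nu> X X < qform \<rho> X X + e"
    using e by (intro order_tendstoD) auto
  then obtain d' where d': "d' > 0" "\<And>\<nu>. \<nu> \<in> pos_states D \<Longrightarrow> \<nu> \<noteq> \<rho> \<Longrightarrow> norm (\<nu> - \<rho>) < d' \<Longrightarrow>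
      qform \<nu> X X < qform \<rho> X X + e"
    unfolding eventually_at dist_norm by blast
  show ?thesis
  proof (intro exI[of _ d'] conjI ballI impI)
    fix \<nu> assume "\<nu> \<in> pos_states D" "norm (\<nu> - \<rho>) < d'"
    then show "qform \<nu> X X \<le> qform \<rho> X X + e" using d'(2)[of \<nu>] e by (cases "\<nu> = \<rho>") auto
  qed (rule d'(1))
qed

section \<open>The generator and the chain rule\<close>

abbreviation sq :: "'n cmat" where "sq \<equiv> fcalc sqrt (sig D)"
abbreviation isq :: "'n cmat" where "isq \<equiv> fcalc (\<lambda>x. 1 / sqrt x) (sig D)"

lemma sq_simps:
  shows "sq \<in> Alg D" "isq \<in> Alg D" "mstar sq = sq" "mstar isq = isq"
    and "sq ** isq = mat 1" "isq ** sq = mat 1"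
    and "isq ** (sq ** X) = X" "X ** sq ** isq = X" "X ** isq ** sq = X"
proof -
  have pos: "0 < l" if "l \<in> eigvals (sig D)" for l using posdef_eigvals_pos[OF sigma(3) that] .
  show "sq \<in> Alg D" "isq \<in> Alg D" "mstar sq = sq" "mstar isq = isq"
    using sigma by (auto intro: A.fcalc_closed fcalc_self_adjoint)
  show 1: "sq ** isq = mat 1" and 2: "isq ** sq = mat 1"
    unfolding fcalc_mult[OF sigma(2)] by (rule fcalc_one[OF sigma(2)], use pos in force)+
  show "isq ** (sq ** X) = X" "X ** sq ** isq = X" "X ** isq ** sq = X"
    using 1 2 by (metis matrix_mul_assoc matrix_mul_lid matrix_mul_rid)+
qed

lemma matrix_inv_sigma: "matrix_inv (sig D) ** sig D = mat 1"
  unfolding matrix_inv_def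
  by (rule someI2_ex) (use sigma_invertible in \<open>auto simp: invertible_def\<close>)

text \<open>The left-hand side is conjugate linear in \<open>X1\<close>, so it is represented by some \<open>W\<close>; conjugation with the
  invertible matrix \<open>sq\<close> turns \<open>W\<close> into the required \<open>Y\<close>.\<close>

lemma gen_unique_existence:
  assumes X2: "X2 \<in> Alg D"
  shows "\<exists>!Y. Y \<in> Alg D \<and> (\<forall>X1\<in>Alg D.
     (\<Sum>j\<in>Idx D. BTr D j (mstar (pd D j X1) ** lhom D j sq ** pd D j X2 ** rhom D j sq))
     = - Tr D (mstar X1 ** sq ** Y ** sq))"
proof -
  let ?\<Phi> = "\<lambda>X1. \<Sum>j\<in>Idx D. BTr D j (mstar (pd D j X1) ** lhom D j sq ** pd D j X2 ** rhom D j sq)"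
  have \<Phi>_add: "?\<Phi> (X + Y) = ?\<Phi> X + ?\<Phi> Y" if "X \<in> Alg D" "Y \<in> Alg D" for X Y
    unfolding sum.distrib[symmetric]
  proof (intro sum.cong refl)
    fix j assume j: "j \<in> Idx D"
    interpret M: trace_bimodule "Alg D" "Tr D" "BAlg D j" "BTr D j" "lhom D j" "rhom D j"
      by (rule bimodule[OF j])
    show "BTr D j (mstar (pd D j (X + Y)) ** lhom D j sq ** pd D j X2 ** rhom D j sq)
      = BTr D j (mstar (pd D j X) ** lhom D j sq ** pd D j X2 ** rhom D j sq)
        + BTr D j (mstar (pd D j Y) ** lhom D j sq ** pd D j X2 ** rhom D j sq)"
      using that X2 by (simp add: pd_add[OF j] mstar_add mmult.add_left M.B.trace_add M.B.closed
          pd_closed[OF j] M.l_simps M.r_simps sq_simps)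
  qed
  have \<Phi>_cscale: "?\<Phi> (cscale z X) = cnj z * ?\<Phi> X" if "X \<in> Alg D" for X z
    unfolding sum_distrib_left
  proof (intro sum.cong refl)
    fix j assume j: "j \<in> Idx D"
    interpret M: trace_bimodule "Alg D" "Tr D" "BAlg D j" "BTr D j" "lhom D j" "rhom D j"
      by (rule bimodule[OF j])
    show "BTr D j (mstar (pd D j (cscale z X)) ** lhom D j sq ** pd D j X2 ** rhom D j sq)
      = cnj z * BTr D j (mstar (pd D j X) ** lhom D j sq ** pd D j X2 ** rhom D j sq)"
      using that X2 by (simp add: pd_cscale[OF j] mstar_cscale cscale_mult M.B.trace_cscale M.B.closed
          pd_closed[OF j] M.l_simps M.r_simps sq_simps)
  qed
  have "\<exists>!W. W \<in> Alg D \<and> (\<forall>Z\<in>Alg D. Tr D (mstar W ** Z) = - cnj (?\<Phi> Z))"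
    by (rule A.riesz) (simp_all only: \<Phi>_add \<Phi>_cscale complex_cnj_add complex_cnj_mult complex_cnj_cnj
        minus_add_distrib mult_minus_right)
  then obtain W where W: "W \<in> Alg D" "\<And>Z. Z \<in> Alg D \<Longrightarrow> Tr D (mstar W ** Z) = - cnj (?\<Phi> Z)"
    by blast
  show ?thesis
  proof (rule ex_ex1I)
    have "?\<Phi> Z = - Tr D (mstar Z ** sq ** (isq ** W ** isq) ** sq)" if Z: "Z \<in> Alg D" for Z
    proof -
      have "mstar Z ** sq ** (isq ** W ** isq) ** sq = mstar (mstar W ** Z)"
        by (simp add: mstar_mult matrix_mul_assoc sq_simps)
      then have "Tr D (mstar Z ** sq ** (isq ** W ** isq) ** sq) = cnj (Tr D (mstar W ** Z))"
        using A.trace_star[of "mstar W ** Z"] W(1) Z by (simp add: A.closed)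
      then show ?thesis using W(2)[OF Z] by simp
    qed
    then show "\<exists>Y. Y \<in> Alg D \<and> (\<forall>Z\<in>Alg D. ?\<Phi> Z = - Tr D (mstar Z ** sq ** Y ** sq))"
      using W(1) by (intro exI[of _ "isq ** W ** isq"]) (simp add: A.closed sq_simps)
  next
    fix Y Y'
    assume Y: "Y \<in> Alg D \<and> (\<forall>Z\<in>Alg D. ?\<Phi> Z = - Tr D (mstar Z ** sq ** Y ** sq))"
      and Y': "Y' \<in> Alg D \<and> (\<forall>Z\<in>Alg D. ?\<Phi> Z = - Tr D (mstar Z ** sq ** Y' ** sq))"
    \<comment> \<open>Testing with \<open>?Z\<close> itself makes its trace norm vanish.\<close>
    let ?Z = "sq ** (Y - Y') ** sq"
    have Z: "?Z \<in> Alg D" using Y Y' by (intro A.closed sq_simps) auto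
    have "- Tr D (mstar ?Z ** sq ** Y ** sq) = - Tr D (mstar ?Z ** sq ** Y' ** sq)"
      by (rule trans[OF bspec[OF conjunct2[OF Y] Z, symmetric] bspec[OF conjunct2[OF Y'] Z]])
    then have "Tr D (mstar ?Z ** sq ** Y ** sq) = Tr D (mstar ?Z ** sq ** Y' ** sq)"
      by (simp only: neg_equal_iff_equal)
    moreover have "mstar ?Z ** ?Z = mstar ?Z ** sq ** Y ** sq - mstar ?Z ** sq ** Y' ** sq"
      by (simp add: mmult.diff_left mmult.diff_right matrix_mul_assoc)
    moreover have "mstar ?Z ** sq ** Y ** sq \<in> Alg D" "mstar ?Z ** sq ** Y' ** sq \<in> Alg D"
      using Y Y' Z by (auto intro!: A.mult_closed A.star_closed[OF Z] sq_simps)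
    ultimately have "A.ip ?Z ?Z = 0" by (simp add: A.ip_def A.trace_diff)
    then have "?Z = 0" using A.ip_pos[OF Z] by fastforce
    then have "isq ** ?Z ** isq = 0" by simp
    then have "Y - Y' = 0" by (simp only: matrix_mul_assoc sq_simps matrix_mul_lid)
    then show "Y = Y'" by simp
  qed
qed

lemma gen_properties:
  assumes "X2 \<in> Alg D"
  shows gen_closed: "gen D X2 \<in> Alg D"
    and gen: "X1 \<in> Alg D \<Longrightarrow>
     (\<Sum>j\<in>Idx D. BTr D j (mstar (pd D j X1) ** lhom D j sq ** pd D j X2 ** rhom D j sq))
     = - Tr D (mstar X1 ** sq ** gen D X2 ** sq)"
  using theI'[OF gen_unique_existence[OF assms]] unfolding gen_def by blast+

lemma gen_eqI:
  assumes "X2 \<in> Alg D" "Y \<in> Alg D"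
    and "\<And>X1. X1 \<in> Alg D \<Longrightarrow>
     (\<Sum>j\<in>Idx D. BTr D j (mstar (pd D j X1) ** lhom D j sq ** pd D j X2 ** rhom D j sq))
     = - Tr D (mstar X1 ** sq ** Y ** sq)"
  shows "gen D X2 = Y"
  unfolding gen_def by (rule the1_equality[OF gen_unique_existence[OF assms(1)]]) (use assms in blast)

lemma gen_add:
  assumes XY: "X \<in> Alg D" "Y \<in> Alg D" shows "gen D (X + Y) = gen D X + gen D Y"
proof (rule gen_eqI)
  fix Z assume Z: "Z \<in> Alg D"
  have "(\<Sum>j\<in>Idx D. BTr D j (mstar (pd D j Z) ** lhom D j sq ** pd D j (X + Y) ** rhom D j sq))
    = (\<Sum>j\<in>Idx D. BTr D j (mstar (pd D j Z) ** lhom D j sq ** pd D j X ** rhom D j sq))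
      + (\<Sum>j\<in>Idx D. BTr D j (mstar (pd D j Z) ** lhom D j sq ** pd D j Y ** rhom D j sq))"
    unfolding sum.distrib[symmetric]
  proof (intro sum.cong refl)
    fix j assume j: "j \<in> Idx D"
    interpret M: trace_bimodule "Alg D" "Tr D" "BAlg D j" "BTr D j" "lhom D j" "rhom D j"
      by (rule bimodule[OF j])
    show "BTr D j (mstar (pd D j Z) ** lhom D j sq ** pd D j (X + Y) ** rhom D j sq)
      = BTr D j (mstar (pd D j Z) ** lhom D j sq ** pd D j X ** rhom D j sq)
        + BTr D j (mstar (pd D j Z) ** lhom D j sq ** pd D j Y ** rhom D j sq)"
      using XY Z by (simp add: pd_add[OF j] mmult.add_left mmult.add_right M.B.trace_add M.B.closed
          pd_closed[OF j] M.l_simps M.r_simps sq_simps)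
  qed
  also have "\<dots> = - Tr D (mstar Z ** sq ** (gen D X + gen D Y) ** sq)"
    using XY Z gen_closed by (simp add: gen mmult.add_left mmult.add_right A.trace_add A.closed sq_simps)
  finally show "(\<Sum>j\<in>Idx D. BTr D j (mstar (pd D j Z) ** lhom D j sq ** pd D j (X + Y) ** rhom D j sq))
    = - Tr D (mstar Z ** sq ** (gen D X + gen D Y) ** sq)" .
qed (use XY gen_closed in \<open>auto intro: A.add_closed\<close>)

lemma gen_cscale:
  assumes X: "X \<in> Alg D" shows "gen D (cscale z X) = cscale z (gen D X)"
proof (rule gen_eqI)
  fix Z assume Z: "Z \<in> Alg D"
  have "(\<Sum>j\<in>Idx D. BTr D j (mstar (pd D j Z) ** lhom D j sq ** pd D j (cscale z X) ** rhom D j sq))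
    = z * (\<Sum>j\<in>Idx D. BTr D j (mstar (pd D j Z) ** lhom D j sq ** pd D j X ** rhom D j sq))"
    unfolding sum_distrib_left
  proof (intro sum.cong refl)
    fix j assume j: "j \<in> Idx D"
    interpret M: trace_bimodule "Alg D" "Tr D" "BAlg D j" "BTr D j" "lhom D j" "rhom D j"
      by (rule bimodule[OF j])
    show "BTr D j (mstar (pd D j Z) ** lhom D j sq ** pd D j (cscale z X) ** rhom D j sq)
      = z * BTr D j (mstar (pd D j Z) ** lhom D j sq ** pd D j X ** rhom D j sq)"
      using X Z by (simp add: pd_cscale[OF j] cscale_mult mult_cscale M.B.trace_cscale M.B.closed
          pd_closed[OF j] M.l_simps M.r_simps sq_simps)
  qed
  also have "\<dots> = - Tr D (mstar Z ** sq ** cscale z (gen D X) ** sq)"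
    using X Z gen_closed by (simp add: gen cscale_mult mult_cscale A.trace_cscale A.closed sq_simps)
  finally show "(\<Sum>j\<in>Idx D. BTr D j (mstar (pd D j Z) ** lhom D j sq ** pd D j (cscale z X) ** rhom D j sq))
    = - Tr D (mstar Z ** sq ** cscale z (gen D X) ** sq)" .
qed (use X gen_closed in \<open>auto intro: A.cscale_closed\<close>)

lemma gen_adj_properties:
  assumes C: "C \<in> Alg D"
  shows gen_adj_closed: "gen_adj D C \<in> Alg D"
    and gen_adj: "Z \<in> Alg D \<Longrightarrow> Tr D (mstar (gen_adj D C) ** Z) = Tr D (mstar C ** gen D Z)"
proof -
  have 1: "Tr D (mstar C ** gen D (X + Y)) = Tr D (mstar C ** gen D X) + Tr D (mstar C ** gen D Y)"
    if "X \<in> Alg D" "Y \<in> Alg D" for X Y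
    using that C gen_closed by (simp add: gen_add mmult.add_right A.trace_add A.closed)
  have 2: "Tr D (mstar C ** gen D (cscale z X)) = z * Tr D (mstar C ** gen D X)"
    if "X \<in> Alg D" for z X
    using that C gen_closed by (simp add: gen_cscale mult_cscale A.trace_cscale A.closed)
  show "gen_adj D C \<in> Alg D"
    "Z \<in> Alg D \<Longrightarrow> Tr D (mstar (gen_adj D C) ** Z) = Tr D (mstar C ** gen D Z)"
    unfolding gen_adj_def using A.trace_adjoint_properties[of "Tr D" C "gen D", OF 1 2] by blast+
qed

text \<open>The modular relation for \<open>\<sigma>\<close> says that \<open>V\<close> only connects eigenspaces of \<open>\<sigma>\<close> whose
  eigenvalues differ by the factor \<open>exp (- \<omega>)\<close>; it therefore extends to all functions of \<open>\<sigma>\<close>.\<close>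

lemma velocity_intertwines:
  assumes j: "j \<in> Idx D"
    and fg: "\<And>k m. k \<in> eigvals (sig D) \<Longrightarrow> m \<in> eigvals (sig D) \<Longrightarrow> k = exp (- omg D j) * m \<Longrightarrow> f k = g m"
  shows "lhom D j (fcalc f (sig D)) ** Vel D j = Vel D j ** rhom D j (fcalc g (sig D))"
proof -
  interpret M: trace_bimodule "Alg D" "Tr D" "BAlg D j" "BTr D j" "lhom D j" "rhom D j"
    by (rule bimodule[OF j])
  note \<sigma> = sigma(1,2)
  let ?V = "Vel D j"
  have V: "?V \<in> BAlg D j" by (rule velocity_closed[OF j])
  have inv: "matrix_inv (sig D) = fcalc (\<lambda>x. 1 / x) (sig D)"
  proof -
    have "sig D ** fcalc (\<lambda>x. 1 / x) (sig D) = fcalc (\<lambda>x. x) (sig D) ** fcalc (\<lambda>x. 1 / x) (sig D)"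
      by (simp add: spectral_decomposition[OF \<sigma>(2)])
    also have "\<dots> = mat 1" unfolding fcalc_mult[OF \<sigma>(2)]
      by (rule fcalc_one[OF \<sigma>(2)]) (use posdef_eigvals_pos[OF sigma(3)] in force)
    finally have "sig D ** fcalc (\<lambda>x. 1 / x) (sig D) = mat 1" .
    moreover have "matrix_inv (sig D) ** sig D = mat 1" by (rule matrix_inv_sigma)
    ultimately show ?thesis by (metis matrix_mul_assoc matrix_mul_lid matrix_mul_rid)
  qed
  have "exp (- omg D j) *\<^sub>R ?V ** rhom D j (sig D) = lhom D j (sig D) ** ?V ** (rhom D j (matrix_inv (sig D)) ** rhom D j (sig D))"
    by (simp add: sigma_velocity[OF j, symmetric] matrix_mul_assoc)
  also have "rhom D j (matrix_inv (sig D)) ** rhom D j (sig D) = rhom D j (mat 1)"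
    using M.r_simps(5)[of "matrix_inv (sig D)" "sig D"] \<sigma> matrix_inv_sigma
    by (simp add: inv A.fcalc_closed)
  also have "lhom D j (sig D) ** ?V ** rhom D j (mat 1) = lhom D j (sig D) ** ?V"
    by (intro M.hom_one_mult(2) M.B.mult_closed V M.l_simps \<sigma>)
  finally have "M.dop (\<lambda>k m. k) (sig D) ?V = exp (- omg D j) *\<^sub>R M.dop (\<lambda>k m. m) (sig D) ?V"
    using M.dop_left[OF \<sigma> V, of "\<lambda>x. x"] M.dop_right[OF \<sigma> V, of "\<lambda>x. x"]
    by (simp add: spectral_decomposition[OF \<sigma>(2)] mmult.scaleR_left)
  then have "f k *\<^sub>R M.proj2 (sig D) k m ?V = g m *\<^sub>R M.proj2 (sig D) k m ?V"
    if km: "k \<in> eigvals (sig D)" "m \<in> eigvals (sig D)" for k m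
  proof -
    let ?p = "M.proj2 (sig D) k m ?V"
    assume "M.dop (\<lambda>k m. k) (sig D) ?V = exp (- omg D j) *\<^sub>R M.dop (\<lambda>k m. m) (sig D) ?V"
    then have "M.proj2 (sig D) k m (M.dop (\<lambda>k m. k) (sig D) ?V)
        = M.proj2 (sig D) k m (exp (- omg D j) *\<^sub>R M.dop (\<lambda>k m. m) (sig D) ?V)" by simp
    then have "k *\<^sub>R ?p = (exp (- omg D j) * m) *\<^sub>R ?p"
      by (simp add: M.proj2_scaleR M.proj2_dop[OF \<sigma> km])
    then show ?thesis using fg[OF km] by (cases "?p = 0") auto
  qed
  then have "M.dop (\<lambda>k m. f k) (sig D) ?V = M.dop (\<lambda>k m. g m) (sig D) ?V"
    unfolding M.dop_def by (intro sum.cong refl)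
  then show ?thesis by (simp add: M.dop_left[OF \<sigma> V] M.dop_right[OF \<sigma> V])
qed

lemma sq_velocity:
  assumes j: "j \<in> Idx D"
  shows "lhom D j sq ** Vel D j = exp (- omg D j / 2) *\<^sub>R (Vel D j ** rhom D j sq)"
proof -
  interpret M: trace_bimodule "Alg D" "Tr D" "BAlg D j" "BTr D j" "lhom D j" "rhom D j"
    by (rule bimodule[OF j])
  have "sqrt (exp (- omg D j)) = exp (- omg D j / 2)"
    by (rule real_sqrt_unique) (simp_all add: power2_eq_square exp_add[symmetric])
  then have "lhom D j sq ** Vel D j = Vel D j ** rhom D j (fcalc (\<lambda>x. exp (- omg D j / 2) * sqrt x) (sig D))"
    by (intro velocity_intertwines[OF j]) (simp add: real_sqrt_mult)
  also have "fcalc (\<lambda>x. exp (- omg D j / 2) * sqrt x) (sig D) = exp (- omg D j / 2) *\<^sub>R sq"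
    by (simp add: fcalc_def scaleR_sum_right)
  finally show ?thesis by (simp add: M.r_simps sq_simps mmult.scaleR_right)
qed

text \<open>The chain rule: the logarithmic mean is the divided difference that turns derivatives of logarithms
  back into the derivative of \<open>\<rho>\<close>, with the frequencies \<open>\<omega>\<close> absorbed by the logarithm of \<open>\<sigma>\<close>.\<close>

lemma chain_rule:
  assumes j: "j \<in> Idx D" and \<rho>: "\<rho> \<in> pos_states D"
  shows "hat_op D j \<rho> (pd D j (fcalc ln \<rho> - fcalc ln (sig D)))
    = exp (- omg D j / 2) *\<^sub>R (Vel D j ** rhom D j \<rho>) - exp (omg D j / 2) *\<^sub>R (lhom D j \<rho> ** Vel D j)"
proof -
  interpret M: trace_bimodule "Alg D" "Tr D" "BAlg D j" "BTr D j" "lhom D j" "rhom D j"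
    by (rule bimodule[OF j])
  note \<sigma> = sigma(1,2) and r = pos_states_simps(2,3)[OF \<rho>]
  let ?V = "Vel D j" and ?w = "omg D j"
  have V: "?V \<in> BAlg D j" by (rule velocity_closed[OF j])
  have ln: "fcalc ln \<rho> \<in> Alg D" "fcalc ln (sig D) \<in> Alg D"
    using \<sigma> r by (auto intro: A.fcalc_closed)
  have "lhom D j (fcalc ln (sig D)) ** ?V = ?V ** rhom D j (fcalc (\<lambda>x. ln x - ?w) (sig D))"
  proof (rule velocity_intertwines[OF j])
    fix k m assume "m \<in> eigvals (sig D)" "k = exp (- ?w) * m"
    then show "ln k = ln m - ?w" using posdef_eigvals_pos[OF sigma(3), of m] by (simp add: ln_mult)
  qed
  also have "fcalc (\<lambda>x. ln x - ?w) (sig D) = fcalc ln (sig D) - ?w *\<^sub>R mat 1"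
    by (simp add: fcalc_def scaleR_diff_left sum_subtractf scaleR_sum_right specproj_sum[OF \<sigma>(2), symmetric])
  also have "?V ** rhom D j (fcalc ln (sig D) - ?w *\<^sub>R mat 1) = ?V ** rhom D j (fcalc ln (sig D)) - ?w *\<^sub>R ?V"
    using ln A.one_closed
    by (simp add: M.hom_diff[OF M.r_hom] A.closed M.r_simps mmult.diff_right mmult.scaleR_right M.hom_one_mult V)
  finally have dsig: "?V ** rhom D j (fcalc ln (sig D)) - lhom D j (fcalc ln (sig D)) ** ?V = ?w *\<^sub>R ?V"
    by simp
  have "pd D j (fcalc ln \<rho> - fcalc ln (sig D))
      = (?V ** rhom D j (fcalc ln \<rho>) - lhom D j (fcalc ln \<rho>) ** ?V)
        - (?V ** rhom D j (fcalc ln (sig D)) - lhom D j (fcalc ln (sig D)) ** ?V)"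
    using ln by (simp add: pd_def M.hom_diff[OF M.r_hom] M.hom_diff[OF M.l_hom] mmult.diff_left mmult.diff_right)
  also have "\<dots> = M.dop (\<lambda>k m. ln m) \<rho> ?V - M.dop (\<lambda>k m. ln k) \<rho> ?V - M.dop (\<lambda>_ _. ?w) \<rho> ?V"
    unfolding dsig by (simp add: M.dop_left[OF r V] M.dop_right[OF r V] M.dop_const[OF r V])
  also have "\<dots> = M.dop (\<lambda>k m. ln m - ln k - ?w) \<rho> ?V"
    by (simp add: M.dop_diff[OF r])
  finally have "hat_op D j \<rho> (pd D j (fcalc ln \<rho> - fcalc ln (sig D)))
      = M.dop (\<lambda>k m. theta D j k m * (ln m - ln k - ?w)) \<rho> ?V"
    unfolding hat_op_dop[OF j] by (simp only: M.dop_dop[OF r])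
  also have "\<dots> = M.dop (\<lambda>k m. exp (- ?w / 2) * m - exp (?w / 2) * k) \<rho> ?V"
    unfolding M.dop_def
    by (intro sum.cong refl) (simp only: theta_log_difference pos_states_simps(6)[OF \<rho>])
  also have "\<dots> = exp (- ?w / 2) *\<^sub>R M.dop (\<lambda>k m. m) \<rho> ?V - exp (?w / 2) *\<^sub>R M.dop (\<lambda>k m. k) \<rho> ?V"
    unfolding M.dop_diff[OF r, symmetric] by (simp add: M.dop_def scaleR_sum_right)
  also have "\<dots> = exp (- ?w / 2) *\<^sub>R (?V ** rhom D j \<rho>) - exp (?w / 2) *\<^sub>R (lhom D j \<rho> ** ?V)"
    using M.dop_left[OF r V, of "\<lambda>x. x"] M.dop_right[OF r V, of "\<lambda>x. x"]
    by (simp add: spectral_decomposition[OF r(2)])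
  finally show ?thesis .
qed

lemma entropy_gradient:
  assumes "\<rho> \<in> pos_states D"
  shows "fcalc ln \<rho> - fcalc ln (sig D) \<in> Alg D"
    and "mstar (fcalc ln \<rho> - fcalc ln (sig D)) = fcalc ln \<rho> - fcalc ln (sig D)"
  using sigma pos_states_simps(2,3)[OF assms]
  by (auto simp: mstar_diff fcalc_self_adjoint intro!: A.diff_closed A.fcalc_closed)

text \<open>By duality the Fisher information pairs \<open>\<rho>\<close> with \<open>gen D X\<close>. Testing the Dirichlet form that defines
  \<open>gen\<close> with \<open>\<sigma>\<close> to the power \<open>-1/2\<close> on both sides of \<open>\<rho>\<close> cancels the weights, and commuting the square
  roots of \<open>\<sigma>\<close> past \<open>V\<close> leaves exactly the right-hand side of the chain rule.\<close>

lemma Fisher_qform: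
  assumes \<rho>: "\<rho> \<in> pos_states D"
  defines "X \<equiv> fcalc ln \<rho> - fcalc ln (sig D)"
  shows "Fisher D \<rho> = ereal (qform \<rho> X X)"
proof -
  note r = pos_states_simps(2,3)[OF \<rho>]
  have X: "X \<in> Alg D" "mstar X = X" unfolding X_def by (rule entropy_gradient[OF \<rho>])+
  have "Re (Tr D (X ** gen_adj D \<rho>)) = A.ip X (gen_adj D \<rho>)" using X by (simp add: A.ip_def)
  also have "\<dots> = A.ip (gen_adj D \<rho>) X" by (intro A.ip_commute X gen_adj_closed r)
  also have "\<dots> = Re (Tr D (\<rho> ** gen D X))" by (simp add: A.ip_def gen_adj r X)
  finally have 1: "Re (Tr D (X ** gen_adj D \<rho>)) = Re (Tr D (\<rho> ** gen D X))" .
  let ?G = "gen D X" and ?Y = "isq ** \<rho> ** isq"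
  have G: "?G \<in> Alg D" by (rule gen_closed[OF X(1)])
  have Y: "?Y \<in> Alg D" "mstar ?Y = ?Y"
    using r sq_simps by (auto intro!: A.mult_closed simp: mstar_mult matrix_mul_assoc)
  have "Tr D (mstar ?Y ** sq ** ?G ** sq) = Tr D ((isq ** \<rho> ** ?G) ** sq)"
    unfolding Y(2) by (simp add: matrix_mul_assoc sq_simps)
  also have "\<dots> = Tr D (sq ** (isq ** \<rho> ** ?G))"
    using r sq_simps G by (intro A.trace_cyclic A.mult_closed)
  also have "\<dots> = Tr D (\<rho> ** ?G)" by (simp add: matrix_mul_assoc sq_simps)
  finally have "- Re (Tr D (X ** gen_adj D \<rho>))
      = Re (\<Sum>j\<in>Idx D. BTr D j (mstar (pd D j ?Y) ** lhom D j sq ** pd D j X ** rhom D j sq))"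
    by (simp add: 1 gen[OF X(1) Y(1)])
  also have "\<dots> = (\<Sum>j\<in>Idx D. Re (BTr D j (mstar (pd D j ?Y) ** lhom D j sq ** pd D j X ** rhom D j sq)))"
    by simp
  also have "\<dots> = qform \<rho> X X"
    unfolding qform_def
  proof (intro sum.cong refl)
    fix j assume j: "j \<in> Idx D"
    interpret M: trace_bimodule "Alg D" "Tr D" "BAlg D j" "BTr D j" "lhom D j" "rhom D j"
      by (rule bimodule[OF j])
    let ?V = "Vel D j" and ?w = "omg D j" and ?P = "pd D j X" and ?H = "hat_op D j \<rho> (pd D j X)"
    have V: "?V \<in> BAlg D j" by (rule velocity_closed[OF j])
    have P: "?P \<in> BAlg D j" "pd D j ?Y \<in> BAlg D j" by (intro pd_closed[OF j] X Y)+
    have H: "?H \<in> BAlg D j" by (intro hat_op_closed j r P)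
    have ls: "lhom D j sq \<in> BAlg D j" "rhom D j sq \<in> BAlg D j"
      "mstar (lhom D j sq) = lhom D j sq" "mstar (rhom D j sq) = rhom D j sq"
      by (simp_all add: M.l_simps M.r_simps sq_simps M.l_simps(6)[symmetric] M.r_simps(6)[symmetric])
    have sYs: "sq ** ?Y ** sq = \<rho>" by (simp add: matrix_mul_assoc sq_simps)
    have l: "lhom D j sq ** (lhom D j ?Y ** (?V ** rhom D j sq)) = exp (?w / 2) *\<^sub>R (lhom D j \<rho> ** ?V)"
    proof -
      have "?V ** rhom D j sq = exp (?w / 2) *\<^sub>R (lhom D j sq ** ?V)"
        by (simp add: sq_velocity[OF j] exp_add[symmetric])
      then have "lhom D j sq ** (lhom D j ?Y ** (?V ** rhom D j sq))
          = exp (?w / 2) *\<^sub>R ((lhom D j sq ** lhom D j ?Y ** lhom D j sq) ** ?V)"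
        by (simp add: mmult.scaleR_right matrix_mul_assoc)
      also have "lhom D j sq ** lhom D j ?Y ** lhom D j sq = lhom D j (sq ** ?Y ** sq)"
        using Y sq_simps by (simp only: M.l_simps(5) A.mult_closed)
      finally show ?thesis unfolding sYs .
    qed
    have r': "(lhom D j sq ** ?V) ** (rhom D j ?Y ** rhom D j sq) = exp (- ?w / 2) *\<^sub>R (?V ** rhom D j \<rho>)"
    proof -
      have "(lhom D j sq ** ?V) ** (rhom D j ?Y ** rhom D j sq)
          = exp (- ?w / 2) *\<^sub>R (?V ** (rhom D j sq ** rhom D j ?Y ** rhom D j sq))"
        by (simp add: sq_velocity[OF j] mmult.scaleR_left matrix_mul_assoc)
      also have "rhom D j sq ** rhom D j ?Y ** rhom D j sq = rhom D j (sq ** ?Y ** sq)"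
        using Y sq_simps by (simp only: M.r_simps(5) A.mult_closed)
      finally show ?thesis unfolding sYs .
    qed
    have "lhom D j sq ** pd D j ?Y ** rhom D j sq
        = (lhom D j sq ** ?V) ** (rhom D j ?Y ** rhom D j sq) - lhom D j sq ** (lhom D j ?Y ** (?V ** rhom D j sq))"
      by (simp only: pd_def mmult.diff_left mmult.diff_right matrix_mul_assoc)
    also have "\<dots> = ?H" unfolding l r' unfolding X_def chain_rule[OF j \<rho>] ..
    finally have "mstar ?H = rhom D j sq ** (mstar (pd D j ?Y) ** lhom D j sq)"
      using ls by (metis mstar_mult)
    then have "mstar ?H ** ?P = rhom D j sq ** (mstar (pd D j ?Y) ** lhom D j sq ** ?P)"
      by (simp only: matrix_mul_assoc)
    moreover have "BTr D j (rhom D j sq ** (mstar (pd D j ?Y) ** lhom D j sq ** ?P))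
        = BTr D j ((mstar (pd D j ?Y) ** lhom D j sq ** ?P) ** rhom D j sq)"
      by (intro M.B.trace_cyclic M.B.mult_closed M.B.star_closed ls P)
    ultimately have "Re (BTr D j (mstar (pd D j ?Y) ** lhom D j sq ** ?P ** rhom D j sq)) = ipB j ?H ?P"
      by (simp add: M.B.ip_def)
    also have "\<dots> = ipB j ?P ?H" by (intro M.B.ip_commute H P)
    finally show "Re (BTr D j (mstar (pd D j ?Y) ** lhom D j sq ** ?P ** rhom D j sq)) = ipB j ?P ?H" .
  qed
  finally show ?thesis using \<rho> by (simp add: Fisher_def X_def)
qed

section \<open>Action of curves\<close>

definition action :: "(real \<Rightarrow> 'n cmat) \<Rightarrow> (real \<Rightarrow> 'n cmat) \<Rightarrow> real" where
  "action \<rho> B = integral {0..1} (\<lambda>t. Re (Tr D (B t ** Kop D (\<rho> t) (B t))))"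

lemma admissible_simps:
  assumes "admissible D x y \<rho> B" "s \<in> {0..1}"
  shows "\<rho> s \<in> pos_states D" "B s \<in> Alg D" "mstar (B s) = B s"
    "(\<rho> has_vector_derivative Kop D (\<rho> s) (B s)) (at s within {0..1})"
    "\<rho> 0 = x" "\<rho> 1 = y"
  using assms by (auto simp: admissible_def Alg0_def)

lemma energy_density:
  assumes adm: "admissible D x y \<rho> B" and s: "s \<in> {0..1}"
  shows "Re (Tr D (B s ** Kop D (\<rho> s) (B s))) = qform (\<rho> s) (B s) (B s)"
    and "0 \<le> qform (\<rho> s) (B s) (B s)"
  using admissible_simps[OF adm s]
  by (auto intro!: trace_Kop qform_nonneg simp: pos_states_simps)

text \<open>Along an admissible curve the velocity is the first of the higher derivatives, hence continuous, and the
  energy density is the trace of its product with \<open>B\<close>.\<close>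

lemma energy_integrable:
  assumes adm: "admissible D x y \<rho> B"
  shows "(\<lambda>t. qform (\<rho> t) (B t) (B t)) integrable_on {0..1}"
proof -
  obtain g where g: "bounded_linear g" "\<And>X. X \<in> Alg D \<Longrightarrow> g X = Tr D X"
    using A.trace_bounded_linear by blast
  obtain d where d: "d 0 = \<rho>"
    "\<And>k t. t \<in> {0..1} \<Longrightarrow> ((d k :: real \<Rightarrow> 'n cmat) has_vector_derivative d (Suc k) t) (at t within {0..1})"
    using adm unfolding admissible_def smooth_curve_def by blast
  obtain b where b: "b 0 = B"
    "\<And>k t. t \<in> {0..1} \<Longrightarrow> ((b k :: real \<Rightarrow> 'n cmat) has_vector_derivative b (Suc k) t) (at t within {0..1})"
    using adm unfolding admissible_def smooth_curve_def by blast
  have cont: "continuous_on {0..1} (d 1)" "continuous_on {0..1} B"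
    unfolding continuous_on_eq_continuous_within b(1)[symmetric]
    using has_vector_derivative_continuous[OF d(2)] has_vector_derivative_continuous[OF b(2)] by blast+
  have d1: "d 1 t = Kop D (\<rho> t) (B t)" if t: "t \<in> {0..1}" for t
  proof -
    have "(\<rho> has_vector_derivative d 1 t) (at t within cbox 0 1)"
      using d(2)[OF t, of 0] d(1) by (simp add: cbox_interval)
    then show ?thesis
      using admissible_simps(4)[OF adm t] t
      by (intro vector_derivative_unique_within_closed_interval[of 0 1 t \<rho>]) (auto simp: cbox_interval)
  qed
  have "continuous_on {0..1} (\<lambda>t. Re (g (B t ** d 1 t)))"
    by (intro continuous_on_Re bounded_linear.continuous_on[OF g(1)] mmult.continuous_on cont)
  then have "(\<lambda>t. Re (g (B t ** d 1 t))) integrable_on {0..1}" by (rule integrable_continuous_real)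
  then show ?thesis
  proof (rule integrable_eq)
    fix t :: real assume t: "t \<in> {0..1}"
    have "B t ** Kop D (\<rho> t) (B t) \<in> Alg D"
      using admissible_simps[OF adm t] by (intro A.mult_closed Kop_closed) (auto simp: pos_states_simps)
    then show "Re (g (B t ** d 1 t)) = qform (\<rho> t) (B t) (B t)"
      unfolding d1[OF t] by (simp add: g(2) energy_density(1)[OF adm t])
  qed
qed

lemma action_qform:
  assumes adm: "admissible D x y \<rho> B"
  shows "action \<rho> B = integral {0..1} (\<lambda>t. qform (\<rho> t) (B t) (B t))" "0 \<le> action \<rho> B"
proof -
  show 1: "action \<rho> B = integral {0..1} (\<lambda>t. qform (\<rho> t) (B t) (B t))"
    unfolding action_def by (rule integral_cong) (rule energy_density(1)[OF adm])
  show "0 \<le> action \<rho> B" unfolding 1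
    by (rule integral_nonneg[OF energy_integrable[OF adm] energy_density(2)[OF adm]])
qed

text \<open>The derivative of \<open>ip X (\<rho> t)\<close> is \<open>qform (\<rho> t) X (B t)\<close>, which the arithmetic-geometric mean
  inequality splits into the form at \<open>X\<close> and the energy density of the curve.\<close>

lemma curve_estimate:
  assumes adm: "admissible D x y \<rho> B" and s: "s \<in> {0..1}"
    and X: "X \<in> Alg D" "mstar X = X" and c: "c > 0"
    and M: "\<And>t. t \<in> {0..1} \<Longrightarrow> qform (\<rho> t) X X \<le> M"
  shows "2 * \<bar>A.ip X (\<rho> s - x)\<bar> \<le> c * M + action \<rho> B / c"
proof -
  obtain g where g: "bounded_linear g" "\<And>X. X \<in> Alg D \<Longrightarrow> g X = Tr D X"
    using A.trace_bounded_linear by blast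
  note adm_s = admissible_simps[OF adm]
  define h where "h t = Re (g (X ** \<rho> t))" for t
  have lin: "bounded_linear (\<lambda>Y. Re (g (X ** Y)))"
    by (intro bounded_linear_compose[OF bounded_linear_Re] bounded_linear_compose[OF g(1)]
        mmult.bounded_linear_right)
  have deriv: "(h has_vector_derivative qform (\<rho> t) X (B t)) (at t within {0..1})" if t: "t \<in> {0..1}" for t
  proof -
    have r: "\<rho> t \<in> Alg D" "mstar (\<rho> t) = \<rho> t" using adm_s(1)[OF t] by (auto simp: pos_states_simps)
    have "(h has_vector_derivative Re (g (X ** Kop D (\<rho> t) (B t)))) (at t within {0..1})"
      unfolding h_def by (rule bounded_linear.has_vector_derivative[OF lin adm_s(4)[OF t]])
    also have "Re (g (X ** Kop D (\<rho> t) (B t))) = qform (\<rho> t) X (B t)"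
      using trace_Kop[OF r X adm_s(2)[OF t]] Kop_closed[OF r adm_s(2)[OF t]] X(1)
      by (simp add: g(2) A.mult_closed)
    finally show ?thesis .
  qed
  have sub: "{0..s} \<subseteq> {0..1}" using s by auto
  have int: "((\<lambda>t. qform (\<rho> t) X (B t)) has_integral (h s - h 0)) {0..s}"
  proof (rule fundamental_theorem_of_calculus)
    show "0 \<le> s" using s by simp
    show "(h has_vector_derivative qform (\<rho> t) X (B t)) (at t within {0..s})" if "t \<in> {0..s}" for t
      using deriv[of t] that sub by (meson has_vector_derivative_within_subset subsetD)
  qed
  let ?e = "\<lambda>t. qform (\<rho> t) (B t) (B t)"
  let ?b = "\<lambda>t. (c * M) / 2 + ?e t / (2 * c)"
  have e_int: "?e integrable_on {0..s}"
    using integrable_subinterval_real[OF energy_integrable[OF adm] sub] .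
  have b_int: "?b integrable_on {0..s}"
    by (intro integrable_add integrable_const_ivl integrable_on_divide e_int)
  have M0: "0 \<le> M"
    using qform_nonneg[OF pos_states_simps(1)[OF adm_s(1)[OF s]] X(1)] M[OF s] by linarith
  have bound: "\<bar>qform (\<rho> t) X (B t)\<bar> \<le> ?b t" if "t \<in> {0..s}" for t
  proof -
    have t: "t \<in> {0..1}" using that sub by blast
    have "2 * \<bar>qform (\<rho> t) X (B t)\<bar> \<le> c * qform (\<rho> t) X X + ?e t / c"
      using adm_s[OF t] X(1) c by (intro qform_am_gm) (auto simp: pos_states_simps)
    also have "\<dots> \<le> c * M + ?e t / c" using M[OF t] c by simp
    finally show ?thesis by (simp add: field_simps)
  qed
  have "\<bar>h s - h 0\<bar> \<le> integral {0..s} ?b"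
  proof -
    have "norm (integral {0..s} (\<lambda>t. qform (\<rho> t) X (B t))) \<le> integral {0..s} ?b"
      using int bound by (intro integral_norm_bound_integral b_int) auto
    then show ?thesis using integral_unique[OF int] by simp
  qed
  also have "integral {0..s} ?b = s * ((c * M) / 2) + integral {0..s} ?e / (2 * c)"
    using s by (subst integral_add[OF integrable_const_ivl integrable_on_divide[OF e_int]]) simp
  also have "\<dots> \<le> 1 * ((c * M) / 2) + action \<rho> B / (2 * c)"
  proof (intro add_mono mult_right_mono divide_right_mono)
    show "integral {0..s} ?e \<le> action \<rho> B"
      unfolding action_qform(1)[OF adm]
      using energy_density(2)[OF adm]
      by (intro integral_subset_le[OF sub e_int energy_integrable[OF adm]] ballI)
  qed (use s c M0 in auto)
  finally have "2 * \<bar>h s - h 0\<bar> \<le> c * M + action \<rho> B / c" using c by (simp add: field_simps)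
  moreover have "h s - h 0 = A.ip X (\<rho> s - x)"
  proof -
    have "\<rho> s \<in> Alg D" "\<rho> 0 \<in> Alg D" using adm_s(1)[OF s] adm_s(1)[of 0] by (auto simp: pos_states_simps)
    then show ?thesis using X adm_s(5)[OF s]
      by (simp add: h_def g(2) A.ip_def A.closed mmult.diff_right A.trace_diff)
  qed
  ultimately show ?thesis by simp
qed

text \<open>Testing the curve estimate with the displacement itself shows that curves of small action stay near
  their starting point.\<close>

lemma displacement_bounded_by_action:
  "\<exists>C>0. \<forall>x y \<rho> B. admissible D x y \<rho> B \<longrightarrow> (\<forall>s\<in>{0..1}. (norm (\<rho> s - x))\<^sup>2 \<le> C * action \<rho> B)"
proof -
  obtain \<kappa> where \<kappa>: "\<kappa> > 0" "\<And>X. X \<in> Alg D \<Longrightarrow> \<kappa> * (norm X)\<^sup>2 \<le> A.ip X X"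
    using A.ip_coercive by blast
  obtain M where M: "M > 0" "\<And>\<rho> X. \<rho> \<in> states D \<Longrightarrow> X \<in> Alg D \<Longrightarrow> qform \<rho> X X \<le> M * (norm X)\<^sup>2"
    using qform_bounded by blast
  have "(norm (\<rho> s - x))\<^sup>2 \<le> (M / \<kappa>\<^sup>2) * action \<rho> B"
    if adm: "admissible D x y \<rho> B" and s: "s \<in> {0..1}" for x y \<rho> B s
  proof -
    let ?Y = "\<rho> s - x" and ?N = "(norm (\<rho> s - x))\<^sup>2"
    note adm_s = admissible_simps[OF adm]
    have "x \<in> pos_states D" using adm_s(1)[of 0] adm_s(5)[OF s] by simp
    then have Y: "?Y \<in> Alg D" "mstar ?Y = ?Y"
      using adm_s(1)[OF s] by (auto simp: pos_states_simps mstar_diff intro!: A.diff_closed)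
    \<comment> \<open>The weight \<open>\<kappa> / M\<close> lets half of the left-hand side absorb the first term on the right.\<close>
    have "2 * \<bar>A.ip ?Y ?Y\<bar> \<le> (\<kappa> / M) * (M * ?N) + action \<rho> B / (\<kappa> / M)"
      using \<kappa>(1) M(1) adm_s(1)
      by (intro curve_estimate[OF adm s Y] M(2) Y) (auto simp: pos_states_simps)
    also have "\<dots> = \<kappa> * ?N + M / \<kappa> * action \<rho> B" using \<kappa>(1) M(1) by (simp add: field_simps)
    finally have "2 * (\<kappa> * ?N) \<le> \<kappa> * ?N + M / \<kappa> * action \<rho> B" using \<kappa>(2)[OF Y(1)] by linarith
    then have "\<kappa> * ?N \<le> M / \<kappa> * action \<rho> B" by linarith
    then show ?thesis using \<kappa>(1) by (simp add: field_simps power2_eq_square)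
  qed
  moreover have "M / \<kappa>\<^sup>2 > 0" using \<kappa>(1) M(1) by simp
  ultimately show ?thesis by blast
qed

section \<open>The transport distance\<close>

text \<open>The value \<open>sqrt (Inf {})\<close> would be assigned to a pair of states that no admissible curve joins. Any other
  value is a genuine infimum of actions.\<close>

lemma Wpos_action:
  assumes W: "Wpos D x y \<noteq> sqrt (Inf {})"
  shows "0 \<le> Wpos D x y" and "e > 0 \<Longrightarrow> \<exists>\<rho> B. admissible D x y \<rho> B \<and> action \<rho> B < (Wpos D x y)\<^sup>2 + e"
proof -
  let ?S = "{action \<rho> B | \<rho> B. admissible D x y \<rho> B}"
  have WS: "Wpos D x y = sqrt (Inf ?S)" by (simp add: Wpos_def action_def)
  have ne: "?S \<noteq> {}" using W unfolding WS by metis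
  have nonneg: "0 \<le> Inf ?S" using ne action_qform(2) by (intro cInf_greatest) auto
  then show "0 \<le> Wpos D x y" unfolding WS by simp
  show "\<exists>\<rho> B. admissible D x y \<rho> B \<and> action \<rho> B < (Wpos D x y)\<^sup>2 + e" if "e > 0"
    using cInf_lessD[OF ne, of "Inf ?S + e"] that nonneg unfolding WS by auto
qed

lemma displacement_bounded_by_Wpos:
  "\<exists>C>0. \<forall>x y. Wpos D x y \<noteq> sqrt (Inf {}) \<longrightarrow> (norm (y - x))\<^sup>2 \<le> C * (Wpos D x y)\<^sup>2"
proof -
  obtain C where C: "C > 0" "\<And>x y \<rho> B s. admissible D x y \<rho> B \<Longrightarrow> s \<in> {0..1} \<Longrightarrow>
      (norm (\<rho> s - x))\<^sup>2 \<le> C * action \<rho> B"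
    using displacement_bounded_by_action by blast
  have "(norm (y - x))\<^sup>2 \<le> C * (Wpos D x y)\<^sup>2" if W: "Wpos D x y \<noteq> sqrt (Inf {})" for x y
  proof (rule field_le_epsilon)
    fix e :: real assume e: "e > 0"
    obtain \<rho> B where adm: "admissible D x y \<rho> B" "action \<rho> B < (Wpos D x y)\<^sup>2 + e / C"
      using Wpos_action(2)[OF W, of "e / C"] e C(1) by auto
    have "(norm (y - x))\<^sup>2 \<le> C * action \<rho> B"
      using C(2)[OF adm(1), of 1] admissible_simps(6)[OF adm(1), of 1] by simp
    also have "\<dots> \<le> C * ((Wpos D x y)\<^sup>2 + e / C)" using adm(2) C(1) by (intro mult_left_mono) auto
    also have "\<dots> = C * (Wpos D x y)\<^sup>2 + e" using C(1) by (simp add: field_simps)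
    finally show "(norm (y - x))\<^sup>2 \<le> C * (Wpos D x y)\<^sup>2 + e" .
  qed
  then show ?thesis using C(1) by blast
qed

text \<open>The values produced by an infimum over no curves and by a limit that does not exist or is not unique.
  Off this finite set the distance carries its intended meaning. Along a geodesic of nonzero speed the distance
  from the starting point is proportional to time, so it avoids a finite set at all but finitely many times.\<close>

definition exceptional :: "real set" where
  "exceptional = {sqrt (Inf {}), (THE l. False), (THE l. True)}"

text \<open>At boundary states the bound passes to the limit that defines the distance there.\<close>

lemma displacement_bounded_by_Wdist:
  "\<exists>C>0. \<forall>\<rho> \<nu>. Wdist D \<rho> \<nu> \<notin> exceptional \<longrightarrow> (norm (\<nu> - \<rho>))\<^sup>2 \<le> C * (Wdist D \<rho> \<nu>)\<^sup>2"
proof -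
  obtain C where C: "C > 0" "\<And>x y. Wpos D x y \<noteq> sqrt (Inf {}) \<Longrightarrow> (norm (y - x))\<^sup>2 \<le> C * (Wpos D x y)\<^sup>2"
    using displacement_bounded_by_Wpos by blast
  have "(norm (\<nu> - \<rho>))\<^sup>2 \<le> C * (Wdist D \<rho> \<nu>)\<^sup>2" if W: "Wdist D \<rho> \<nu> \<notin> exceptional" for \<rho> \<nu>
  proof (cases "\<rho> \<in> pos_states D \<and> \<nu> \<in> pos_states D")
    case True
    then show ?thesis using W C(2) by (simp add: Wdist_def exceptional_def)
  next
    case False
    let ?F = "at (\<rho>, \<nu>) within pos_states D \<times> pos_states D" and ?f = "\<lambda>(x, y). Wpos D x y"
    have Wd: "Wdist D \<rho> \<nu> = Lim ?F ?f" unfolding Wdist_def by (rule if_not_P[OF False])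
    have nontriv: "?F \<noteq> bot"
    proof
      assume "?F = bot"
      then have "(\<lambda>l. (?f \<longlongrightarrow> l) ?F) = (\<lambda>l. True)" by simp
      then have "Lim ?F ?f = (THE l. True)" unfolding t2_space_class.Lim_def by (rule arg_cong)
      then show False using W by (simp add: Wd exceptional_def)
    qed
    have "\<exists>l. (?f \<longlongrightarrow> l) ?F"
    proof (rule ccontr)
      assume "\<nexists>l. (?f \<longlongrightarrow> l) ?F"
      then have "(\<lambda>l. (?f \<longlongrightarrow> l) ?F) = (\<lambda>l. False)" by blast
      then have "Lim ?F ?f = (THE l. False)" unfolding t2_space_class.Lim_def by (rule arg_cong)
      then show False using W by (simp add: Wd exceptional_def)
    qed
    then have lim: "(?f \<longlongrightarrow> Wdist D \<rho> \<nu>) ?F" unfolding Wd using tendsto_Lim[OF nontriv] by blast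
    have "\<forall>\<^sub>F p in ?F. ?f p \<noteq> sqrt (Inf {})"
      using W by (intro tendsto_imp_eventually_ne[OF lim]) (simp add: exceptional_def)
    then have ev: "\<forall>\<^sub>F p in ?F. (norm (snd p - fst p))\<^sup>2 \<le> C * (?f p)\<^sup>2"
      by eventually_elim (auto simp: C(2))
    have "((\<lambda>p. (norm (snd p - fst p))\<^sup>2) \<longlongrightarrow> (norm (snd (\<rho>, \<nu>) - fst (\<rho>, \<nu>)))\<^sup>2) ?F"
      by (intro tendsto_intros)
    moreover have "((\<lambda>p. C * (?f p)\<^sup>2) \<longlongrightarrow> C * (Wdist D \<rho> \<nu>)\<^sup>2) ?F"
      by (intro tendsto_mult tendsto_power tendsto_const lim)
    ultimately have "(norm (snd (\<rho>, \<nu>) - fst (\<rho>, \<nu>)))\<^sup>2 \<le> C * (Wdist D \<rho> \<nu>)\<^sup>2"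
      using tendsto_le[OF nontriv _ _ ev] by blast
    then show ?thesis by simp
  qed
  then show ?thesis using C(1) by blast
qed

section \<open>From curvature to the logarithmic Sobolev inequality\<close>

lemma Ent_sigma: "Ent D (sig D) = 0"
  by (simp add: Ent_def A.trace_zero)

text \<open>The entropy lies above its tangent at \<open>\<rho>\<close>: the difference is the relative entropy of \<open>\<nu>\<close> with respect
  to \<open>\<rho>\<close>, which Klein's inequality shows to be nonnegative.\<close>

lemma Ent_tangent:
  assumes \<rho>: "\<rho> \<in> pos_states D" and \<nu>: "\<nu> \<in> states D"
  defines "X \<equiv> fcalc ln \<rho> - fcalc ln (sig D)"
  shows "Ent D \<rho> + A.ip X (\<nu> - \<rho>) \<le> Ent D \<nu>"
proof -
  note r = pos_states_simps(2,3)[OF \<rho>] and n = states_simps(1,2)[OF \<nu>]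
  have X: "X \<in> Alg D" "mstar X = X" unfolding X_def by (rule entropy_gradient[OF \<rho>])+
  have L: "fcalc ln \<nu> - fcalc ln \<rho> \<in> Alg D" using r n by (intro A.diff_closed A.fcalc_closed)
  have "0 \<le> Re (Tr D (\<nu> ** (fcalc ln \<nu> - fcalc ln \<rho>)))"
    using A.klein_inequality[OF n(1) states_simps(3)[OF \<nu>] r(1) pos_states_simps(4)[OF \<rho>]]
      states_simps(4)[OF \<nu>] pos_states_simps(5)[OF \<rho>] by simp
  moreover have "\<nu> ** (fcalc ln \<nu> - fcalc ln (sig D)) = \<nu> ** (fcalc ln \<nu> - fcalc ln \<rho>) + \<nu> ** X"
    by (simp add: X_def mmult.diff_right)
  then have "Ent D \<nu> = Re (Tr D (\<nu> ** (fcalc ln \<nu> - fcalc ln \<rho>))) + Re (Tr D (\<nu> ** X))"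
    using n L X by (simp add: Ent_def A.trace_add A.mult_closed)
  moreover have "Ent D \<rho> = Re (Tr D (\<rho> ** X))" by (simp add: Ent_def X_def)
  moreover have "A.ip X (\<nu> - \<rho>) = A.ip (\<nu> - \<rho>) X" using n r X by (intro A.ip_commute A.diff_closed)
  moreover have "A.ip (\<nu> - \<rho>) X = Re (Tr D (\<nu> ** X)) - Re (Tr D (\<rho> ** X))"
    using n r X by (simp add: A.ip_def mstar_diff mmult.diff_left A.trace_diff A.mult_closed)
  ultimately show ?thesis by linarith
qed

text \<open>If the two states have distance zero, then the curve that sits at \<open>\<rho>\<close> at time \<open>1/2\<close> and at \<open>\<sigma>\<close> at all
  other times is a constant speed geodesic of speed zero. Convexity along it bounds the entropy of its midpoint
  by those of its end points. The geodesic from \<open>\<rho>\<close> to \<open>\<sigma>\<close> supplies the other vanishing distances.\<close>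

lemma Ent_nonpos_of_zero_distance:
  assumes \<rho>: "\<rho> \<in> states D" and W: "Wdist D \<rho> (sig D) = 0"
    and geod: "Ric_geodesic_convex D lam" and all: "Ric_all_geodesics_convex D lam"
  shows "Ent D \<rho> \<le> 0"
proof -
  obtain \<gamma> where \<gamma>: "const_speed_geodesic D \<gamma>" "\<gamma> 0 = \<rho>" "\<gamma> 1 = sig D"
    using geod \<rho> sigma_state unfolding Ric_geodesic_convex_def by blast
  have W0: "Wdist D (\<gamma> s) (\<gamma> t) = 0" if "s \<in> {0..1}" "t \<in> {0..1}" for s t
    using \<gamma> that W by (simp add: const_speed_geodesic_def)
  have W1: "Wdist D \<rho> \<rho> = 0" "Wdist D (sig D) (sig D) = 0" "Wdist D (sig D) \<rho> = 0"
    using W0[of 0 0] W0[of 1 1] W0[of 1 0] \<gamma>(2,3) by auto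
  define \<delta> where "\<delta> t = (if t = 1 / 2 then \<rho> else sig D)" for t :: real
  have "const_speed_geodesic D \<delta>"
    using W W1 \<rho> sigma_state by (auto simp: const_speed_geodesic_def \<delta>_def)
  then have "Ent_convex_along D lam \<delta>" using all by (simp add: Ric_all_geodesics_convex_def)
  then have "Ent D (\<delta> (1 / 2)) \<le> (1 - 1 / 2) * Ent D (\<delta> 0) + 1 / 2 * Ent D (\<delta> 1)
      - lam / 2 * (1 / 2) * (1 - 1 / 2) * (Wdist D (\<delta> 0) (\<delta> 1))\<^sup>2"
    unfolding Ent_convex_along_def by (rule bspec) simp
  then show ?thesis by (simp add: \<delta>_def Ent_sigma W1)
qed

text \<open>Convexity bounds the entropy at time \<open>t\<close> from above, the tangent bounds it from below, and the curve
  estimate bounds the slope in terms of \<open>M\<close> and the distance \<open>t * W\<close>. With weight \<open>t / lam\<close> in the curve estimate the terms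
  \<open>lam / 2 * W\<^sup>2\<close> from the slope and from the convexity defect cancel to first order in \<open>t\<close>.\<close>

lemma short_time_estimate:
  assumes lam: "lam > 0" and \<rho>: "\<rho> \<in> pos_states D"
    and \<gamma>: "const_speed_geodesic D \<gamma>" "\<gamma> 0 = \<rho>" "\<gamma> 1 = sig D" "Ent_convex_along D lam \<gamma>"
    and t: "0 < t" "t < 1"
    and W: "W = Wdist D \<rho> (sig D)" "t * W \<notin> exceptional"
    and near: "\<gamma> t \<in> pos_states D"
    and M: "\<And>u s B. admissible D \<rho> (\<gamma> t) u B \<Longrightarrow> action u B < (t * W)\<^sup>2 + t ^ 3 \<Longrightarrow> s \<in> {0..1} \<Longrightarrow>
      qform (u s) (fcalc ln \<rho> - fcalc ln (sig D)) (fcalc ln \<rho> - fcalc ln (sig D)) \<le> M"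
  shows "Ent D \<rho> \<le> M / (2 * lam) + lam / 2 * (t * (1 + W\<^sup>2))"
proof -
  let ?X = "fcalc ln \<rho> - fcalc ln (sig D)"
  note X = entropy_gradient[OF \<rho>]
  have "Wdist D (\<gamma> 0) (\<gamma> t) = \<bar>0 - t\<bar> * Wdist D (\<gamma> 0) (\<gamma> 1)"
    using \<gamma>(1) t unfolding const_speed_geodesic_def by (metis atLeastAtMost_iff less_eq_real_def zero_le_one order_refl)
  then have Wt: "Wpos D \<rho> (\<gamma> t) = t * W" using \<gamma>(2,3) W(1) \<rho> near t by (simp add: Wdist_def)
  \<comment> \<open>The slack \<open>t ^ 3\<close> is divided by \<open>t\<^sup>2\<close> in the end, so it still vanishes as \<open>t\<close> tends to \<open>0\<close>.\<close>
  then obtain u B where adm: "admissible D \<rho> (\<gamma> t) u B" and a: "action u B < (t * W)\<^sup>2 + t ^ 3"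
    using Wpos_action(2)[of \<rho> "\<gamma> t" "t ^ 3"] W(2) t by (auto simp: exceptional_def)
  have "2 * \<bar>A.ip ?X (u 1 - \<rho>)\<bar> \<le> (t / lam) * M + action u B / (t / lam)"
    using t lam by (intro curve_estimate[OF adm _ X] M[OF adm a]) auto
  also have "\<dots> \<le> (t / lam) * M + ((t * W)\<^sup>2 + t ^ 3) / (t / lam)"
    using a t lam by (intro add_left_mono divide_right_mono) auto
  also have "\<dots> = t * (M / lam + lam * (W\<^sup>2 * 1 + t))"
    using t lam by (simp add: field_simps power2_eq_square power3_eq_cube)
  finally have 1: "- A.ip ?X (\<gamma> t - \<rho>) \<le> t * (M / lam + lam * (W\<^sup>2 + t)) / 2"
    using admissible_simps(6)[OF adm, of 1] by simp
  have "Ent D \<rho> + A.ip ?X (\<gamma> t - \<rho>) \<le> Ent D (\<gamma> t)"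
    by (rule Ent_tangent[OF \<rho> pos_states_simps(1)[OF near]])
  also have "\<dots> \<le> (1 - t) * Ent D (\<gamma> 0) + t * Ent D (\<gamma> 1) - lam / 2 * t * (1 - t) * (Wdist D (\<gamma> 0) (\<gamma> 1))\<^sup>2"
    using \<gamma>(4) t unfolding Ent_convex_along_def by (intro bspec[where x = t]) auto
  also have "\<dots> = Ent D \<rho> - t * Ent D \<rho> - lam / 2 * t * (1 - t) * W\<^sup>2"
    using \<gamma>(2,3) W(1) by (simp add: Ent_sigma algebra_simps)
  finally have "t * Ent D \<rho> \<le> t * (M / lam + lam * (W\<^sup>2 + t)) / 2 - lam / 2 * t * (1 - t) * W\<^sup>2"
    using 1 by linarith
  also have "\<dots> = t * (M / (2 * lam) + lam / 2 * (t * (1 + W\<^sup>2)))"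
    using lam by (simp add: field_simps)
  finally show ?thesis using t by simp
qed

text \<open>For positive distance, let \<open>t\<close> tend to \<open>0\<close> in the short time estimate: at small times the geodesic, and
  the almost optimal curves that join \<open>\<rho>\<close> to it, stay among positive definite states so close to \<open>\<rho>\<close> that the
  form at \<open>X\<close> exceeds its value at \<open>\<rho>\<close> by at most a prescribed amount.\<close>

lemma modified_log_sobolev:
  assumes lam: "lam > 0" and Ric: "Ric_geodesic_convex D lam" "Ric_all_geodesics_convex D lam"
    and \<rho>: "\<rho> \<in> pos_states D"
  defines "X \<equiv> fcalc ln \<rho> - fcalc ln (sig D)"
  shows "Ent D \<rho> \<le> qform \<rho> X X / (2 * lam)"
proof (cases "Wdist D \<rho> (sig D) = 0")
  case True
  have "X \<in> Alg D" unfolding X_def by (rule entropy_gradient[OF \<rho>])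
  then have "0 \<le> qform \<rho> X X / (2 * lam)"
    using qform_nonneg[OF pos_states_simps(1)[OF \<rho>]] lam by simp
  then show ?thesis
    using Ent_nonpos_of_zero_distance[OF pos_states_simps(1)[OF \<rho>] True Ric] by linarith
next
  case False
  define W where "W = Wdist D \<rho> (sig D)"
  have X: "X \<in> Alg D" unfolding X_def by (rule entropy_gradient[OF \<rho>])
  obtain \<gamma> where \<gamma>: "const_speed_geodesic D \<gamma>" "\<gamma> 0 = \<rho>" "\<gamma> 1 = sig D" "Ent_convex_along D lam \<gamma>"
    using Ric(1) pos_states_simps(1)[OF \<rho>] sigma_state unfolding Ric_geodesic_convex_def by blast
  obtain C1 where C1: "C1 > 0" "\<And>\<rho> \<nu>. Wdist D \<rho> \<nu> \<notin> exceptional \<Longrightarrow> (norm (\<nu> - \<rho>))\<^sup>2 \<le> C1 * (Wdist D \<rho> \<nu>)\<^sup>2"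
    using displacement_bounded_by_Wdist by blast
  obtain C2 where C2: "C2 > 0" "\<And>x y \<rho> B s. admissible D x y \<rho> B \<Longrightarrow> s \<in> {0..1} \<Longrightarrow>
      (norm (\<rho> s - x))\<^sup>2 \<le> C2 * action \<rho> B"
    using displacement_bounded_by_action by blast
  obtain a r where r: "r > 0" "\<And>Y l. mstar Y = Y \<Longrightarrow> norm (Y - \<rho>) < r \<Longrightarrow> posdef Y \<and> (l \<in> eigvals Y \<longrightarrow> a \<le> l)"
    using posdef_neighbourhood[OF pos_states_simps(4)[OF \<rho>]] by metis
  show ?thesis
  proof (rule field_le_epsilon)
    fix e :: real assume e: "e > 0"
    then have "e * (2 * lam) > 0" using lam by simp
    then obtain d where d: "d > 0" "\<And>\<nu>. \<nu> \<in> pos_states D \<Longrightarrow> norm (\<nu> - \<rho>) < d \<Longrightarrow>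
        qform \<nu> X X \<le> qform \<rho> X X + e * (2 * lam)"
      using qform_continuous[OF \<rho> X] by blast
    let ?M = "qform \<rho> X X + e * (2 * lam)"
    have lim: "((\<lambda>t. ?M / (2 * lam) + lam / 2 * (t * (1 + W\<^sup>2))) \<longlongrightarrow> ?M / (2 * lam) + lam / 2 * (0 * (1 + W\<^sup>2)))
        (at_right 0)"
      by (intro tendsto_intros)
    have small: "\<forall>\<^sub>F t in at_right 0. C1 * (t * W)\<^sup>2 < r\<^sup>2" "\<forall>\<^sub>F t in at_right 0. C2 * ((t * W)\<^sup>2 + t ^ 3) < d\<^sup>2"
    proof -
      have "((\<lambda>t. C1 * (t * W)\<^sup>2) \<longlongrightarrow> C1 * (0 * W)\<^sup>2) (at_right 0)"
        "((\<lambda>t. C2 * ((t * W)\<^sup>2 + t ^ 3)) \<longlongrightarrow> C2 * ((0 * W)\<^sup>2 + 0 ^ 3)) (at_right 0)"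
        by (intro tendsto_intros)+
      then show "\<forall>\<^sub>F t in at_right 0. C1 * (t * W)\<^sup>2 < r\<^sup>2" "\<forall>\<^sub>F t in at_right 0. C2 * ((t * W)\<^sup>2 + t ^ 3) < d\<^sup>2"
        using r(1) d(1) by (auto intro: order_tendstoD(2))
    qed
    have generic: "\<forall>\<^sub>F t in at_right 0. t * W \<notin> exceptional"
    proof -
      have "\<forall>\<^sub>F t in at_right 0. t * W \<noteq> c" for c
      proof (cases "c / W > 0")
        case True
        have "\<forall>\<^sub>F t in at_right 0. t < c / W" by (rule order_tendstoD(2)[OF tendsto_ident_at True])
        then show ?thesis by eventually_elim (use False W_def in auto)
      next
        case F: False
        have "\<forall>\<^sub>F t :: real in at_right 0. 0 < t" by (rule eventually_at_right_less)
        then show ?thesis by eventually_elim (use F False W_def in auto)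
      qed
      then show ?thesis by (simp add: exceptional_def eventually_conj_iff)
    qed
    have "\<forall>\<^sub>F t :: real in at_right 0. 0 < t" "\<forall>\<^sub>F t :: real in at_right 0. t < 1"
      by (rule eventually_at_right_less, rule order_tendstoD(2)[OF tendsto_ident_at zero_less_one])
    then have "\<forall>\<^sub>F t in at_right 0. Ent D \<rho> \<le> ?M / (2 * lam) + lam / 2 * (t * (1 + W\<^sup>2))"
      using small generic
    proof eventually_elim
      case (elim t)
      have st: "\<gamma> t \<in> states D" using \<gamma>(1) elim(1,2) by (simp add: const_speed_geodesic_def)
      have "Wdist D (\<gamma> 0) (\<gamma> t) = \<bar>0 - t\<bar> * Wdist D (\<gamma> 0) (\<gamma> 1)"
        using \<gamma>(1) elim(1,2) unfolding const_speed_geodesic_def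
        by (metis atLeastAtMost_iff less_eq_real_def zero_le_one order_refl)
      then have Wt: "Wdist D \<rho> (\<gamma> t) = t * W" using \<gamma>(2,3) elim(1) by (simp add: W_def)
      have "(norm (\<gamma> t - \<rho>))\<^sup>2 \<le> C1 * (t * W)\<^sup>2" using C1(2)[of \<rho> "\<gamma> t"] elim(5) by (simp add: Wt)
      then have "(norm (\<gamma> t - \<rho>))\<^sup>2 < r\<^sup>2" using elim(3) by linarith
      then have "norm (\<gamma> t - \<rho>) < r" using r(1) by (simp add: power2_less_imp_less)
      then have near: "\<gamma> t \<in> pos_states D"
        using r(2)[OF states_simps(2)[OF st]] states_simps(1,4)[OF st] by (simp add: pos_states_def)
      show ?case
      proof (rule short_time_estimate[OF lam \<rho> \<gamma> elim(1,2) W_def elim(5) near])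
        fix u B and s :: real assume u: "admissible D \<rho> (\<gamma> t) u B" "action u B < (t * W)\<^sup>2 + t ^ 3" "s \<in> {0..1}"
        have "(norm (u s - \<rho>))\<^sup>2 \<le> C2 * action u B" by (rule C2(2)[OF u(1,3)])
        also have "\<dots> \<le> C2 * ((t * W)\<^sup>2 + t ^ 3)" using u(2) C2(1) by simp
        also have "\<dots> < d\<^sup>2" by (rule elim(4))
        finally have "norm (u s - \<rho>) < d" using d(1) by (simp add: power2_less_imp_less)
        then show "qform (u s) (fcalc ln \<rho> - fcalc ln (sig D)) (fcalc ln \<rho> - fcalc ln (sig D)) \<le> ?M"
          using d(2)[OF admissible_simps(1)[OF u(1,3)]] by (simp add: X_def)
      qed
    qed
    then have "Ent D \<rho> \<le> ?M / (2 * lam) + lam / 2 * (0 * (1 + W\<^sup>2))"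
      by (intro tendsto_lowerbound[OF lim]) auto
    then show "Ent D \<rho> \<le> qform \<rho> X X / (2 * lam) + e" using lam by (simp add: add_divide_distrib)
  qed
qed

end

theorem theorem11p4:
  fixes D :: "('n::finite, 'm::finite, 'j) diff_struct" and lam :: real
  assumes "differential_structure D"
    and "ergodic D"
    and "lam > 0"
    and "Ric_ge D lam"
  shows "\<forall>\<rho>\<in>states D. ereal (Ent D \<rho>) \<le> ereal (1 / (2 * lam)) * Fisher D \<rho>"
proof
  fix \<rho> assume \<rho>: "\<rho> \<in> states D"
  interpret differential D by (rule differential.intro) (rule assms(1))
  show "ereal (Ent D \<rho>) \<le> ereal (1 / (2 * lam)) * Fisher D \<rho>"
  proof (cases "\<rho> \<in> pos_states D")
    case True
    show ?thesis
      using modified_log_sobolev[OF assms(3) _ _ True] assms(4) by (simp add: Fisher_qform[OF True] Ric_ge_def)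
  next
    case False
    then show ?thesis using assms(3) by (simp add: Fisher_def)
  qed
qed

end
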